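(* Let $F_1(x;\tau)$ be the limiting one-point distribution function of the periodic TASEP with flat initial condition, defined in the context, and let $F_{\rm GOE}$ be the GOE Tracy–Widom distribution. For every $x_0\in\mathbb R$ there exist constants $C,c,\epsilon>0$ and $\tau_0>0$ such that $$\left|F_1(\tau^{1/3}x;\tau)-F_{\rm GOE}(2^{2/3}x)\right|\le Ce^{-\epsilon\tau^{-2/3}}e^{-c(x-x_0)},\qquad0<\tau<\tau_0,\ x\ge x_0 .$$ In particular, $\lim_{\tau\to0}F_1(\tau^{1/3}x;\tau)=F_{\rm GOE}(2^{2/3}x)$.
   Context: Roots and logarithms are principal. $F_{\rm GOE}(x)=\det(\mathbf I-\mathbf A_x)_{L^2(0,\infty)}$, where $\mathbf A_x$ has kernel $\mathrm{Ai}(s+x+t)$. $\mathrm{Li}_s(z)=\sum_{k\ge1}z^k/k^s$ for $|z|<1$, continued analytically to $\mathbb C\setminus[1,\infty)$. For $|z|<1$: $A_1(z)=-\frac1{\sqrt{2\pi}}\mathrm{Li}_{3/2}(z)$, $A_2(z)=-\frac1{\sqrt{2\pi}}\mathrm{Li}_{5/2}(z)$, $A_3(z)=-\frac14\log(1-z)$, $B(z)=\frac1{4\pi}\int_0^z\frac{(\mathrm{Li}_{1/2}(y))^2}{y}dy$. For $0<|z|<1$, $\mathcal S_-=\{\xi\in\mathbb C:e^{-\xi^2/2}=z,\ \mathrm{Re}\,\xi<0\}$, a subset of the sector $3\pi/4<\arg\xi<5\pi/4$; in that sector $Q(\xi)=\sqrt{2/\pi}\int_{-\infty}^\xi\mathrm{Li}_{1/2}(e^{-s^2/2})ds$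 (path in the sector) and $\Psi(\xi)=\Psi(\xi;x,\tau)=-\frac13\tau\xi^3+x\xi-\frac12Q(\xi)$. $\mathbf K^{(1)}_z$ is the operator on $\ell^2(\mathcal S_-)$ with kernel $$\mathbf K_z^{(1)}(\xi_1,\xi_2)=\frac{e^{\Psi(\xi_1)+\Psi(\xi_2)}}{\xi_1(\xi_1+\xi_2)}$$ (conjugate to the kernel $-\frac{e^{\Psi(\xi_1)+\Psi(\xi_2)}}{\sqrt{-\xi_1}\sqrt{-\xi_2}(\xi_1+\xi_2)}$, with the same Fredholm determinant). For $\tau>0$, $x\in\mathbb R$, $$F_1(x;\tau)=\oint_{|z|=R}e^{xA_1(z)+\tau A_2(z)+A_3(z)+B(z)}\det(\mathbf I-\mathbf K_z^{(1)})\frac{dz}{2\pi iz},$$ with any $0<R<1$, counterclockwise. *)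

theory Defs
  imports
    "HOL-Complex_Analysis.Complex_Analysis"
    "Jordan_Normal_Form.Determinant"
begin

(* The Fredholm determinant det(I - K) on L^2(M), given by its Fredholm expansion
     sum over n of (-1)^n / n! * (integral of det [K (x_i) (x_j)]_{i,j<n} over M^n).
   For M = count_space S this is the determinant on l^2(S).  JNF's matrices are used because
   the size n varies; mat and det are qualified to separate them from those of HOL-Analysis. *)
definition fredholm_det ::
    "'a measure \<Rightarrow> ('a \<Rightarrow> 'a \<Rightarrow> 'b) \<Rightarrow> 'b::{real_normed_field,banach,second_countable_topology}" where
  "fredholm_det M K =
     (\<Sum>n. (- 1) ^ n / fact n *
        (\<integral>u. Determinant.det (Matrix.mat n n (\<lambda>(i, j). K (u i) (u j)))
           \<partial>(\<Pi>\<^sub>M i\<in>{..<n}. M)))"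

(* Ai(x) = 1/pi * (integral over (0,\<infinity>) of cos (t^3/3 + x t)), which converges only improperly. *)
definition airy_Ai :: "real \<Rightarrow> real" where
  "airy_Ai x = Lim at_top (\<lambda>T. integral {0..T} (\<lambda>t. cos (t ^ 3 / 3 + x * t))) / pi"

definition F_GOE :: "real \<Rightarrow> real" where
  "F_GOE x = fredholm_det (restrict_space lborel {0<..}) (\<lambda>s t. airy_Ai (s + x + t))"

definition polylog_series :: "real \<Rightarrow> complex \<Rightarrow> complex" where
  "polylog_series s z = (\<Sum>k. z ^ Suc k / of_real (real (Suc k) powr s))"

(* Outside the unit disc: the analytic continuation to the plane cut along [1,\<infinity>)
   (the value on the cut itself is unspecified). *)
definition Li :: "real \<Rightarrow> complex \<Rightarrow> complex" where
  "Li s z =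
     (if norm z < 1 then polylog_series s z
      else (THE w. \<exists>f. f holomorphic_on (- complex_of_real ` {1..}) \<and>
                       (\<forall>u. norm u < 1 \<longrightarrow> f u = polylog_series s u) \<and>
                       z \<notin> complex_of_real ` {1..} \<and> w = f z))"

definition A1 :: "complex \<Rightarrow> complex" where
  "A1 z = - (1 / of_real (sqrt (2 * pi))) * Li (3/2) z"

definition A2 :: "complex \<Rightarrow> complex" where
  "A2 z = - (1 / of_real (sqrt (2 * pi))) * Li (5/2) z"

definition A3 :: "complex \<Rightarrow> complex" where
  "A3 z = - (1/4) * Ln (1 - z)"

definition B_fun :: "complex \<Rightarrow> complex" where
  "B_fun z = 1 / (4 * of_real pi) * contour_integral (linepath 0 z) (\<lambda>y. (Li (1/2) y)\<^sup>2 / y)"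

definition S_minus :: "complex \<Rightarrow> complex set" where
  "S_minus z = {\<xi>. exp (- (\<xi>\<^sup>2) / 2) = z \<and> Re \<xi> < 0}"

(* The sector 3*pi/4 < arg < 5*pi/4 is convex, so for \<xi> in it the segment from -T to \<xi> is a path
   in the sector; letting T tend to infinity gives the integral from -\<infinity> to \<xi>. *)
definition Q_fun :: "complex \<Rightarrow> complex" where
  "Q_fun \<xi> = of_real (sqrt (2 / pi)) *
     Lim at_top (\<lambda>T. contour_integral (linepath (- of_real T) \<xi>)
                       (\<lambda>s. Li (1/2) (exp (- (s\<^sup>2) / 2))))"

definition Psi :: "real \<Rightarrow> real \<Rightarrow> complex \<Rightarrow> complex" where
  "Psi x \<tau> \<xi> = - (1/3) * of_real \<tau> * \<xi> ^ 3 + of_real x * \<xi> - (1/2) * Q_fun \<xi>"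

definition K1 :: "real \<Rightarrow> real \<Rightarrow> complex \<Rightarrow> complex \<Rightarrow> complex" where
  "K1 x \<tau> \<xi>1 \<xi>2 = exp (Psi x \<tau> \<xi>1 + Psi x \<tau> \<xi>2) / (\<xi>1 * (\<xi>1 + \<xi>2))"

(* F_1(x;\<tau>) computed on the circle of radius R.  Its value does not depend on R in (0,1), but as
   that is a theorem R is kept as a parameter.  The value is complex because it is a contour
   integral. *)
definition F1 :: "real \<Rightarrow> real \<Rightarrow> real \<Rightarrow> complex" where
  "F1 R x \<tau> =
     contour_integral (circlepath 0 R)
       (\<lambda>z. exp (of_real x * A1 z + of_real \<tau> * A2 z + A3 z + B_fun z)
             * fredholm_det (count_space (S_minus z)) (K1 x \<tau>)
             / (2 * of_real pi * \<i> * z))"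

end

theory Submission
  imports Defs
begin

text \<open>
  Write z = exp (- \<zeta>) and w = csqrt (2 \<zeta>): the points of S_minus z are the numbers - csqrt (2 \<zeta>_k)
  with \<zeta>_k = \<zeta> + 2 \<pi> i k.  Since 1 / (w + w') is the Laplace integral of exp (- s (w + w')), the kernel
  K1 factors through L^2(0, \<infinity>), and det (I - A B) = det (I - B A) turns the determinant on S_minus z
  into one on the half line with the Hankel kernel H_z(s + t), where H_z is a single sum over k.  With
  h = (2 \<tau>)^(2/3) and u = sqrt h w this sum is a trapezoidal sum of step 2 \<pi> h for the Airy contour
  integral of exp (u^3/3 - m u), perturbed by the factor exp (- Q) = 1 + O(z).

  Hadamard's inequality makes the determinants holomorphic in 0 < |z| < 1, so the contour may be moved to
  |z| = exp (- 2 / h).  There the trapezoidal sum is exponentially close to the Airy function, by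
  Cauchy's formula on the annulus between exp (- 4 / h) and exp (- 1 / h).  The exponential prefactor is
  holomorphic on the disc and equals 1 at z = 0, so its mean over the circle is 1 and
  F1 - F_GOE is the mean of the prefactor times the difference of the two determinants.
\<close>

section \<open>Determinants and Hadamard's inequality\<close>

text \<open>The circle must shrink with \<open>\<tau>\<close>. On a fixed circle |z| = R the nodes
  satisfy Re (u^2) = - 2 h ln R, which tends to 0: the contour degenerates to the imaginary axis,
  where the Airy integrand has modulus 1. On |z| = exp (- 2 / h) one has Re (u^2) = 4 for every h,
  so all estimates are uniform. Moving the circle needs holomorphy in z, but
  \<open>S_minus z\<close> varies with z; after the exchange of the factors the determinant lives on
  the fixed space L^2(0, \<infinity>). A bound on the prefactor minus 1 would not be enough:
  \<open>F_GOE\<close> tends to 1 as x grows, so that error would not decay in x. Taking the mean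
  removes it exactly. Rates: the factor exp (- Q) costs O(exp (- 2 / h)) and the annulus costs O(exp
  (- 1 / h)), both with a factor 1 / h from the suprema. Half of the exponent pays for 1 / h, which
  leaves exp (- 1 / (2 h)), that is \<open>\<epsilon>\<close> = 2^(-2/3) / 2.\<close>

definition detn :: "nat \<Rightarrow> (nat \<Rightarrow> nat \<Rightarrow> 'a::comm_ring_1) \<Rightarrow> 'a" where
  "detn n a = Determinant.det (Matrix.mat n n (\<lambda>(i, j). a i j))"

lemma detn_leibniz:
  "detn n a = (\<Sum>p | p permutes {..<n}. signof p * (\<Prod>i<n. a i (p i)))"
proof -
  have "detn n a = (\<Sum>p | p permutes {0..<n}. signof p * (\<Prod>i = 0..<n. Matrix.mat n n (\<lambda>(i, j). a i j) $$ (i, p i)))"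
    unfolding detn_def by (rule Determinant.det_def') simp
  also have "\<dots> = (\<Sum>p | p permutes {0..<n}. signof p * (\<Prod>i = 0..<n. a i (p i)))"
    by (intro sum.cong prod.cong refl arg_cong2[where f="(*)"]) (auto simp: permutes_in_image)
  finally show ?thesis by (simp add: atLeast0LessThan)
qed

lemma detn_cong:
  assumes "\<And>i j. i < n \<Longrightarrow> j < n \<Longrightarrow> a i j = b i j"
  shows "detn n a = detn n b"
  unfolding detn_def by (intro arg_cong[where f=Determinant.det] eq_matI) (auto simp: assms)

text \<open>Every permutation product contains each \<open>f i\<close> and each \<open>g j\<close>
  exactly once. This is how the weights of a kernel are pulled out of its determinants.\<close>

lemma detn_scale:
  "detn n (\<lambda>i j. f i * g j * a i j) = (\<Prod>i<n. f i) * (\<Prod>i<n. g i) * detn n a"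
proof -
  have "(\<Prod>i<n. f i * g (p i) * a i (p i)) = (\<Prod>i<n. f i) * (\<Prod>i<n. g i) * (\<Prod>i<n. a i (p i))"
    if "p permutes {..<n}" for p
    using prod.permute[OF that, of g] by (simp add: prod.distrib o_def)
  then show ?thesis
    unfolding detn_leibniz by (simp add: sum_distrib_left mult_ac)
qed

lemma detn_of_real:
  "detn n (\<lambda>i j. of_real (a i j) :: complex) = of_real (detn n a)"
  unfolding detn_leibniz by (simp add: sign_def)

lemma detn_addrow:
  assumes "k < n" "l < n" "k \<noteq> l"
  shows "detn n (\<lambda>i j. if i = k then c * a l j + a k j else a i j) = detn n a"
proof -
  let ?A = "Matrix.mat n n (\<lambda>(i, j). a i j)"
  have "Matrix.mat n n (\<lambda>(i, j). if i = k then c * a l j + a k j else a i j) = addrow c k l ?A"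
    using assms by (intro eq_matI) auto
  then show ?thesis
    unfolding detn_def using det_addrow[of l n k ?A c] assms by auto
qed

definition row_inner :: "nat \<Rightarrow> (nat \<Rightarrow> nat \<Rightarrow> complex) \<Rightarrow> nat \<Rightarrow> nat \<Rightarrow> complex" where
  "row_inner n a i k = (\<Sum>j<n. a i j * cnj (a k j))"

lemma row_inner_self: "row_inner n a i i = of_real (\<Sum>j<n. (cmod (a i j))\<^sup>2)"
  by (simp only: row_inner_def complex_norm_square[symmetric] of_real_sum of_real_power)

lemma row_inner_cnj: "row_inner n a k i = cnj (row_inner n a i k)"
  by (simp add: row_inner_def mult.commute)

lemma row_inner_self_0: "row_inner n a l l = 0 \<Longrightarrow> j < n \<Longrightarrow> a l j = 0"
  unfolding row_inner_self by (subst (asm) of_real_eq_0_iff, subst (asm) sum_nonneg_eq_0_iff) auto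

text \<open>One Gram-Schmidt step: the projection of row k on row l is subtracted from row k. What
  is left is orthogonal to the removed part, so the norm of row k can only drop. The last conclusion
  keeps row k orthogonal to any row to which both rows k and l were orthogonal.\<close>

lemma orthogonalize_step:
  assumes kl: "k < n" "l < k"
  obtains b where "detn n b = detn n a"
    "\<And>i. i \<noteq> k \<Longrightarrow> b i = a i"
    "\<And>i. Re (row_inner n b i i) \<le> Re (row_inner n a i i)"
    "row_inner n b k l = 0"
    "\<And>i. i < k \<Longrightarrow> row_inner n a k i = 0 \<Longrightarrow> row_inner n a l i = 0 \<Longrightarrow> row_inner n b k i = 0"
proof -
  define r where "r = row_inner n a l l"
  define s where "s = row_inner n a k l"
  \<comment> \<open>If row l vanishes, then r = 0 and division by zero gives c = 0; since s = 0 as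
    well, \<open>cr\<close> still holds.\<close>
  define c where "c = - s / r"
  define b where "b = (\<lambda>i j. if i = k then c * a l j + a k j else a i j)"
  have det: "detn n b = detn n a" unfolding b_def using kl by (intro detn_addrow) auto
  have other: "b i = a i" if "i \<noteq> k" for i using that by (auto simp: b_def)
  have ipk: "row_inner n b k i = c * row_inner n a l i + row_inner n a k i" if "i \<noteq> k" for i
    using that unfolding row_inner_def b_def
    by (simp add: sum_distrib_left sum.distrib[symmetric] algebra_simps)
  have s0: "s = 0" if "r = 0"
    unfolding s_def row_inner_def using row_inner_self_0[OF that[unfolded r_def]] by simp
  have cr: "c * r = - s" using s0 by (auto simp: c_def)
  have orth: "row_inner n b k l = 0" using ipk[of l] kl cr by (simp add: r_def s_def)
  have "row_inner n b k k = c * cnj c * r + c * cnj s + cnj c * s + row_inner n a k k"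
    unfolding row_inner_def b_def r_def s_def
    by (simp add: sum_distrib_left sum.distrib algebra_simps)
  also have "c * cnj c * r = - (cnj c * s)" using cr by (metis mult.assoc mult.commute mult_minus_right)
  finally have kk: "row_inner n b k k = row_inner n a k k + c * cnj s" by simp
  have rr: "r = of_real (Re r)" "Re r \<ge> 0" unfolding r_def row_inner_self by (auto intro: sum_nonneg)
  \<comment> \<open>Pythagoras: the squared norm changes by minus the squared length of the removed
    projection.\<close>
  have "c * cnj s = of_real (- (cmod s)\<^sup>2 / Re r)"
    unfolding c_def using rr(1)
    by (metis (no_types, lifting) complex_norm_square minus_divide_left mult_minus_left of_real_divide
        of_real_minus of_real_power times_divide_eq_left)
  then have "Re (row_inner n b k k) \<le> Re (row_inner n a k k)"
    using kk rr(2) by simp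
  then have mono: "Re (row_inner n b i i) \<le> Re (row_inner n a i i)" for i
    using other[of i] by (cases "i = k") (auto simp: row_inner_def)
  show ?thesis
    by (rule that[OF det other mono orth]) (auto simp: ipk)
qed

text \<open>Row k is cleaned against the rows before it in turn. These are already orthogonal to
  each other, so removing the component along a new one leaves the earlier inner products of row k
  at 0.\<close>

lemma orthogonalize_row:
  assumes "k < n" "\<And>i j. i < k \<Longrightarrow> j < k \<Longrightarrow> i \<noteq> j \<Longrightarrow> row_inner n a i j = 0" "l \<le> k"
  shows "\<exists>b. detn n b = detn n a \<and> (\<forall>i. i \<noteq> k \<longrightarrow> b i = a i)
    \<and> (\<forall>i. Re (row_inner n b i i) \<le> Re (row_inner n a i i)) \<and> (\<forall>i<l. row_inner n b k i = 0)"
  using assms(3)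
proof (induction l)
  case 0
  then show ?case by (intro exI[of _ a]) auto
next
  case (Suc l)
  then obtain b where b: "detn n b = detn n a" "\<And>i. i \<noteq> k \<Longrightarrow> b i = a i"
    "\<And>i. Re (row_inner n b i i) \<le> Re (row_inner n a i i)" "\<And>i. i < l \<Longrightarrow> row_inner n b k i = 0" by auto
  obtain c where c: "detn n c = detn n b" "\<And>i. i \<noteq> k \<Longrightarrow> c i = b i"
    "\<And>i. Re (row_inner n c i i) \<le> Re (row_inner n b i i)" "row_inner n c k l = 0"
    "\<And>i. i < k \<Longrightarrow> row_inner n b k i = 0 \<Longrightarrow> row_inner n b l i = 0 \<Longrightarrow> row_inner n c k i = 0"
    using orthogonalize_step[of k n l b] assms(1) Suc.prems by (metis Suc_le_eq)
  have "row_inner n c k i = 0" if "i < Suc l" for i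
  proof (cases "i = l")
    case False
    have "row_inner n b l i = row_inner n a l i" using Suc.prems that by (simp add: row_inner_def b(2))
    also have "\<dots> = 0" using assms(2)[of l i] False that Suc.prems by auto
    finally show ?thesis using c(5)[of i] b(4)[of i] False that Suc.prems by auto
  qed (use c in auto)
  moreover have "Re (row_inner n c i i) \<le> Re (row_inner n a i i)" for i using b(3)[of i] c(3)[of i] by simp
  ultimately show ?case using b c by (intro exI[of _ c]) auto
qed

lemma orthogonalize:
  assumes "k \<le> n"
  shows "\<exists>b. detn n b = detn n a \<and> (\<forall>i. Re (row_inner n b i i) \<le> Re (row_inner n a i i))
    \<and> (\<forall>i<k. \<forall>j<k. i \<noteq> j \<longrightarrow> row_inner n b i j = 0)"
  using assms
proof (induction k)
  case 0
  then show ?case by (intro exI[of _ a]) auto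
next
  case (Suc k)
  then obtain b where b: "detn n b = detn n a" "\<And>i. Re (row_inner n b i i) \<le> Re (row_inner n a i i)"
    "\<And>i j. i < k \<Longrightarrow> j < k \<Longrightarrow> i \<noteq> j \<Longrightarrow> row_inner n b i j = 0" by auto
  obtain c where c: "detn n c = detn n b" "\<And>i. i \<noteq> k \<Longrightarrow> c i = b i"
    "\<And>i. Re (row_inner n c i i) \<le> Re (row_inner n b i i)" "\<And>i. i < k \<Longrightarrow> row_inner n c k i = 0"
    using orthogonalize_row[of k n b k] b(3) Suc.prems by auto
  have "row_inner n c i j = 0" if "i < Suc k" "j < Suc k" "i \<noteq> j" for i j
  proof (cases "i = k \<or> j = k")
    case True
    then show ?thesis using c(4) that row_inner_cnj[of n c i j] by (auto simp: less_Suc_eq)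
  next
    case False
    then have "row_inner n c i j = row_inner n b i j" by (simp add: row_inner_def c(2))
    then show ?thesis using b(3) False that by auto
  qed
  moreover have "Re (row_inner n c i i) \<le> Re (row_inner n a i i)" for i using b(2)[of i] c(3)[of i] by simp
  ultimately show ?case using b c by (intro exI[of _ c]) auto
qed

text \<open>For pairwise orthogonal rows the matrix times its conjugate transpose is diagonal, with
  the squared row norms on the diagonal, and equality holds. Gram-Schmidt reduces to this case,
  since it keeps the determinant and increases no row norm.\<close>

lemma hadamard_inequality:
  "(cmod (detn n a))\<^sup>2 \<le> (\<Prod>i<n. \<Sum>j<n. (cmod (a i j))\<^sup>2)"
proof -
  obtain b where b: "detn n b = detn n a" "\<And>i. Re (row_inner n b i i) \<le> Re (row_inner n a i i)"
    "\<And>i j. i < n \<Longrightarrow> j < n \<Longrightarrow> i \<noteq> j \<Longrightarrow> row_inner n b i j = 0"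
    using orthogonalize[of n n a] by auto
  let ?B = "Matrix.mat n n (\<lambda>(i, j). b i j)" and ?C = "Matrix.mat n n (\<lambda>(i, j). cnj (b j i))"
  have "Determinant.det ?C = Determinant.det (transpose_mat ?C)"
    by (rule det_transpose[symmetric, of _ n]) simp
  also have "transpose_mat ?C = Matrix.mat n n (\<lambda>(i, j). cnj (b i j))"
    by (intro eq_matI) auto
  also have "Determinant.det \<dots> = cnj (detn n b)"
    unfolding detn_def[symmetric] detn_leibniz by (simp add: sign_def)
  finally have detC: "Determinant.det ?C = cnj (detn n b)" .
  have BC: "?B * ?C = Matrix.mat n n (\<lambda>(i, j). row_inner n b i j)"
    by (intro eq_matI) (auto simp: scalar_prod_def row_inner_def atLeast0LessThan)
  have "detn n b * cnj (detn n b) = Determinant.det (?B * ?C)"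
    using det_mult[of ?B n ?C] detC by (simp add: detn_def)
  also have "\<dots> = prod_list (diag_mat (?B * ?C))"
    by (rule det_upper_triangular[of _ n]) (auto simp: BC b(3))
  also have "\<dots> = (\<Prod>i<n. row_inner n b i i)"
    unfolding BC by (simp add: prod_list_diag_prod atLeast0LessThan)
  finally have "of_real ((cmod (detn n b))\<^sup>2) = (\<Prod>i<n. row_inner n b i i)"
    by (simp only: complex_norm_square)
  also have "\<dots> = of_real (\<Prod>i<n. \<Sum>j<n. (cmod (b i j))\<^sup>2)" by (simp add: row_inner_self)
  finally have "(cmod (detn n b))\<^sup>2 = (\<Prod>i<n. \<Sum>j<n. (cmod (b i j))\<^sup>2)"
    by (simp only: of_real_eq_iff)
  also have "\<dots> \<le> (\<Prod>i<n. \<Sum>j<n. (cmod (a i j))\<^sup>2)"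
    using b(2) by (intro prod_mono) (auto simp: row_inner_self intro: sum_nonneg)
  finally show ?thesis using b(1) by simp
qed

text \<open>Up to an exponential, \<open>sqrt (real n) ^ n\<close> grows like the square root of n!,
  which the n! of the Fredholm series beats. The bound may differ from row to row so that a single
  small row, as in a difference of determinants, can be exploited.\<close>

lemma hadamard_rows:
  assumes "\<And>i j. i < n \<Longrightarrow> j < n \<Longrightarrow> cmod (a i j) \<le> c i" and c: "\<And>i. i < n \<Longrightarrow> 0 \<le> c i"
  shows "cmod (detn n a) \<le> sqrt (real n) ^ n * (\<Prod>i<n. c i)"
proof -
  have "(cmod (detn n a))\<^sup>2 \<le> (\<Prod>i<n. \<Sum>j<n. (cmod (a i j))\<^sup>2)" by (rule hadamard_inequality)
  also have "\<dots> \<le> (\<Prod>i<n. real n * (c i)\<^sup>2)"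
  proof (intro prod_mono conjI sum_nonneg)
    fix i assume "i \<in> {..<n}"
    then have "(\<Sum>j<n. (cmod (a i j))\<^sup>2) \<le> (\<Sum>j<n. (c i)\<^sup>2)"
      using assms by (intro sum_mono power_mono) auto
    then show "(\<Sum>j<n. (cmod (a i j))\<^sup>2) \<le> real n * (c i)\<^sup>2" by simp
  qed auto
  also have "\<dots> = (sqrt (real n) ^ n * (\<Prod>i<n. c i))\<^sup>2"
    by (simp add: prod.distrib power_mult_distrib prod_power_distrib power2_eq_square
        flip: power_mult_distrib)
  finally show ?thesis using c
    by (meson power2_le_imp_le mult_nonneg_nonneg prod_nonneg zero_le_power real_sqrt_ge_zero of_nat_0_le_iff lessThan_iff)
qed

lemma detn_diff_row:
  assumes "k < n"
  shows "detn n (a(k := u)) - detn n (a(k := v)) = detn n (a(k := (\<lambda>j. u j - v j)))"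
proof -
  have "(\<Prod>i<n. (a(k := w)) i (p i)) = w (p k) * (\<Prod>i\<in>{..<n} - {k}. a i (p i))" for w p
    using assms by (subst prod.remove[of _ k]) (auto intro!: prod.cong)
  then show ?thesis
    unfolding detn_leibniz by (simp add: sum_subtractf[symmetric] algebra_simps)
qed

text \<open>Exchange the rows of a for those of b one at a time.\<close>
lemma detn_diff_bound:
  assumes a: "\<And>i j. i < n \<Longrightarrow> j < n \<Longrightarrow> cmod (a i j) \<le> M"
    and b: "\<And>i j. i < n \<Longrightarrow> j < n \<Longrightarrow> cmod (b i j) \<le> M"
    and d: "\<And>i j. i < n \<Longrightarrow> j < n \<Longrightarrow> cmod (a i j - b i j) \<le> e"
    and n: "0 < n" and M: "0 \<le> M"
  shows "cmod (detn n a - detn n b) \<le> real n * (sqrt (real n) ^ n * M ^ (n - 1) * e)"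
proof -
  have e: "0 \<le> e" using d[of 0 0] n norm_ge_zero order_trans by blast
  define c where "c k = (\<lambda>i. if i < k then b i else a i)" for k
  have step: "cmod (detn n (c k) - detn n (c (Suc k))) \<le> sqrt (real n) ^ n * M ^ (n - 1) * e"
    if k: "k < n" for k
  proof -
    have "c k = (c k)(k := a k)" "c (Suc k) = (c k)(k := b k)"
      by (auto simp: c_def fun_eq_iff)
    then have "detn n (c k) - detn n (c (Suc k)) = detn n ((c k)(k := (\<lambda>j. a k j - b k j)))"
      using detn_diff_row[OF k, of "c k" "a k" "b k"] by simp
    also have "cmod \<dots> \<le> sqrt (real n) ^ n * (\<Prod>i<n. if i = k then e else M)"
      using a b d e M by (intro hadamard_rows) (auto simp: c_def)
    also have "(\<Prod>i<n. if i = k then e else M) = e * M ^ (n - 1)"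
      using k by (subst prod.remove[of _ k]) auto
    finally show ?thesis by (simp add: mult_ac)
  qed
  have ab: "detn n a = detn n (c 0)" "detn n b = detn n (c n)"
    by (auto simp: c_def intro: detn_cong)
  have "detn n a - detn n b = (\<Sum>k<n. detn n (c k) - detn n (c (Suc k)))"
    unfolding ab by (simp add: sum_lessThan_telescope'[where f="\<lambda>k. detn n (c k)"])
  also have "cmod \<dots> \<le> (\<Sum>k<n. sqrt (real n) ^ n * M ^ (n - 1) * e)"
    using step by (intro sum_norm_le) auto
  finally show ?thesis by simp
qed

section \<open>Fredholm determinants\<close>

definition fredholm_term :: "'a measure \<Rightarrow> ('a \<Rightarrow> 'a \<Rightarrow> 'b) \<Rightarrow> nat \<Rightarrow> 'b::{real_normed_field,banach,second_countable_topology}" where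
  "fredholm_term M K n = (\<integral>u. detn n (\<lambda>i j. K (u i) (u j)) \<partial>(\<Pi>\<^sub>M i\<in>{..<n}. M))"

lemma fredholm_det_alt:
  "fredholm_det M K = (\<Sum>n. (- 1) ^ n / fact n * fredholm_term M K n)"
  unfolding fredholm_det_def fredholm_term_def detn_def ..

lemma fredholm_term_cong:
  assumes "\<And>x y. x \<in> space M \<Longrightarrow> y \<in> space M \<Longrightarrow> K x y = L x y"
  shows "fredholm_term M K n = fredholm_term M L n"
  unfolding fredholm_term_def
  by (intro Bochner_Integration.integral_cong refl detn_cong assms) (auto simp: space_PiM PiE_iff)

text \<open>If \<open>f\<close> is not integrable, its Bochner integral is 0 by convention, and
  \<open>g\<close> is nonnegative because it dominates a norm.\<close>

lemma norm_integral_le: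
  fixes f :: "'a \<Rightarrow> 'b::{banach,second_countable_topology}"
  assumes "integrable M g" "\<And>x. x \<in> space M \<Longrightarrow> norm (f x) \<le> g x"
  shows "norm (\<integral>x. f x \<partial>M) \<le> (\<integral>x. g x \<partial>M)"
proof (cases "integrable M f")
  case True
  have "norm (\<integral>x. f x \<partial>M) \<le> (\<integral>x. norm (f x) \<partial>M)" by simp
  also have "\<dots> \<le> (\<integral>x. g x \<partial>M)" using True assms by (intro integral_mono) auto
  finally show ?thesis .
next
  case False
  have "0 \<le> (\<integral>x. g x \<partial>M)"
    using assms(2) norm_ge_zero order_trans by (intro integral_nonneg_AE AE_I2) blast
  then show ?thesis using False by (simp add: not_integrable_integral_eq)
qed

text \<open>The terms of index 0 of two determinants agree, so a comparison starts at n = 1, where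
  there is a row to exchange.\<close>

lemma fredholm_term_0:
  assumes "sigma_finite_measure M" shows "fredholm_term M K 0 = 1"
proof -
  interpret product_sigma_finite "\<lambda>_::nat. M"
    using assms by (simp add: product_sigma_finite_def)
  show ?thesis
    unfolding fredholm_term_def by (simp add: detn_leibniz PiM_empty)
qed

section \<open>Exchanging the factors of a composed kernel\<close>

lemma prod_permute_inverse:
  fixes f :: "nat \<Rightarrow> nat \<Rightarrow> 'a::comm_monoid_mult"
  assumes "p permutes {..<n}"
  shows "(\<Prod>i<n. f (p i) i) = (\<Prod>i<n. f i (inv_into UNIV p i))"
  using prod.permute[OF assms, of "\<lambda>i. f i (inv_into UNIV p i)"] permutes_inverses[OF assms]
  by (simp add: o_def)

text \<open>The separated bounds are made for Fubini. In the product over i of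
  \<open>A (x i) (s i) * B (s i) (x (p i))\<close> every \<open>\<alpha> (x i)\<close> and, after
  reindexing by p, every \<open>\<beta> (x i)\<close> occurs once, and every \<open>e (s i)\<close>
  twice. So one majorant serves all permutations, and it is integrable as soon as
  \<open>\<alpha> * \<beta>\<close> and \<open>e * e\<close> are.\<close>

locale kernel_factorization = M: sigma_finite_measure M + N: sigma_finite_measure N
  for M :: "'a measure" and N :: "'b measure" +
  fixes A :: "'a \<Rightarrow> 'b \<Rightarrow> complex" and B :: "'b \<Rightarrow> 'a \<Rightarrow> complex"
    and \<alpha> \<beta> :: "'a \<Rightarrow> real" and e :: "'b \<Rightarrow> real"
  assumes measA[measurable]: "case_prod A \<in> borel_measurable (M \<Otimes>\<^sub>M N)"
    and measB[measurable]: "case_prod B \<in> borel_measurable (N \<Otimes>\<^sub>M M)"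
    and nonneg: "\<And>x. 0 \<le> \<alpha> x" "\<And>x. 0 \<le> \<beta> x" "\<And>s. 0 \<le> e s"
    and boundA: "\<And>x s. x \<in> space M \<Longrightarrow> s \<in> space N \<Longrightarrow> cmod (A x s) \<le> \<alpha> x * e s"
    and boundB: "\<And>x s. x \<in> space M \<Longrightarrow> s \<in> space N \<Longrightarrow> cmod (B s x) \<le> \<beta> x * e s"
    and int_M: "integrable M (\<lambda>x. \<alpha> x * \<beta> x)" and int_N: "integrable N (\<lambda>s. e s * e s)"
begin

sublocale PM: product_sigma_finite "\<lambda>_::nat. M" by unfold_locales
sublocale PN: product_sigma_finite "\<lambda>_::nat. N" by unfold_locales

lemma measA' [measurable (raw)]:
  assumes "f \<in> measurable L M" "g \<in> measurable L N"
  shows "(\<lambda>w. A (f w) (g w)) \<in> borel_measurable L"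
  using measurable_compose[OF measurable_Pair[OF assms] measA] by simp

lemma measB' [measurable (raw)]:
  assumes "f \<in> measurable L N" "g \<in> measurable L M"
  shows "(\<lambda>w. B (f w) (g w)) \<in> borel_measurable L"
  using measurable_compose[OF measurable_Pair[OF assms] measB] by simp

lemma integrable_N:
  assumes "x \<in> space M" "y \<in> space M"
  shows "integrable N (\<lambda>s. A x s * B s y)"
proof (rule Bochner_Integration.integrable_bound)
  show "integrable N (\<lambda>s. \<alpha> x * \<beta> y * (e s * e s))" using int_N by simp
  show "AE s in N. cmod (A x s * B s y) \<le> norm (\<alpha> x * \<beta> y * (e s * e s))"
  proof (rule AE_I2)
    fix s assume s: "s \<in> space N"
    have "cmod (A x s * B s y) \<le> (\<alpha> x * e s) * (\<beta> y * e s)"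
      unfolding norm_mult using boundA[OF assms(1) s] boundB[OF assms(2) s] nonneg
      by (intro mult_mono) auto
    then show "cmod (A x s * B s y) \<le> norm (\<alpha> x * \<beta> y * (e s * e s))"
      using nonneg by (simp add: mult_ac abs_mult)
  qed
qed (use assms in measurable)

lemma integrable_M:
  assumes "s \<in> space N" "t \<in> space N"
  shows "integrable M (\<lambda>x. B s x * A x t)"
proof (rule Bochner_Integration.integrable_bound)
  show "integrable M (\<lambda>x. e s * e t * (\<alpha> x * \<beta> x))" using int_M by simp
  show "AE x in M. cmod (B s x * A x t) \<le> norm (e s * e t * (\<alpha> x * \<beta> x))"
  proof (rule AE_I2)
    fix x assume x: "x \<in> space M"
    have "cmod (B s x * A x t) \<le> (\<beta> x * e s) * (\<alpha> x * e t)"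
      unfolding norm_mult using boundA[OF x assms(2)] boundB[OF x assms(1)] nonneg
      by (intro mult_mono) auto
    then show "cmod (B s x * A x t) \<le> norm (e s * e t * (\<alpha> x * \<beta> x))"
      using nonneg by (simp add: mult_ac abs_mult)
  qed
qed (use assms in measurable)

lemma integrable_pair:
  fixes n :: nat
  assumes p: "p permutes {..<n}"
  shows "integrable ((\<Pi>\<^sub>M i\<in>{..<n}. M) \<Otimes>\<^sub>M (\<Pi>\<^sub>M i\<in>{..<n}. N))
           (\<lambda>(x, s). \<Prod>i<n. A (x i) (s i) * B (s i) (x (p i)))"
proof -
  interpret P: pair_sigma_finite "\<Pi>\<^sub>M i\<in>{..<n}. M" "\<Pi>\<^sub>M i\<in>{..<n}. N"
    using PM.sigma_finite[of "{..<n}"] PN.sigma_finite[of "{..<n}"] by (simp add: pair_sigma_finite_def)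
  define F where "F x = (\<Prod>i<n. \<alpha> (x i) * \<beta> (x i))" for x :: "nat \<Rightarrow> 'a"
  define G where "G s = (\<Prod>i<n. e (s i) * e (s i))" for s :: "nat \<Rightarrow> 'b"
  have F: "integrable (\<Pi>\<^sub>M i\<in>{..<n}. M) F" unfolding F_def
    by (rule PM.product_integrable_prod) (use int_M in auto)
  have G: "integrable (\<Pi>\<^sub>M i\<in>{..<n}. N) G" unfolding G_def
    by (rule PN.product_integrable_prod) (use int_N in auto)
  have nn: "0 \<le> F x" "0 \<le> G s" for x s unfolding F_def G_def using nonneg by (auto intro!: prod_nonneg)
  note [measurable] = borel_measurable_integrable[OF F] borel_measurable_integrable[OF G]
  have "integrable ((\<Pi>\<^sub>M i\<in>{..<n}. M) \<Otimes>\<^sub>M (\<Pi>\<^sub>M i\<in>{..<n}. N)) (\<lambda>(x, s). F x * G s)"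
    by (intro P.Fubini_integrable) (use F G nn in \<open>auto simp: abs_mult split_beta'\<close>)
  then show ?thesis
  proof (rule Bochner_Integration.integrable_bound)
    have [measurable]: "(\<lambda>x. x (p i)) \<in> measurable (\<Pi>\<^sub>M i\<in>{..<n}. M) M" if "i < n" for i
      using permutes_in_image[OF p, of i] that by (intro measurable_component_singleton) auto
    show "(\<lambda>(x, s). \<Prod>i<n. A (x i) (s i) * B (s i) (x (p i)))
        \<in> borel_measurable ((\<Pi>\<^sub>M i\<in>{..<n}. M) \<Otimes>\<^sub>M (\<Pi>\<^sub>M i\<in>{..<n}. N))"
      unfolding split_beta'
      by (intro borel_measurable_prod borel_measurable_times measA' measB'
          measurable_compose[OF measurable_fst] measurable_compose[OF measurable_snd]) auto
    show "AE w in (\<Pi>\<^sub>M i\<in>{..<n}. M) \<Otimes>\<^sub>M (\<Pi>\<^sub>M i\<in>{..<n}. N).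
        cmod (case w of (x, s) \<Rightarrow> \<Prod>i<n. A (x i) (s i) * B (s i) (x (p i)))
          \<le> norm (case w of (x, s) \<Rightarrow> F x * G s)"
    proof (rule AE_I2, clarsimp simp: space_pair_measure)
      fix x s assume x: "x \<in> space (\<Pi>\<^sub>M i\<in>{..<n}. M)" and s: "s \<in> space (\<Pi>\<^sub>M i\<in>{..<n}. N)"
      have xs: "x i \<in> space M" "s i \<in> space N" "x (p i) \<in> space M" if "i < n" for i
        using x s that permutes_in_image[OF p, of i] by (auto simp: space_PiM PiE_iff)
      have "cmod (\<Prod>i<n. A (x i) (s i) * B (s i) (x (p i)))
          \<le> (\<Prod>i<n. (\<alpha> (x i) * e (s i)) * (\<beta> (x (p i)) * e (s i)))"
        unfolding prod_norm[symmetric] norm_mult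
        using xs nonneg by (intro prod_mono conjI mult_mono boundA boundB) auto
      also have "\<dots> = (\<Prod>i<n. \<alpha> (x i)) * (\<Prod>i<n. \<beta> (x (p i))) * G s"
        by (simp add: G_def prod.distrib mult_ac)
      also have "(\<Prod>i<n. \<beta> (x (p i))) = (\<Prod>i<n. \<beta> (x i))"
        using prod.permute[OF p, of "\<lambda>i. \<beta> (x i)"] by (simp add: o_def)
      also have "(\<Prod>i<n. \<alpha> (x i)) * (\<Prod>i<n. \<beta> (x i)) * G s = F x * G s"
        by (simp add: F_def prod.distrib)
      finally show "cmod (\<Prod>i<n. A (x i) (s i) * B (s i) (x (p i))) \<le> \<bar>F x * G s\<bar>"
        by linarith
    qed
  qed
qed

text \<open>Both sides expand into the integrals over M and N of the products
  A (x i) (s i) B (s i) (x (p i)) with p a permutation.\<close>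
lemma fredholm_term_swap:
  "fredholm_term M (\<lambda>x y. \<integral>s. A x s * B s y \<partial>N) n
   = fredholm_term N (\<lambda>s t. \<integral>x. B s x * A x t \<partial>M) n"
proof -
  let ?PM = "\<Pi>\<^sub>M i\<in>{..<n}. M" and ?PN = "\<Pi>\<^sub>M i\<in>{..<n}. N"
  interpret P: pair_sigma_finite ?PM ?PN
    using PM.sigma_finite[of "{..<n}"] PN.sigma_finite[of "{..<n}"] by (simp add: pair_sigma_finite_def)
  define f where "f p x s = (\<Prod>i<n. A (x i) (s i) * B (s i) (x (p i)))"
    for p :: "nat \<Rightarrow> nat" and x s
  have intf: "integrable (?PM \<Otimes>\<^sub>M ?PN) (case_prod (f p))" if "p permutes {..<n}" for p
    unfolding f_def using integrable_pair[OF that] by (simp add: case_prod_beta')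
  have 1: "(\<Prod>i<n. \<integral>s. A (x i) s * B s (x (p i)) \<partial>N) = (\<integral>s. f p x s \<partial>?PN)"
    if x: "x \<in> space ?PM" and p: "p permutes {..<n}" for x p
    unfolding f_def
  proof (rule PN.product_integral_prod[symmetric])
    fix i assume "i \<in> {..<n}"
    then show "integrable N (\<lambda>s. A (x i) s * B s (x (p i)))"
      using x permutes_in_image[OF p, of i] by (intro integrable_N) (auto simp: space_PiM PiE_iff)
  qed simp
  have 2: "(\<Prod>i<n. \<integral>x. B (s i) x * A x (s (p i)) \<partial>M) = (\<integral>x. f p x s \<partial>?PM)"
    if s: "s \<in> space ?PN" and p: "p permutes {..<n}" for s p
  proof -
    have "(\<Prod>i<n. \<integral>x. B (s i) x * A x (s (p i)) \<partial>M) = (\<Prod>i<n. \<integral>x. B (s (inv_into UNIV p i)) x * A x (s i) \<partial>M)"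
      using prod_permute_inverse[OF p, of "\<lambda>a b. \<integral>x. B (s b) x * A x (s a) \<partial>M"] .
    also have "\<dots> = (\<integral>x. (\<Prod>i<n. B (s (inv_into UNIV p i)) (x i) * A (x i) (s i)) \<partial>?PM)"
    proof (rule PM.product_integral_prod[symmetric])
      fix i assume "i \<in> {..<n}"
      then show "integrable M (\<lambda>x. B (s (inv_into UNIV p i)) x * A x (s i))"
        using s permutes_in_image[OF permutes_inv[OF p], of i]
        by (intro integrable_M) (auto simp: space_PiM PiE_iff)
    qed simp
    also have "\<dots> = (\<integral>x. f p x s \<partial>?PM)"
    proof (rule Bochner_Integration.integral_cong[OF refl])
      fix x
      have "(\<Prod>i<n. B (s i) (x (p i))) = (\<Prod>i<n. B (s (inv_into UNIV p i)) (x i))"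
        using prod_permute_inverse[OF p, of "\<lambda>a b. B (s b) (x a)"] .
      then show "(\<Prod>i<n. B (s (inv_into UNIV p i)) (x i) * A (x i) (s i)) = f p x s"
        by (simp add: f_def prod.distrib mult.commute)
    qed
    finally show ?thesis .
  qed
  have "fredholm_term M (\<lambda>x y. \<integral>s. A x s * B s y \<partial>N) n
      = (\<integral>x. (\<Sum>p | p permutes {..<n}. signof p * (\<integral>s. f p x s \<partial>?PN)) \<partial>?PM)"
    unfolding fredholm_term_def detn_leibniz
    by (intro Bochner_Integration.integral_cong sum.cong refl arg_cong2[where f="(*)"] 1) auto
  also have "\<dots> = (\<Sum>p | p permutes {..<n}. signof p * (\<integral>x. (\<integral>s. f p x s \<partial>?PN) \<partial>?PM))"
    using P.integrable_fst[OF intf] by (subst Bochner_Integration.integral_sum) auto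
  also have "\<dots> = (\<Sum>p | p permutes {..<n}. signof p * (\<integral>s. (\<integral>x. f p x s \<partial>?PM) \<partial>?PN))"
    by (intro sum.cong refl arg_cong2[where f="(*)"] P.Fubini_integral[symmetric] intf) auto
  also have "\<dots> = (\<integral>s. (\<Sum>p | p permutes {..<n}. signof p * (\<integral>x. f p x s \<partial>?PM)) \<partial>?PN)"
    using P.integrable_snd[OF intf] by (subst Bochner_Integration.integral_sum) auto
  also have "\<dots> = fredholm_term N (\<lambda>s t. \<integral>x. B s x * A x t \<partial>M) n"
    unfolding fredholm_term_def detn_leibniz
    by (intro Bochner_Integration.integral_cong sum.cong refl arg_cong2[where f="(*)"] 2[symmetric]) auto
  finally show ?thesis .
qed

lemma fredholm_det_swap:
  "fredholm_det M (\<lambda>x y. \<integral>s. A x s * B s y \<partial>N) = fredholm_det N (\<lambda>s t. \<integral>x. B s x * A x t \<partial>M)"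
  unfolding fredholm_det_alt fredholm_term_swap ..

end

text \<open>Since n^n / n! is one term of the series of exp n, \<open>sqrt (real n) ^ n\<close> is
  at most \<open>exp (1/2) ^ n * sqrt (fact n)\<close>. This leaves a square root of n! in the
  denominator, and the ratio test applies.\<close>

lemma summable_fredholm_majorant:
  fixes X :: real
  assumes "0 \<le> X"
  shows "summable (\<lambda>n. real n * (sqrt (real n) ^ n * X ^ n) / fact n)"
proof (rule summable_comparison_test')
  \<comment> \<open>The 2 absorbs the factor n through n \<le> 2^n, and \<open>exp (1/2)\<close>
    comes from the square root of exp n. From n \<ge> 4 Y^2 on, the ratio of consecutive terms is at
    most 1/2.\<close>
  define Y where "Y = 2 * X * exp (1/2)"
  have Y: "0 \<le> Y" using assms by (simp add: Y_def)
  show "summable (\<lambda>n. Y ^ n / sqrt (fact n))"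
  proof (rule summable_ratio_test[of "1/2" "nat \<lceil>4 * Y\<^sup>2\<rceil>"])
    fix n assume n: "nat \<lceil>4 * Y\<^sup>2\<rceil> \<le> n"
    then have "4 * Y\<^sup>2 \<le> real (Suc n)" by linarith
    then have "sqrt (4 * Y\<^sup>2) \<le> sqrt (real (Suc n))" by (rule real_sqrt_le_mono)
    then have "2 * Y \<le> sqrt (real (Suc n))" using Y by (simp add: real_sqrt_mult)
    then have "Y / sqrt (real (Suc n)) \<le> 1/2" by (simp add: field_simps)
    then have "Y / sqrt (real (Suc n)) * (Y ^ n / sqrt (fact n)) \<le> 1/2 * (Y ^ n / sqrt (fact n))"
      using Y by (intro mult_right_mono) auto
    moreover have "Y ^ Suc n / sqrt (fact (Suc n)) = Y / sqrt (real (Suc n)) * (Y ^ n / sqrt (fact n))"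
      by (simp add: real_sqrt_mult)
    ultimately show "norm (Y ^ Suc n / sqrt (fact (Suc n))) \<le> 1/2 * norm (Y ^ n / sqrt (fact n))"
      using Y by (simp del: power_Suc)
  qed simp
  fix n :: nat
  have "real n ^ n / fact n \<le> (\<Sum>k. real n ^ k / fact k)"
    using sum_le_suminf[OF summable_exp[of "real n"], of "{n}"] by (simp add: divide_inverse mult.commute)
  also have "\<dots> = exp (real n)" by (simp add: exp_def divide_inverse mult.commute scaleR_conv_of_real)
  finally have "real n ^ n \<le> exp (real n) * fact n" by (simp add: field_simps)
  then have "sqrt (real n ^ n) \<le> sqrt (exp (real n) * fact n)" by (rule real_sqrt_le_mono)
  then have "sqrt (real n) ^ n \<le> sqrt (exp (real n)) * sqrt (fact n)"
    by (simp add: real_sqrt_power real_sqrt_mult)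
  also have "sqrt (exp (real n)) = exp (1/2) ^ n"
    by (rule real_sqrt_unique) (auto simp: power2_eq_square exp_of_nat_mult[symmetric] exp_add[symmetric] simp flip: power_mult)
  finally have 1: "sqrt (real n) ^ n \<le> exp (1/2) ^ n * sqrt (fact n)" .
  have "real n \<le> 2 ^ n" by (simp add: less_imp_le)
  then have "real n * (sqrt (real n) ^ n * X ^ n) \<le> 2 ^ n * ((exp (1/2) ^ n * sqrt (fact n)) * X ^ n)"
    using 1 assms by (intro mult_mono) auto
  also have "\<dots> = Y ^ n * sqrt (fact n)" by (simp add: Y_def power_mult_distrib mult_ac)
  finally have "real n * (sqrt (real n) ^ n * X ^ n) / fact n \<le> Y ^ n * sqrt (fact n) / fact n"
    by (intro divide_right_mono) auto
  also have "\<dots> = Y ^ n / sqrt (fact n)"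
    by (simp add: field_simps)
  finally show "norm (real n * (sqrt (real n) ^ n * X ^ n) / fact n) \<le> Y ^ n / sqrt (fact n)"
    using assms by (simp add: abs_mult)
qed

section \<open>Hadamard bounds for kernels dominated by a product weight\<close>

locale weighted_space = sigma_finite_measure M for M :: "'a measure" +
  fixes g :: "'a \<Rightarrow> real"
  assumes g_pos: "\<And>x. 0 < g x" and int_g: "integrable M (\<lambda>x. g x * g x)"
begin

sublocale P: product_sigma_finite "\<lambda>_::nat. M" by unfold_locales

abbreviation "J \<equiv> \<integral>x. g x * g x \<partial>M"

definition weight :: "nat \<Rightarrow> (nat \<Rightarrow> 'a) \<Rightarrow> real" where
  "weight n u = (\<Prod>i<n. g (u i) * g (u i))"

lemma weight_nonneg: "0 \<le> weight n u" by (simp add: weight_def prod_nonneg)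

lemma integrable_weight: "integrable (\<Pi>\<^sub>M i\<in>{..<n}. M) (weight n)"
  unfolding weight_def by (rule P.product_integrable_prod) (use int_g in auto)

lemma integral_weight: "(\<integral>u. weight n u \<partial>(\<Pi>\<^sub>M i\<in>{..<n}. M)) = J ^ n"
  unfolding weight_def by (subst P.product_integral_prod) (use int_g in auto)

definition kernel_le :: "real \<Rightarrow> ('a \<Rightarrow> 'a \<Rightarrow> complex) \<Rightarrow> bool" where
  "kernel_le C K \<longleftrightarrow> (\<forall>x\<in>space M. \<forall>y\<in>space M. cmod (K x y) \<le> C * (g x * g y))"

text \<open>Dividing row i and column j by their weights leaves entries bounded by the constant of
  \<open>kernel_le\<close>, to which Hadamard's inequality applies. The weights that come out form a
  product of functions \<open>g * g\<close> of one variable each, whose integral is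
  \<open>J ^ n\<close>.\<close>

lemma detn_normalize:
  fixes K :: "'a \<Rightarrow> 'a \<Rightarrow> complex"
  shows "detn n (\<lambda>i j. K (u i) (u j)) = of_real (weight n u) * detn n (\<lambda>i j. K (u i) (u j) / of_real (g (u i) * g (u j)))"
proof -
  have "detn n (\<lambda>i j. K (u i) (u j)) = detn n (\<lambda>i j. of_real (g (u i)) * of_real (g (u j)) * (K (u i) (u j) / of_real (g (u i) * g (u j))))"
    using less_imp_neq[OF g_pos, THEN not_sym] by (intro detn_cong) simp
  then show ?thesis unfolding detn_scale by (simp add: weight_def prod.distrib)
qed

lemma normalized_le:
  assumes "kernel_le C K" "u \<in> space (\<Pi>\<^sub>M i\<in>{..<n}. M)" "i < n" "j < n"
  shows "cmod (K (u i) (u j) / of_real (g (u i) * g (u j))) \<le> C"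
  using assms g_pos[of "u i"] g_pos[of "u j"]
  by (auto simp: kernel_le_def space_PiM PiE_iff norm_divide norm_mult field_simps)

lemma detn_kernel_bound:
  assumes "kernel_le C K" "0 \<le> C" "u \<in> space (\<Pi>\<^sub>M i\<in>{..<n}. M)"
  shows "cmod (detn n (\<lambda>i j. K (u i) (u j))) \<le> sqrt (real n) ^ n * C ^ n * weight n u"
proof -
  have "cmod (detn n (\<lambda>i j. K (u i) (u j) / of_real (g (u i) * g (u j)))) \<le> sqrt (real n) ^ n * (\<Prod>i<n. C)"
    using assms by (intro hadamard_rows normalized_le) auto
  then have "weight n u * cmod (detn n (\<lambda>i j. K (u i) (u j) / of_real (g (u i) * g (u j))))
    \<le> weight n u * (sqrt (real n) ^ n * (\<Prod>i<n. C))"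
    by (rule mult_left_mono) (rule weight_nonneg)
  then show ?thesis
    using weight_nonneg[of n u] unfolding detn_normalize[of n K u] norm_mult by (simp add: mult_ac)
qed

lemma detn_kernel_diff_bound:
  assumes "kernel_le C K" "kernel_le C L" "kernel_le e (\<lambda>x y. K x y - L x y)" "0 \<le> C"
    "u \<in> space (\<Pi>\<^sub>M i\<in>{..<n}. M)" "0 < n"
  shows "cmod (detn n (\<lambda>i j. K (u i) (u j)) - detn n (\<lambda>i j. L (u i) (u j)))
    \<le> real n * (sqrt (real n) ^ n * C ^ (n - 1) * e) * weight n u"
proof -
  have "cmod (detn n (\<lambda>i j. K (u i) (u j) / of_real (g (u i) * g (u j)))
           - detn n (\<lambda>i j. L (u i) (u j) / of_real (g (u i) * g (u j))))
      \<le> real n * (sqrt (real n) ^ n * C ^ (n - 1) * e)"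
    using assms normalized_le[OF assms(3,5)]
    by (intro detn_diff_bound normalized_le) (auto simp: diff_divide_distrib)
  then have "weight n u * cmod (detn n (\<lambda>i j. K (u i) (u j) / of_real (g (u i) * g (u j)))
           - detn n (\<lambda>i j. L (u i) (u j) / of_real (g (u i) * g (u j))))
      \<le> weight n u * (real n * (sqrt (real n) ^ n * C ^ (n - 1) * e))"
    by (rule mult_left_mono) (rule weight_nonneg)
  then show ?thesis
    using weight_nonneg[of n u]
    unfolding detn_normalize[of n K u] detn_normalize[of n L u] right_diff_distrib[symmetric] norm_mult
    by (simp add: mult_ac)
qed

lemma measurable_detn:
  fixes K :: "'a \<Rightarrow> 'a \<Rightarrow> complex"
  assumes "case_prod K \<in> borel_measurable (M \<Otimes>\<^sub>M M)"
  shows "(\<lambda>u. detn n (\<lambda>i j. K (u i) (u j))) \<in> borel_measurable (\<Pi>\<^sub>M i\<in>{..<n}. M)"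
proof -
  have "(\<lambda>u. K (u i) (u j)) \<in> borel_measurable (\<Pi>\<^sub>M i\<in>{..<n}. M)" if "i < n" "j < n" for i j
    using measurable_compose[OF measurable_Pair assms,
        of "\<lambda>u. u i" "\<Pi>\<^sub>M i\<in>{..<n}. M" "\<lambda>u. u j"] that
    by (simp add: measurable_component_singleton)
  moreover have "p i < n" if "p permutes {..<n}" "i < n" for p i
    using permutes_in_image[OF that(1), of i] that(2) by simp
  ultimately show ?thesis
    unfolding detn_leibniz
    by (intro borel_measurable_sum borel_measurable_times borel_measurable_prod borel_measurable_const) auto
qed

lemma integrable_detn:
  assumes "case_prod K \<in> borel_measurable (M \<Otimes>\<^sub>M M)" "kernel_le C K" "0 \<le> C"
  shows "integrable (\<Pi>\<^sub>M i\<in>{..<n}. M) (\<lambda>u. detn n (\<lambda>i j. K (u i) (u j)))"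
proof (rule Bochner_Integration.integrable_bound)
  show "integrable (\<Pi>\<^sub>M i\<in>{..<n}. M) (\<lambda>u. sqrt (real n) ^ n * C ^ n * weight n u)"
    using integrable_weight by simp
  show "AE u in \<Pi>\<^sub>M i\<in>{..<n}. M. cmod (detn n (\<lambda>i j. K (u i) (u j)))
      \<le> norm (sqrt (real n) ^ n * C ^ n * weight n u)"
    using detn_kernel_bound[OF assms(2,3)] by (intro AE_I2) (force intro: order_trans)
qed (rule measurable_detn[OF assms(1)])

lemma fredholm_term_bound:
  assumes "kernel_le C K" "0 \<le> C"
  shows "cmod (fredholm_term M K n) \<le> sqrt (real n) ^ n * (C * J) ^ n"
proof -
  have "cmod (fredholm_term M K n) \<le> (\<integral>u. sqrt (real n) ^ n * C ^ n * weight n u \<partial>(\<Pi>\<^sub>M i\<in>{..<n}. M))"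
    unfolding fredholm_term_def
  proof (rule norm_integral_le)
    show "integrable (\<Pi>\<^sub>M i\<in>{..<n}. M) (\<lambda>u. sqrt (real n) ^ n * C ^ n * weight n u)"
      using integrable_weight by simp
  qed (use detn_kernel_bound[OF assms] in auto)
  then show ?thesis
    by (simp add: integral_weight power_mult_distrib)
qed

lemma fredholm_term_diff_bound:
  assumes "case_prod K \<in> borel_measurable (M \<Otimes>\<^sub>M M)" "case_prod L \<in> borel_measurable (M \<Otimes>\<^sub>M M)"
    "kernel_le C K" "kernel_le C L" "kernel_le e (\<lambda>x y. K x y - L x y)" "0 \<le> C" "0 < n"
  shows "cmod (fredholm_term M K n - fredholm_term M L n)
    \<le> real n * (sqrt (real n) ^ n * C ^ (n - 1) * e) * J ^ n"
proof -
  have "fredholm_term M K n - fredholm_term M L n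
    = (\<integral>u. detn n (\<lambda>i j. K (u i) (u j)) - detn n (\<lambda>i j. L (u i) (u j)) \<partial>(\<Pi>\<^sub>M i\<in>{..<n}. M))"
    unfolding fredholm_term_def
    by (rule Bochner_Integration.integral_diff[symmetric]; rule integrable_detn) (use assms in auto)
  also have "cmod \<dots> \<le> (\<integral>u. real n * (sqrt (real n) ^ n * C ^ (n - 1) * e) * weight n u \<partial>(\<Pi>\<^sub>M i\<in>{..<n}. M))"
  proof (rule norm_integral_le)
    show "integrable (\<Pi>\<^sub>M i\<in>{..<n}. M) (\<lambda>u. real n * (sqrt (real n) ^ n * C ^ (n - 1) * e) * weight n u)"
      using integrable_weight by simp
  qed (use detn_kernel_diff_bound[OF assms(3-6) _ assms(7)] in auto)
  finally show ?thesis by (simp add: integral_weight)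
qed

text \<open>The factor is \<open>Suc n\<close> instead of n so that the majorant does not vanish at
  n = 0, where the Fredholm term is of size 1.\<close>

lemma norm_fredholm_summand:
  assumes "kernel_le C K" "0 \<le> C"
  shows "cmod ((- 1) ^ n / fact n * fredholm_term M K n) \<le> real (Suc n) * (sqrt (real n) ^ n * (C * J) ^ n) / fact n"
proof -
  have "cmod ((- 1) ^ n / fact n * fredholm_term M K n) = cmod (fredholm_term M K n) / fact n"
    by (simp add: norm_mult norm_divide norm_power)
  also have "\<dots> \<le> sqrt (real n) ^ n * (C * J) ^ n / fact n"
    by (intro divide_right_mono fredholm_term_bound assms) auto
  also have "\<dots> \<le> real (Suc n) * (sqrt (real n) ^ n * (C * J) ^ n) / fact n"
  proof (intro divide_right_mono)
    have "0 \<le> real n * (sqrt (real n) ^ n * (C * J) ^ n)" using assms by simp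
    then show "sqrt (real n) ^ n * (C * J) ^ n \<le> real (Suc n) * (sqrt (real n) ^ n * (C * J) ^ n)"
      by (simp add: distrib_right)
  qed simp
  finally show ?thesis .
qed

lemma summable_Suc_majorant:
  assumes "0 \<le> C"
  shows "summable (\<lambda>n. real (Suc n) * (sqrt (real n) ^ n * (C * J) ^ n) / fact n)"
proof (rule summable_comparison_test')
  show "summable (\<lambda>n. 2 * (real n * (sqrt (real n) ^ n * (C * J) ^ n) / fact n))"
    using assms by (intro summable_mult summable_fredholm_majorant) auto
  fix n :: nat assume n: "1 \<le> n"
  have "real (Suc n) * (sqrt (real n) ^ n * (C * J) ^ n) \<le> (2 * real n) * (sqrt (real n) ^ n * (C * J) ^ n)"
    using n assms by (intro mult_right_mono) auto
  then show "norm (real (Suc n) * (sqrt (real n) ^ n * (C * J) ^ n) / fact n)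
      \<le> 2 * (real n * (sqrt (real n) ^ n * (C * J) ^ n) / fact n)"
    using assms by (simp add: field_simps abs_mult)
qed

lemma summable_fredholm:
  assumes "kernel_le C K" "0 \<le> C"
  shows "summable (\<lambda>n. (- 1) ^ n / fact n * fredholm_term M K n)"
  by (rule summable_comparison_test'[OF summable_Suc_majorant[OF assms(2)]])
    (rule norm_fredholm_summand[OF assms])

text \<open>The point is the order of the quantifiers: \<open>D\<close> depends on C and the weight
  but not on the two kernels, which makes the later estimate uniform in z, h and x.\<close>

lemma fredholm_det_diff_bound:
  assumes "0 < C"
  shows "\<exists>D>0. \<forall>K L e. case_prod K \<in> borel_measurable (M \<Otimes>\<^sub>M M) \<and> case_prod L \<in> borel_measurable (M \<Otimes>\<^sub>M M)
    \<and> kernel_le C K \<and> kernel_le C L \<and> kernel_le e (\<lambda>x y. K x y - L x y) \<and> 0 \<le> e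
    \<longrightarrow> cmod (fredholm_det M K - fredholm_det M L) \<le> D * e"
proof -
  define b where "b n = real n * (sqrt (real n) ^ n * (C * J) ^ n) / fact n" for n
  have b: "summable b" unfolding b_def using assms by (intro summable_fredholm_majorant) auto
  have b0: "0 \<le> b n" for n using assms by (simp add: b_def)
  \<comment> \<open>Exchanging rows gives n C^(n-1) e, that is n C^n times e / C, hence the division
    by C. The 1 makes \<open>D\<close> positive.\<close>
  define D where "D = suminf b / C + 1"
  have "0 < D" unfolding D_def using suminf_nonneg[OF b b0] assms by (simp add: add_nonneg_pos)
  moreover have "cmod (fredholm_det M K - fredholm_det M L) \<le> D * e"
    if m: "case_prod K \<in> borel_measurable (M \<Otimes>\<^sub>M M)" "case_prod L \<in> borel_measurable (M \<Otimes>\<^sub>M M)"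
    and k: "kernel_le C K" "kernel_le C L" "kernel_le e (\<lambda>x y. K x y - L x y)" "0 \<le> e" for K L e
  proof -
    have trm: "norm ((- 1) ^ n / fact n * fredholm_term M K n - (- 1) ^ n / fact n * fredholm_term M L n) \<le> b n * (e / C)" for n
    proof (cases "n = 0")
      case True
      then show ?thesis by (simp add: b_def fredholm_term_0[OF sigma_finite_measure_axioms])
    next
      case False
      have "norm ((- 1) ^ n / fact n * fredholm_term M K n - (- 1) ^ n / fact n * fredholm_term M L n)
        = cmod (fredholm_term M K n - fredholm_term M L n) / fact n"
        unfolding right_diff_distrib[symmetric] by (simp add: norm_mult norm_divide norm_power)
      also have "\<dots> \<le> real n * (sqrt (real n) ^ n * C ^ (n - 1) * e) * J ^ n / fact n"
        using m k assms False by (intro divide_right_mono fredholm_term_diff_bound) auto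
      also have "\<dots> = b n * (e / C)"
        using assms power_minus_mult[of n C] False by (simp add: b_def power_mult_distrib mult_ac)
          (simp add: field_simps)
      finally show ?thesis .
    qed
    have "fredholm_det M K - fredholm_det M L
      = (\<Sum>n. (- 1) ^ n / fact n * fredholm_term M K n - (- 1) ^ n / fact n * fredholm_term M L n)"
      unfolding fredholm_det_alt using k assms by (intro suminf_diff summable_fredholm[of C]) auto
    also have "norm \<dots> \<le> (\<Sum>n. b n * (e / C))"
      by (intro norm_suminf_le trm) (rule summable_mult2[OF b])
    also have "\<dots> = suminf b / C * e" using suminf_mult2[OF b, of "e / C"] by simp
    also have "\<dots> \<le> D * e" unfolding D_def using k by (intro mult_right_mono) auto
    finally show ?thesis .
  qed
  ultimately show ?thesis by blast
qed

end

section \<open>Holomorphic dependence on a parameter\<close>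

lemma holomorphic_on_integral:
  fixes f :: "complex \<Rightarrow> 'a \<Rightarrow> complex"
  assumes U: "open U"
    and meas: "\<And>z. z \<in> U \<Longrightarrow> f z \<in> borel_measurable M"
    and hol: "\<And>x. x \<in> space M \<Longrightarrow> (\<lambda>z. f z x) holomorphic_on U"
    and dom: "\<And>z. z \<in> U \<Longrightarrow> \<exists>r>0. \<exists>G. integrable M G \<and> ball z r \<subseteq> U \<and>
                (\<forall>w\<in>ball z r. \<forall>x\<in>space M. cmod (f w x) \<le> G x)"
  shows "(\<lambda>z. \<integral>x. f z x \<partial>M) holomorphic_on U"
  unfolding holomorphic_on_open[OF U]
proof
  fix z0 assume z0: "z0 \<in> U"
  obtain r G where r: "0 < r" and G: "integrable M G" and sub: "ball z0 r \<subseteq> U"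
    and bd: "\<And>w x. w \<in> ball z0 r \<Longrightarrow> x \<in> space M \<Longrightarrow> cmod (f w x) \<le> G x"
    using dom[OF z0] by blast
  define D where "D x = deriv (\<lambda>z. f z x) z0" for x
  have int: "integrable M (f w)" if "w \<in> ball z0 r" for w
  proof (rule Bochner_Integration.integrable_bound[OF G])
    show "f w \<in> borel_measurable M" using that sub meas by blast
    show "AE x in M. cmod (f w x) \<le> norm (G x)"
      using bd[OF that] by (intro AE_I2) (simp add: order_trans[OF _ abs_ge_self])
  qed
  have der: "((\<lambda>z. f z x) has_field_derivative deriv (\<lambda>z. f z x) w) (at w)" if "x \<in> space M" "w \<in> U" for x w
    using holomorphic_derivI[OF hol[OF that(1)] U that(2)] .
  \<comment> \<open>A disc of radius r/4 around a point within r/2 of z0 stays in the ball of radius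
    r, where \<open>G\<close> bounds the integrand. Cauchy's inequality then bounds the derivative
    there, hence the difference quotients, by \<open>G x / (r/4)\<close>, and dominated convergence
    along sequences differentiates under the integral.\<close>
  have lip: "cmod (f w x - f z0 x) \<le> (G x / (r/4)) * cmod (w - z0)" if x: "x \<in> space M" and w: "w \<in> ball z0 (r/2)" for x w
  proof (rule field_differentiable_bound[of "ball z0 (r/2)" "\<lambda>z. f z x"])
    fix v assume v: "v \<in> ball z0 (r/2)"
    have cb: "cball v (r/4) \<subseteq> ball z0 r"
    proof
      fix y assume "y \<in> cball v (r/4)"
      then have "dist z0 y \<le> dist z0 v + r/4" using dist_triangle[of z0 y v] by simp
      then show "y \<in> ball z0 r" using v r by simp
    qed
    have "v \<in> ball z0 r" using v r by simp
    then have "v \<in> U" using sub by blast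
    then show "((\<lambda>z. f z x) has_field_derivative deriv (\<lambda>z. f z x) v) (at v within ball z0 (r/2))"
      by (rule has_field_derivative_at_within[OF der[OF x]])
    have "cmod ((deriv ^^ 1) (\<lambda>z. f z x) v) \<le> fact 1 * G x / (r/4) ^ 1"
    proof (rule Cauchy_inequality)
      have h: "(\<lambda>z. f z x) holomorphic_on cball v (r/4)"
        by (rule holomorphic_on_subset[OF hol[OF x] order_trans[OF cb sub]])
      show "(\<lambda>z. f z x) holomorphic_on ball v (r/4)"
        by (rule holomorphic_on_subset[OF h ball_subset_cball])
      show "continuous_on (cball v (r/4)) (\<lambda>z. f z x)"
        by (rule holomorphic_on_imp_continuous_on[OF h])
      show "cmod (f y x) \<le> G x" if "cmod (v - y) = r/4" for y
        using that cb x by (intro bd) (auto simp: dist_norm)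
    qed (use r in auto)
    then show "cmod (deriv (\<lambda>z. f z x) v) \<le> G x / (r/4)" by simp
  qed (use w r in auto)
  have "((\<lambda>w. ((\<integral>x. f w x \<partial>M) - (\<integral>x. f z0 x \<partial>M)) / (w - z0)) \<longlongrightarrow> (\<integral>x. D x \<partial>M)) (at z0 within ball z0 (r/2))"
    unfolding tendsto_at_iff_sequentially
  proof (intro allI impI)
    fix X assume X: "\<forall>i. X i \<in> ball z0 (r/2) - {z0}" "X \<longlonglongrightarrow> z0"
    have Xi: "X i \<in> ball z0 (r/2)" "X i \<in> ball z0 r" "X i \<in> U" "X i \<noteq> z0" for i
    proof -
      show 1: "X i \<in> ball z0 (r/2)" "X i \<noteq> z0" using X(1) by blast+
      show "X i \<in> ball z0 r" using 1 r by simp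
      then show "X i \<in> U" using sub by blast
    qed
    have z0r: "z0 \<in> ball z0 r" using r by simp
    define q where "q i x = (f (X i) x - f z0 x) / (X i - z0)" for i x
    have qm: "q i \<in> borel_measurable M" for i
      unfolding q_def using meas[OF Xi(3)] meas[OF z0] by measurable
    have lim: "(\<lambda>i. q i x) \<longlonglongrightarrow> D x" if "x \<in> space M" for x
    proof -
      have "((\<lambda>w. (f w x - f z0 x) / (w - z0)) \<longlongrightarrow> D x) (at z0)"
        using der[OF that z0] unfolding D_def has_field_derivative_iff .
      moreover have "filterlim X (at z0) sequentially"
        using X(2) Xi(4) by (simp add: filterlim_at)
      ultimately show ?thesis
        unfolding q_def by (rule filterlim_compose)
    qed
    have "(\<lambda>i. \<integral>x. q i x \<partial>M) \<longlonglongrightarrow> (\<integral>x. D x \<partial>M)"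
    proof (rule integral_dominated_convergence)
      show "D \<in> borel_measurable M" by (rule borel_measurable_LIMSEQ_metric[OF qm lim])
      show "integrable M (\<lambda>x. G x / (r/4))" using G by simp
      show "AE x in M. (\<lambda>i. q i x) \<longlonglongrightarrow> D x" using lim by (intro AE_I2)
      show "AE x in M. cmod (q i x) \<le> G x / (r/4)" for i
      proof (rule AE_I2)
        fix x assume "x \<in> space M"
        from lip[OF this Xi(1)[of i]] Xi(4)[of i]
        show "cmod (q i x) \<le> G x / (r/4)" by (simp add: q_def norm_divide field_simps)
      qed
    qed (rule qm)
    moreover have "(\<integral>x. q i x \<partial>M) = ((\<integral>x. f (X i) x \<partial>M) - (\<integral>x. f z0 x \<partial>M)) / (X i - z0)" for i
      unfolding q_def using int[OF Xi(2)] int[OF z0r] by simp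
    ultimately show "((\<lambda>w. ((\<integral>x. f w x \<partial>M) - (\<integral>x. f z0 x \<partial>M)) / (w - z0)) \<circ> X) \<longlonglongrightarrow> (\<integral>x. D x \<partial>M)"
      by (simp add: o_def)
  qed
  then have "((\<lambda>z. \<integral>x. f z x \<partial>M) has_field_derivative (\<integral>x. D x \<partial>M)) (at z0 within ball z0 (r/2))"
    unfolding has_field_derivative_iff .
  then show "\<exists>f'. ((\<lambda>z. \<integral>x. f z x \<partial>M) has_field_derivative f') (at z0)"
    using at_within_open[of z0 "ball z0 (r/2)"] r by auto
qed

text \<open>Each Fredholm term is an integral of a holomorphic integrand, and the series converges
  uniformly on small discs by the Weierstrass test. The weight is chosen locally, because the decay
  rate of the kernel in question degenerates as |z| approaches 1.\<close>

lemma holomorphic_on_fredholm_det: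
  fixes K :: "complex \<Rightarrow> 'a \<Rightarrow> 'a \<Rightarrow> complex"
  assumes U: "open U"
    and meas: "\<And>z. z \<in> U \<Longrightarrow> case_prod (K z) \<in> borel_measurable (M \<Otimes>\<^sub>M M)"
    and hol: "\<And>x y. x \<in> space M \<Longrightarrow> y \<in> space M \<Longrightarrow> (\<lambda>z. K z x y) holomorphic_on U"
    and dom: "\<And>z. z \<in> U \<Longrightarrow> \<exists>r>0. \<exists>C\<ge>0. \<exists>g. weighted_space M g \<and> ball z r \<subseteq> U \<and>
                (\<forall>w\<in>ball z r. weighted_space.kernel_le M g C (K w))"
  shows "(\<lambda>z. fredholm_det M (K z)) holomorphic_on U"
proof (rule holomorphic_uniform_sequence[OF U])
  fix N
  have "(\<lambda>z. fredholm_term M (K z) n) holomorphic_on U" for n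
    unfolding fredholm_term_def
  proof (rule holomorphic_on_integral[OF U])
    show "(\<lambda>u. detn n (\<lambda>i j. K z (u i) (u j))) \<in> borel_measurable (\<Pi>\<^sub>M i\<in>{..<n}. M)" if z: "z \<in> U" for z
    proof -
      obtain g where "weighted_space M g" using dom[OF z] by blast
      then interpret weighted_space M g .
      show ?thesis by (rule measurable_detn[OF meas[OF z]])
    qed
    show "(\<lambda>z. detn n (\<lambda>i j. K z (u i) (u j))) holomorphic_on U" if u: "u \<in> space (\<Pi>\<^sub>M i\<in>{..<n}. M)" for u
    proof -
      have "u i \<in> space M" if "i < n" for i using u that by (auto simp: space_PiM PiE_iff)
      moreover have "p i < n" if "p permutes {..<n}" "i < n" for p i
        using permutes_in_image[OF that(1), of i] that(2) by simp
      ultimately show ?thesis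
        unfolding detn_leibniz
        by (intro holomorphic_on_sum holomorphic_on_prod holomorphic_on_mult holomorphic_on_const hol) auto
    qed
    show "\<exists>r>0. \<exists>G. integrable (\<Pi>\<^sub>M i\<in>{..<n}. M) G \<and> ball z r \<subseteq> U \<and>
        (\<forall>w\<in>ball z r. \<forall>u\<in>space (\<Pi>\<^sub>M i\<in>{..<n}. M). cmod (detn n (\<lambda>i j. K w (u i) (u j))) \<le> G u)"
      if z: "z \<in> U" for z
    proof -
      obtain r C g where r: "0 < r" "0 \<le> C" "weighted_space M g" "ball z r \<subseteq> U"
        and k: "\<And>w. w \<in> ball z r \<Longrightarrow> weighted_space.kernel_le M g C (K w)"
        using dom[OF z] by blast
      interpret weighted_space M g by fact
      have "integrable (\<Pi>\<^sub>M i\<in>{..<n}. M) (\<lambda>u. sqrt (real n) ^ n * C ^ n * weight n u)"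
        using integrable_weight by simp
      then show ?thesis
        using r(1,4)
        by (intro exI[of _ r] exI[of _ "\<lambda>u. sqrt (real n) ^ n * C ^ n * weight n u"] conjI ballI
            detn_kernel_bound[OF k r(2)])
    qed
  qed
  then show "(\<lambda>z. \<Sum>n<N. (- 1) ^ n / fact n * fredholm_term M (K z) n) holomorphic_on U"
    by (intro holomorphic_on_sum holomorphic_on_mult holomorphic_on_const)
next
  fix z assume z: "z \<in> U"
  obtain r C g where r: "0 < r" "0 \<le> C" "weighted_space M g" "ball z r \<subseteq> U"
    and k: "\<And>w. w \<in> ball z r \<Longrightarrow> weighted_space.kernel_le M g C (K w)"
    using dom[OF z] by blast
  interpret weighted_space M g by fact
  have "cball z (r/2) \<subseteq> ball z r" using r by auto
  moreover have "uniform_limit (cball z (r/2)) (\<lambda>N z. \<Sum>n<N. (- 1) ^ n / fact n * fredholm_term M (K z) n)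
      (\<lambda>z. fredholm_det M (K z)) sequentially"
    unfolding fredholm_det_alt
  proof (rule Weierstrass_m_test)
    show "summable (\<lambda>n. real (Suc n) * (sqrt (real n) ^ n * (C * J) ^ n) / fact n)"
      by (rule summable_Suc_majorant[OF r(2)])
    show "cmod ((- 1) ^ n / fact n * fredholm_term M (K w) n)
        \<le> real (Suc n) * (sqrt (real n) ^ n * (C * J) ^ n) / fact n" if "w \<in> cball z (r/2)" for n w
      using that r(1) by (intro norm_fredholm_summand k r(2)) auto
  qed
  ultimately show "\<exists>d>0. cball z d \<subseteq> U \<and> uniform_limit (cball z d)
      (\<lambda>N z. \<Sum>n<N. (- 1) ^ n / fact n * fredholm_term M (K z) n) (\<lambda>z. fredholm_det M (K z)) sequentially"
    using r(1,4) by (intro exI[of _ "r/2"] conjI) (simp, blast+)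
qed

text \<open>\<open>F_GOE\<close> is a real Fredholm series, whereas the bounds above concern complex
  kernels; this is the bridge between the two.\<close>

lemma fredholm_det_of_real:
  assumes "summable (\<lambda>n. (- 1) ^ n / fact n * fredholm_term M (\<lambda>x y. of_real (K x y) :: complex) n)"
  shows "fredholm_det M (\<lambda>x y. of_real (K x y) :: complex) = of_real (fredholm_det M K)"
proof -
  have 1: "fredholm_term M (\<lambda>x y. of_real (K x y) :: complex) n = of_real (fredholm_term M K n)" for n
    unfolding fredholm_term_def detn_of_real by simp
  have 2: "(- 1) ^ n / fact n * complex_of_real (fredholm_term M K n)
      = complex_of_real ((- 1) ^ n / fact n * fredholm_term M K n)" for n by simp
  have "summable (\<lambda>n. (- 1) ^ n / fact n * fredholm_term M K n)"
    using assms unfolding 1 2 summable_complex_of_real .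
  then show ?thesis unfolding fredholm_det_alt 1 2 by (rule suminf_of_real[symmetric])
qed

section \<open>Sums over a vertical lattice as functions on the punctured disc\<close>

text \<open>The arguments are all the points with the same value of exp (- \<zeta>). The sum is
  written as an integral over counting measure to match the determinants on \<open>S_minus z\<close>
  and to make dominated convergence available.\<close>

definition lattice_sum :: "(complex \<Rightarrow> complex) \<Rightarrow> complex \<Rightarrow> complex" where
  "lattice_sum G \<zeta> = (\<integral>k. G (\<zeta> + 2 * of_real pi * \<i> * of_int k) \<partial>count_space (UNIV :: int set))"

definition disc_sum :: "(complex \<Rightarrow> complex) \<Rightarrow> complex \<Rightarrow> complex" where
  "disc_sum G z = lattice_sum G (- Ln z)"

abbreviation right_half :: "complex set" where "right_half \<equiv> {\<zeta>. 0 < Re \<zeta>}"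

text \<open>Quadratic decay makes the lattice sum converge absolutely and locally uniformly. The
  constant depends on the strip and may blow up towards the imaginary axis and towards the
  right.\<close>

definition halfplane_decay :: "(complex \<Rightarrow> complex) \<Rightarrow> bool" where
  "halfplane_decay G \<longleftrightarrow> G holomorphic_on right_half \<and>
     (\<forall>a>0. \<forall>b. \<exists>C. \<forall>\<zeta>. a \<le> Re \<zeta> \<and> Re \<zeta> \<le> b \<longrightarrow> cmod (G \<zeta>) \<le> C / (1 + (Im \<zeta>)\<^sup>2))"

lemma integrable_int_inverse_square:
  "integrable (count_space (UNIV :: int set)) (\<lambda>k. 1 / (1 + (of_int k)\<^sup>2) :: real)"
proof -
  have nat: "Infinite_Set_Sum.abs_summable_on (\<lambda>n. 1 / (1 + (real n)\<^sup>2)) (UNIV :: nat set)"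
    unfolding abs_summable_on_nat_iff'
  proof (rule summable_comparison_test')
    show "summable (\<lambda>n. 1 / (real n)\<^sup>2)"
      using inverse_power_summable[of 2, where 'a=real] by (simp add: inverse_eq_divide)
    fix n :: nat assume "1 \<le> n"
    then show "norm (norm (1 / (1 + (real n)\<^sup>2))) \<le> 1 / (real n)\<^sup>2"
      by (simp add: frac_le)
  qed
  let ?f = "\<lambda>k::int. 1 / (1 + (of_int k)\<^sup>2) :: real"
  have "Infinite_Set_Sum.abs_summable_on ?f (range int)"
    by (subst Infinite_Set_Sum.abs_summable_on_reindex_iff[symmetric]) (use nat in auto)
  moreover have "Infinite_Set_Sum.abs_summable_on ?f (range (\<lambda>n. - int n))"
    by (subst Infinite_Set_Sum.abs_summable_on_reindex_iff[symmetric]) (use nat in \<open>auto simp: inj_def\<close>)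
  ultimately have "Infinite_Set_Sum.abs_summable_on ?f (range int \<union> range (\<lambda>n. - int n))"
    by (rule Infinite_Set_Sum.abs_summable_on_union)
  also have "range int \<union> range (\<lambda>n. - int n) = UNIV"
  proof -
    have "x \<in> range int \<union> range (\<lambda>n. - int n)" for x by (cases x rule: int_cases2) auto
    then show ?thesis by blast
  qed
  finally show ?thesis by (simp add: Infinite_Set_Sum.abs_summable_on_def)
qed

definition lattice_const :: real where "lattice_const = (\<integral>k. 1 / (1 + (of_int k)\<^sup>2) \<partial>count_space (UNIV :: int set))"

lemma lattice_const_nonneg: "0 \<le> lattice_const"
  unfolding lattice_const_def by (intro integral_nonneg_AE AE_I2) simp

text \<open>With s the shifted point one has 2 pi k = s - t, so k^2 \<le> 2 s^2 + 2 Y^2. Hence one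
  convergent series over k bounds the sums for all shifts in a bounded range.\<close>

lemma inverse_square_shift:
  fixes t Y :: real and k :: int
  assumes "\<bar>t\<bar> \<le> Y"
  shows "1 / (1 + (t + 2 * pi * of_int k)\<^sup>2) \<le> (2 + 2 * Y\<^sup>2) * (1 / (1 + (of_int k)\<^sup>2))"
proof -
  let ?s = "t + 2 * pi * of_int k"
  have "(of_int k)\<^sup>2 \<le> (2 * pi * of_int k :: real)\<^sup>2"
    unfolding abs_le_square_iff[symmetric] abs_mult using pi_gt3 by (simp add: mult_le_cancel_right1)
  also have "\<dots> = (?s - t)\<^sup>2" by simp
  also have "\<dots> \<le> 2 * ?s\<^sup>2 + 2 * t\<^sup>2"
  proof -
    have "(s - t)\<^sup>2 \<le> 2 * s\<^sup>2 + 2 * t\<^sup>2" for s :: real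
      using zero_le_power2[of "s + t"] by (simp add: power2_eq_square algebra_simps)
    then show ?thesis .
  qed
  also have "t\<^sup>2 \<le> Y\<^sup>2" using assms power2_le_iff_abs_le[of Y t] by linarith
  finally have "1 + (of_int k)\<^sup>2 \<le> 1 + 2 * ?s\<^sup>2 + 2 * Y\<^sup>2" by simp
  also have "\<dots> \<le> (2 + 2 * Y\<^sup>2) * (1 + ?s\<^sup>2)"
    using mult_nonneg_nonneg[of "2 * Y\<^sup>2" "?s\<^sup>2"] by (simp add: distrib_left distrib_right)
  finally have "1 + (of_int k)\<^sup>2 \<le> (2 + 2 * Y\<^sup>2) * (1 + ?s\<^sup>2)" .
  moreover have "0 < 1 + (of_int k :: real)\<^sup>2" "0 < 1 + ?s\<^sup>2" by (auto simp: add_pos_nonneg)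
  moreover have "1 / b \<le> K * (1 / a)" if "a \<le> K * b" "0 < a" "0 < b" for a b K :: real
    using that by (simp add: field_simps)
  ultimately show ?thesis by blast
qed

lemma lattice_term_bound:
  assumes "\<And>\<xi>. Re \<xi> = Re \<zeta> \<Longrightarrow> cmod (G \<xi>) \<le> C / (1 + (Im \<xi>)\<^sup>2)" "\<bar>Im \<zeta>\<bar> \<le> Y"
  shows "cmod (G (\<zeta> + 2 * of_real pi * \<i> * of_int k)) \<le> C * (2 + 2 * Y\<^sup>2) * (1 / (1 + (of_int k)\<^sup>2))"
proof -
  have "0 \<le> cmod (G (of_real (Re \<zeta>)))" by simp
  also have "\<dots> \<le> C" using assms(1)[of "of_real (Re \<zeta>)"] by simp
  finally have C: "0 \<le> C" .
  have "cmod (G (\<zeta> + 2 * of_real pi * \<i> * of_int k)) \<le> C * (1 / (1 + (Im \<zeta> + 2 * pi * of_int k)\<^sup>2))"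
    using assms(1)[of "\<zeta> + 2 * of_real pi * \<i> * of_int k"] by simp
  also have "\<dots> \<le> C * ((2 + 2 * Y\<^sup>2) * (1 / (1 + (of_int k)\<^sup>2)))"
    by (intro mult_left_mono inverse_square_shift assms C)
  finally show ?thesis by (simp only: mult.assoc)
qed

lemma lattice_integrable:
  assumes "\<And>\<xi>. Re \<xi> = Re \<zeta> \<Longrightarrow> cmod (G \<xi>) \<le> C / (1 + (Im \<xi>)\<^sup>2)"
  shows "integrable (count_space UNIV) (\<lambda>k::int. G (\<zeta> + 2 * of_real pi * \<i> * of_int k))"
proof (rule Bochner_Integration.integrable_bound)
  let ?b = "\<lambda>k::int. C * (2 + 2 * \<bar>Im \<zeta>\<bar>\<^sup>2) * (1 / (1 + (of_int k)\<^sup>2))"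
  show "integrable (count_space UNIV) ?b"
    by (rule integrable_mult_right[OF integrable_int_inverse_square])
  show "AE k in count_space UNIV. cmod (G (\<zeta> + 2 * of_real pi * \<i> * of_int k)) \<le> norm (?b k)"
    by (intro AE_I2 order_trans[OF lattice_term_bound[OF assms order_refl]]) (simp_all only: real_norm_def abs_ge_self)
qed simp

lemma lattice_sum_bound:
  assumes "\<And>\<xi>. Re \<xi> = Re \<zeta> \<Longrightarrow> cmod (G \<xi>) \<le> C / (1 + (Im \<xi>)\<^sup>2)" "\<bar>Im \<zeta>\<bar> \<le> Y"
  shows "cmod (lattice_sum G \<zeta>) \<le> C * ((2 + 2 * Y\<^sup>2) * lattice_const)"
proof -
  have "cmod (lattice_sum G \<zeta>) \<le> (\<integral>k. C * (2 + 2 * Y\<^sup>2) * (1 / (1 + (of_int k)\<^sup>2)) \<partial>count_space (UNIV :: int set))"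
    unfolding lattice_sum_def
    by (intro norm_integral_le integrable_mult_right integrable_int_inverse_square lattice_term_bound assms)
  also have "\<dots> = C * (2 + 2 * Y\<^sup>2) * lattice_const" unfolding lattice_const_def by (rule integral_mult_right_zero)
  finally show ?thesis by (simp only: mult.assoc)
qed

lemma lattice_sum_shift:
  "lattice_sum G (\<zeta> + 2 * of_real pi * \<i> * of_int n) = lattice_sum G \<zeta>"
proof -
  have "bij_betw (\<lambda>k::int. n + k) UNIV UNIV" by (rule bij_betw_byWitness[of _ "\<lambda>k. k - n"]) auto
  from integral_bij_count_space[OF this, of "\<lambda>k. G (\<zeta> + 2 * of_real pi * \<i> * of_int k)"]
  show ?thesis by (simp add: lattice_sum_def algebra_simps)
qed

text \<open>Two logarithms differ by a lattice period, so any of them may replace the principal one.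
  In particular the cut of \<open>Ln\<close> leaves no trace in \<open>disc_sum\<close>.\<close>

lemma disc_sum_eq:
  assumes "exp (- \<zeta>) = z"
  shows "disc_sum G z = lattice_sum G \<zeta>"
proof -
  have "exp (- \<zeta>) = exp (Ln z)" using assms by (metis exp_Ln exp_not_eq_zero)
  then obtain n :: int where "- \<zeta> = Ln z + of_real (of_int (2 * n) * pi) * \<i>" unfolding exp_eq by blast
  then have "- Ln z = \<zeta> + 2 * of_real pi * \<i> * of_int n"
    by (auto simp: complex_eq_iff algebra_simps)
  then show ?thesis by (simp only: disc_sum_def lattice_sum_shift)
qed

text \<open>The value of the shift bound at Y = pi, which covers the imaginary part of a principal
  logarithm; the 1 makes it positive.\<close>

definition disc_const :: real where "disc_const = (2 + 2 * pi\<^sup>2) * lattice_const + 1"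

lemma disc_const_pos: "0 < disc_const"
  unfolding disc_const_def using lattice_const_nonneg by (intro add_nonneg_pos) auto

lemma disc_sum_bound:
  assumes "z \<noteq> 0" "\<And>\<xi>. Re \<xi> = - ln (cmod z) \<Longrightarrow> cmod (G \<xi>) \<le> C / (1 + (Im \<xi>)\<^sup>2)"
  shows "cmod (disc_sum G z) \<le> C * disc_const"
proof -
  have "0 \<le> cmod (G (of_real (- ln (cmod z))))" by simp
  also have "\<dots> \<le> C" using assms(2)[of "of_real (- ln (cmod z))"] by simp
  finally have C: "0 \<le> C" .
  have "\<bar>Im (Ln z)\<bar> \<le> pi" using mpi_less_Im_Ln[OF assms(1)] Im_Ln_le_pi[OF assms(1)] by simp
  then have "cmod (disc_sum G z) \<le> C * ((2 + 2 * pi\<^sup>2) * lattice_const)"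
    unfolding disc_sum_def using assms by (intro lattice_sum_bound) auto
  also have "\<dots> \<le> C * disc_const" unfolding disc_const_def by (intro mult_left_mono C) simp
  finally show ?thesis .
qed

lemma holomorphic_lattice_sum:
  assumes "halfplane_decay G"
  shows "lattice_sum G holomorphic_on right_half"
  unfolding lattice_sum_def
proof (rule holomorphic_on_integral)
  show "open right_half" by (rule open_halfspace_Re_gt)
  show "(\<lambda>z. G (z + 2 * of_real pi * \<i> * of_int k)) holomorphic_on right_half" for k :: int
  proof -
    have "(G \<circ> (\<lambda>z. z + 2 * of_real pi * \<i> * of_int k)) holomorphic_on right_half"
      using assms by (intro holomorphic_on_compose_gen[of _ _ _ right_half] holomorphic_intros)
        (auto simp: halfplane_decay_def)
    then show ?thesis by (simp add: o_def)
  qed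
  fix z assume z: "z \<in> right_half"
  \<comment> \<open>Since Re z = 2 r, the ball of radius r around z lies in the strip between r and
    3 r.\<close>
  define r where "r = Re z / 2"
  define Y where "Y = \<bar>Im z\<bar> + r"
  have r: "0 < r" using z by (simp add: r_def)
  obtain C where C: "\<And>\<zeta>. r \<le> Re \<zeta> \<and> Re \<zeta> \<le> 3 * r \<Longrightarrow> cmod (G \<zeta>) \<le> C / (1 + (Im \<zeta>)\<^sup>2)"
    using assms r unfolding halfplane_decay_def by meson
  have w: "r \<le> Re w" "Re w \<le> 3 * r" "\<bar>Im w\<bar> \<le> Y" if "w \<in> ball z r" for w
  proof -
    have "cmod (w - z) < r" using that by (simp add: dist_norm norm_minus_commute)
    then have "\<bar>Re w - Re z\<bar> < r" "\<bar>Im w - Im z\<bar> < r"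
      using abs_Re_le_cmod[of "w - z"] abs_Im_le_cmod[of "w - z"] by auto
    then show "r \<le> Re w" "Re w \<le> 3 * r" "\<bar>Im w\<bar> \<le> Y" unfolding r_def Y_def by arith+
  qed
  show "\<exists>r>0. \<exists>B. integrable (count_space UNIV) B \<and> ball z r \<subseteq> right_half \<and>
      (\<forall>w\<in>ball z r. \<forall>k\<in>space (count_space UNIV). cmod (G (w + 2 * of_real pi * \<i> * of_int k)) \<le> B k)"
  proof (intro exI[of _ r] exI[of _ "\<lambda>k. C * (2 + 2 * Y\<^sup>2) * (1 / (1 + (of_int k)\<^sup>2))"] conjI r ballI subsetI)
    show "integrable (count_space UNIV) (\<lambda>k::int. C * (2 + 2 * Y\<^sup>2) * (1 / (1 + (of_int k)\<^sup>2)))"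
      by (rule integrable_mult_right[OF integrable_int_inverse_square])
    show "v \<in> right_half" if "v \<in> ball z r" for v using w(1)[OF that] r by simp
    show "cmod (G (v + 2 * of_real pi * \<i> * of_int k)) \<le> C * (2 + 2 * Y\<^sup>2) * (1 / (1 + (of_int k)\<^sup>2))"
      if "v \<in> ball z r" for v and k :: int
      using w[OF that] by (intro lattice_term_bound C) auto
  qed
qed simp

text \<open>Two charts cover the punctured disc: off the negative axis the logarithm is
  \<open>Ln z\<close>, off the positive axis it is \<open>Ln (- z) + \<i> * pi\<close>. By
  periodicity both give the same lattice sum.\<close>

lemma holomorphic_disc_sum:
  assumes "halfplane_decay G"
  shows "disc_sum G holomorphic_on ball 0 1 - {0}"
proof -
  let ?L = "lattice_sum G"
  have neg: "Re (Ln z) < 0" if "z \<in> ball 0 1 - {0}" for z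
    using that by (simp add: Re_Ln)
  define U1 :: "complex set" where "U1 = (ball 0 1 - {0}) \<inter> (- \<real>\<^sub>\<le>\<^sub>0)"
  define U2 :: "complex set" where "U2 = (ball 0 1 - {0}) \<inter> (uminus -` (- \<real>\<^sub>\<le>\<^sub>0))"
  have op: "open U1" "open U2"
    unfolding U1_def U2_def
    using open_negations[of "- \<real>\<^sub>\<le>\<^sub>0 :: complex set"]
    by (auto intro!: open_Int open_Diff open_vimage continuous_intros)
  have 1: "disc_sum G holomorphic_on U1"
  proof -
    have "(?L \<circ> (\<lambda>z. - Ln z)) holomorphic_on U1"
    proof (rule holomorphic_on_compose_gen[OF _ holomorphic_lattice_sum[OF assms]])
      show "(\<lambda>z. - Ln z) holomorphic_on U1" by (intro holomorphic_intros) (auto simp: U1_def)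
    qed (use neg in \<open>auto simp: U1_def\<close>)
    then show ?thesis by (simp add: o_def disc_sum_def[abs_def])
  qed
  have 2: "disc_sum G holomorphic_on U2"
  proof -
    have "(?L \<circ> (\<lambda>z. - Ln (- z) - \<i> * of_real pi)) holomorphic_on U2"
    proof (rule holomorphic_on_compose_gen[OF _ holomorphic_lattice_sum[OF assms]])
      show "(\<lambda>z. - Ln (- z) - \<i> * of_real pi) holomorphic_on U2" by (intro holomorphic_intros) (auto simp: U2_def)
    qed (use neg[of "- _"] in \<open>auto simp: U2_def\<close>)
    moreover have "(?L \<circ> (\<lambda>z. - Ln (- z) - \<i> * of_real pi)) z = disc_sum G z" if "z \<in> U2" for z
      unfolding o_def using that
      by (intro disc_sum_eq[symmetric]) (auto simp: U2_def exp_add exp_minus)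
    ultimately show ?thesis by (simp cong: holomorphic_cong)
  qed
  have "U1 \<union> U2 = ball 0 1 - {0}"
    by (auto simp: U1_def U2_def complex_nonpos_Reals_iff complex_eq_iff)
  then show ?thesis using holomorphic_on_Un[OF 1 2 op] by simp
qed

section \<open>Circle integrals in the punctured disc\<close>

lemma punctured_circle_independent:
  assumes f: "f holomorphic_on ball 0 1 - {0}" and r: "0 < r" "r < 1" and s: "0 < s" "s < 1"
  shows "contour_integral (circlepath 0 r) f = contour_integral (circlepath 0 s) f"
proof -
  have "contour_integral (circlepath 0 b) f = contour_integral (circlepath 0 a) f"
    if "0 < a" "a \<le> b" "b < 1" for a b
    by (rule contour_integral_circlepath_eq(3)[OF open_ball f]) (use that in auto)
  then show ?thesis using r s by (metis linear)
qed

lemma punctured_circle_integrable: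
  assumes f: "f holomorphic_on ball 0 1 - {0}" and r: "0 < r" "r < 1"
  shows "f contour_integrable_on circlepath 0 r"
  by (rule contour_integral_circlepath_eq(1)[OF open_ball f, of r r]) (use r in auto)

text \<open>Compare Cauchy's formula on an annulus around z0 with the mean value on the outer circle.\<close>
lemma laurent_mean_estimate:
  assumes f: "f holomorphic_on ball 0 1 - {0}"
    and r: "0 < r1" "r1 < cmod z0" "cmod z0 < r2" "r2 < 1"
    and M: "\<And>z. cmod z = r1 \<Longrightarrow> cmod (f z) \<le> M" "\<And>z. cmod z = r2 \<Longrightarrow> cmod (f z) \<le> M"
  shows "cmod (f z0 - contour_integral (circlepath 0 r2) (\<lambda>z. f z / z) / (2 * of_real pi * \<i>))
    \<le> M * cmod z0 / (r2 - cmod z0) + M * r1 / (cmod z0 - r1)"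
proof -
  let ?D = "ball 0 1 - {0 :: complex}" and ?c = "2 * of_real pi * \<i> :: complex"
  have oD: "open ?D" by (intro open_Diff open_ball) auto
  have M0: "0 \<le> M" using order_trans[OF norm_ge_zero M(1)[of "of_real r1"]] r by simp
  have r2: "0 < r2" using r by linarith
  define \<phi> where "\<phi> = (\<lambda>z. if z = z0 then deriv f z0 else (f z - f z0) / (z - z0))"
  have \<phi>: "\<phi> holomorphic_on ?D" unfolding \<phi>_def by (rule pole_lemma_open[OF f oD])
  have cf: "continuous_on (sphere 0 s) f" if "0 < s" "s < 1" for s
    by (rule continuous_on_subset[OF holomorphic_on_imp_continuous_on[OF f]]) (use that in auto)
  have int: "(\<lambda>z. f z / (z - z0)) contour_integrable_on circlepath 0 s"
    if "0 < s" "s < 1" "s \<noteq> cmod z0" for s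
    using that cf[OF that(1,2)]
    by (intro contour_integrable_continuous_circlepath) (auto intro!: continuous_intros)
  have int0: "(\<lambda>z. f z / z) contour_integrable_on circlepath 0 s" if "0 < s" "s < 1" for s
    using that cf[OF that(1,2)]
    by (intro contour_integrable_continuous_circlepath) (auto intro!: continuous_intros)
  have split: "contour_integral (circlepath 0 s) \<phi> = contour_integral (circlepath 0 s) (\<lambda>z. f z / (z - z0))
      - f z0 * k" if s: "0 < s" "s < 1" "s \<noteq> cmod z0"
      and k: "((\<lambda>z. 1 / (z - z0)) has_contour_integral k) (circlepath 0 s)" for s k
  proof -
    have "contour_integral (circlepath 0 s) \<phi>
        = contour_integral (circlepath 0 s) (\<lambda>z. f z / (z - z0) - f z0 * (1 / (z - z0)))"
      by (rule contour_integral_cong) (use s in \<open>auto simp: \<phi>_def diff_divide_distrib\<close>)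
    also have "\<dots> = contour_integral (circlepath 0 s) (\<lambda>z. f z / (z - z0))
        - contour_integral (circlepath 0 s) (\<lambda>z. f z0 * (1 / (z - z0)))"
      by (rule contour_integral_diff[OF int[OF s]])
        (rule has_contour_integral_integrable[OF has_contour_integral_lmul[OF k]])
    also have "contour_integral (circlepath 0 s) (\<lambda>z. f z0 * (1 / (z - z0))) = f z0 * k"
      by (rule contour_integral_unique[OF has_contour_integral_lmul[OF k]])
    finally show ?thesis .
  qed
  have k2: "((\<lambda>z. 1 / (z - z0)) has_contour_integral ?c) (circlepath 0 r2)"
    using Cauchy_integral_circlepath[of 0 r2 "\<lambda>_. 1" z0] r by simp
  have k1: "((\<lambda>z. 1 / (z - z0)) has_contour_integral 0) (circlepath 0 r1)"
  proof (rule Cauchy_theorem_disc_simple[of _ 0 "cmod z0"])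
    show "(\<lambda>z. 1 / (z - z0)) holomorphic_on ball 0 (cmod z0)"
      by (intro holomorphic_intros) auto
  qed (use r in auto)
  have "contour_integral (circlepath 0 r2) \<phi> = contour_integral (circlepath 0 r1) \<phi>"
    by (rule punctured_circle_independent[OF \<phi>]) (use r r2 in auto)
  moreover have "contour_integral (circlepath 0 r2) \<phi>
      = contour_integral (circlepath 0 r2) (\<lambda>z. f z / (z - z0)) - f z0 * ?c"
    by (rule split[OF _ _ _ k2]) (use r r2 in auto)
  moreover have "contour_integral (circlepath 0 r1) \<phi>
      = contour_integral (circlepath 0 r1) (\<lambda>z. f z / (z - z0)) - f z0 * 0"
    by (rule split[OF _ _ _ k1]) (use r r2 in auto)
  ultimately have cauchy: "f z0 * ?c = contour_integral (circlepath 0 r2) (\<lambda>z. f z / (z - z0))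
      - contour_integral (circlepath 0 r1) (\<lambda>z. f z / (z - z0))" by (simp add: algebra_simps)
  define I1 where "I1 = contour_integral (circlepath 0 r1) (\<lambda>z. f z / (z - z0))"
  define I2 where "I2 = contour_integral (circlepath 0 r2) (\<lambda>z. f z / (z - z0)) - contour_integral (circlepath 0 r2) (\<lambda>z. f z / z)"
  have b1: "cmod I1 \<le> M / (cmod z0 - r1) * (2 * pi * r1)"
  proof (rule has_contour_integral_bound_circlepath)
    show "((\<lambda>z. f z / (z - z0)) has_contour_integral I1) (circlepath 0 r1)"
      unfolding I1_def by (rule has_contour_integral_integral[OF int]) (use r in auto)
    show "cmod (f z / (z - z0)) \<le> M / (cmod z0 - r1)" if "cmod (z - 0) = r1" for z
      unfolding norm_divide using M(1)[of z] that r norm_triangle_ineq2[of z0 z] M0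
      by (intro frac_le) (auto simp: norm_minus_commute)
  qed (use r M0 in auto)
  have b2: "cmod I2 \<le> M * cmod z0 / (r2 * (r2 - cmod z0)) * (2 * pi * r2)"
  proof (rule has_contour_integral_bound_circlepath)
    have "((\<lambda>z. f z / (z - z0) - f z / z) has_contour_integral I2) (circlepath 0 r2)"
      unfolding I2_def
      by (intro has_contour_integral_diff has_contour_integral_integral int int0) (use r r2 in auto)
    then show "((\<lambda>z. f z / (z - z0) - f z / z) has_contour_integral I2) (circlepath 0 r2)" .
    show "cmod (f z / (z - z0) - f z / z) \<le> M * cmod z0 / (r2 * (r2 - cmod z0))" if "cmod (z - 0) = r2" for z
    proof -
      have nz: "z \<noteq> 0" "z \<noteq> z0" using that r r2 by auto
      then have "f z / (z - z0) - f z / z = f z * z0 / (z * (z - z0))" by (simp add: field_simps)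
      also have "cmod \<dots> \<le> M * cmod z0 / (r2 * (r2 - cmod z0))"
        unfolding norm_divide norm_mult
        using M(2)[of z] that r r2 norm_triangle_ineq2[of z z0] M0
        by (intro frac_le mult_mono mult_pos_pos) auto
      finally show ?thesis .
    qed
  qed (use r r2 M0 in auto)
  have "(f z0 - contour_integral (circlepath 0 r2) (\<lambda>z. f z / z) / ?c) * ?c = I2 - I1"
    using cauchy by (simp add: I1_def I2_def left_diff_distrib)
  then have "f z0 - contour_integral (circlepath 0 r2) (\<lambda>z. f z / z) / ?c = (I2 - I1) / ?c"
    by (simp add: nonzero_eq_divide_eq)
  also have "cmod \<dots> = cmod (I2 - I1) / (2 * pi)" by (simp add: norm_divide norm_mult)
  also have "\<dots> \<le> (cmod I2 + cmod I1) / (2 * pi)" by (intro divide_right_mono norm_triangle_ineq4) simp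
  also have "\<dots> \<le> (M * cmod z0 / (r2 * (r2 - cmod z0)) * (2 * pi * r2) + M / (cmod z0 - r1) * (2 * pi * r1)) / (2 * pi)"
    by (intro divide_right_mono add_mono b1 b2) simp
  also have "\<dots> = M * cmod z0 / (r2 - cmod z0) + M * r1 / (cmod z0 - r1)"
    using r2 by (simp add: add_divide_distrib)
  finally show ?thesis .
qed

text \<open>The window from 1 - N to N is off centre by one so that a telescoping sum over it ends
  at the indices N and - N, which correspond to points symmetric about the real axis.\<close>

lemma lattice_partial_sums:
  assumes int: "integrable (count_space UNIV) (\<lambda>k::int. h k :: complex)"
  shows "(\<lambda>N. \<Sum>k\<in>{1 - int N..int N}. h k) \<longlonglongrightarrow> (\<integral>k. h k \<partial>count_space UNIV)"
proof -
  have "(\<integral>k. (if k \<in> {1 - int N..int N} then h k else 0) \<partial>count_space UNIV) = (\<Sum>k\<in>{1 - int N..int N}. h k)" for N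
  proof (subst lebesgue_integral_count_space_finite_support)
    show "finite {a \<in> UNIV. (if a \<in> {1 - int N..int N} then h a else 0) \<noteq> 0}"
      by (rule finite_subset[of _ "{1 - int N..int N}"]) auto
  qed (intro sum.mono_neutral_cong_left, auto)
  moreover have "(\<lambda>N. \<integral>k. (if k \<in> {1 - int N..int N} then h k else 0) \<partial>count_space UNIV)
      \<longlonglongrightarrow> (\<integral>k. h k \<partial>count_space UNIV)"
  proof (rule integral_dominated_convergence[where w = "\<lambda>k. cmod (h k)"])
    show "AE k in count_space UNIV. (\<lambda>N. if k \<in> {1 - int N..int N} then h k else 0) \<longlonglongrightarrow> h k"
    proof (rule AE_I2)
      fix k :: int
      have "\<forall>\<^sub>F N in sequentially. (if k \<in> {1 - int N..int N} then h k else 0) = h k"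
        using eventually_ge_at_top[of "nat \<bar>k\<bar> + 1"] by eventually_elim auto
      then show "(\<lambda>N. if k \<in> {1 - int N..int N} then h k else 0) \<longlonglongrightarrow> h k"
        by (rule tendsto_eventually)
    qed
  qed (use int in auto)
  ultimately show ?thesis by (simp only:)
qed

lemma sum_symmetric_telescope:
  fixes u :: "int \<Rightarrow> complex"
  shows "(\<Sum>k\<in>{1 - int N..int N}. u k - u (k - 1)) = u (int N) - u (- int N)"
proof (induction N)
  case (Suc N)
  have "{1 - int (Suc N)..int (Suc N)} = insert (- int N) (insert (int N + 1) {1 - int N..int N})"
    by auto
  moreover have "u (- 1 - int N) = u (- int N - 1)" by (rule arg_cong[where f = u]) simp
  ultimately show ?case using Suc by (simp add: algebra_simps)
qed simp

text \<open>Unfolding: under z = exp (- \<zeta>) one turn around the circle lifts to a vertical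
  segment of length 2 pi, and the sum over the lattice glues its translates to the whole line Re
  \<zeta> = a. So the circle integral equals the integral of G along that line, which the primitive
  evaluates.\<close>

lemma disc_sum_mean:
  assumes G: "halfplane_decay G"
    and \<Gamma>: "\<And>\<zeta>. 0 < Re \<zeta> \<Longrightarrow> (\<Gamma> has_field_derivative G \<zeta>) (at \<zeta>)"
    and a: "0 < a"
    and lim: "((\<lambda>T. \<Gamma> (of_real a + \<i> * of_real T) - \<Gamma> (of_real a - \<i> * of_real T)) \<longlongrightarrow> L) at_top"
  shows "contour_integral (circlepath 0 (exp (- a))) (\<lambda>z. disc_sum G z / z) = L"
proof -
  \<comment> \<open>The minus sign lets exp (- \<zeta>) run counterclockwise while \<zeta> moves
    down; since dz / z = - d\<zeta>, the line is in effect traversed upwards.\<close>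
  define \<zeta> where "\<zeta> k t = of_real a - 2 * of_real pi * \<i> * of_real t + 2 * of_real pi * \<i> * of_int k" for k t
  have Re\<zeta>: "Re (\<zeta> k t) = a" for k t by (simp add: \<zeta>_def)
  obtain C where C: "\<And>\<xi>. a \<le> Re \<xi> \<and> Re \<xi> \<le> a \<Longrightarrow> cmod (G \<xi>) \<le> C / (1 + (Im \<xi>)\<^sup>2)"
    using G a unfolding halfplane_decay_def by meson
  have 1: "contour_integral (circlepath 0 (exp (- a))) (\<lambda>z. disc_sum G z / z)
      = integral {0..1} (\<lambda>t. 2 * of_real pi * \<i> * lattice_sum G (\<zeta> 0 t))"
    unfolding contour_integral_integral
  proof (rule Henstock_Kurzweil_Integration.integral_cong)
    fix t :: real assume "t \<in> {0..1}"
    have c: "circlepath 0 (exp (- a)) t = exp (- \<zeta> 0 t)"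
      by (simp add: circlepath \<zeta>_def exp_diff exp_minus exp_of_real[symmetric] field_simps)
    have v: "vector_derivative (circlepath 0 (exp (- a))) (at t) = 2 * of_real pi * \<i> * exp (- \<zeta> 0 t)"
      using c unfolding vector_derivative_circlepath by (simp add: circlepath)
    show "disc_sum G (circlepath 0 (exp (- a)) t) / circlepath 0 (exp (- a)) t
        * vector_derivative (circlepath 0 (exp (- a))) (at t) = 2 * of_real pi * \<i> * lattice_sum G (\<zeta> 0 t)"
      unfolding v c disc_sum_eq[OF refl] by simp
  qed
  define S where "S N t = (\<Sum>k\<in>{1 - int N..int N}. 2 * of_real pi * \<i> * G (\<zeta> k t))" for N t
  have integ: "((\<lambda>t. 2 * of_real pi * \<i> * G (\<zeta> k t)) has_integral (\<Gamma> (\<zeta> k 0) - \<Gamma> (\<zeta> (k - 1) 0))) {0..1}" for k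
  proof -
    have "((\<lambda>t. - \<Gamma> (\<zeta> k t)) has_vector_derivative (2 * of_real pi * \<i> * G (\<zeta> k t))) (at t within {0..1})" for t
    proof -
      have "((\<lambda>t. \<zeta> k t) has_vector_derivative (- 2 * of_real pi * \<i>)) (at t within {0..1})"
        unfolding \<zeta>_def by (auto intro!: derivative_eq_intros)
      from field_vector_diff_chain_within[OF this, of \<Gamma> "G (\<zeta> k t)"] \<Gamma>[of "\<zeta> k t"] Re\<zeta> a
      have "((\<Gamma> \<circ> (\<lambda>t. \<zeta> k t)) has_vector_derivative (- 2 * of_real pi * \<i> * G (\<zeta> k t))) (at t within {0..1})"
        by (simp add: has_field_derivative_at_within)
      from has_vector_derivative_minus[OF this] show ?thesis by (simp add: o_def)
    qed
    from fundamental_theorem_of_calculus[OF _ this]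
    have "((\<lambda>t. 2 * of_real pi * \<i> * G (\<zeta> k t)) has_integral (- \<Gamma> (\<zeta> k 1) - - \<Gamma> (\<zeta> k 0))) {0..1}" by simp
    moreover have "\<zeta> k 1 = \<zeta> (k - 1) 0" by (simp add: \<zeta>_def algebra_simps)
    ultimately show ?thesis by simp
  qed
  have S_int: "(S N has_integral (\<Gamma> (\<zeta> (int N) 0) - \<Gamma> (\<zeta> (- int N) 0))) {0..1}" for N
    unfolding S_def sum_symmetric_telescope[of "\<lambda>k. \<Gamma> (\<zeta> k 0)", symmetric]
    by (intro has_integral_sum integ) simp
  have bound: "cmod (S N t) \<le> 2 * pi * (C * (2 + 2 * (2 * pi)\<^sup>2) * lattice_const)" if t: "t \<in> {0..1}" for N t
  proof -
    \<comment> \<open>The imaginary part is - 2 pi t with t between 0 and 1. The resulting bound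
      depends on neither N nor t and is the majorant for dominated convergence.\<close>
    have Y: "\<bar>Im (\<zeta> 0 t)\<bar> \<le> 2 * pi" using t by (simp add: \<zeta>_def abs_mult)
    have b: "cmod (G (\<zeta> k t)) \<le> C * (2 + 2 * (2 * pi)\<^sup>2) * (1 / (1 + (of_int k)\<^sup>2))" for k
    proof -
      have "cmod (G (\<zeta> 0 t + 2 * of_real pi * \<i> * of_int k)) \<le> C * (2 + 2 * (2 * pi)\<^sup>2) * (1 / (1 + (of_int k)\<^sup>2))"
        using Re\<zeta> by (intro lattice_term_bound[OF C Y]) auto
      then show ?thesis by (simp add: \<zeta>_def)
    qed
    have C0: "0 \<le> C * (2 + 2 * (2 * pi)\<^sup>2)" using order_trans[OF norm_ge_zero b[of 0]] by simp
    have "cmod (S N t) \<le> (\<Sum>k\<in>{1 - int N..int N}. 2 * pi * (C * (2 + 2 * (2 * pi)\<^sup>2) * (1 / (1 + (of_int k)\<^sup>2))))"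
      unfolding S_def
    proof (rule sum_norm_le)
      fix k
      have "cmod (2 * of_real pi * \<i> * G (\<zeta> k t)) = 2 * pi * cmod (G (\<zeta> k t))" by (simp add: norm_mult)
      also have "\<dots> \<le> 2 * pi * (C * (2 + 2 * (2 * pi)\<^sup>2) * (1 / (1 + (of_int k)\<^sup>2)))"
        by (rule mult_left_mono[OF b]) simp
      finally show "cmod (2 * of_real pi * \<i> * G (\<zeta> k t)) \<le> 2 * pi * (C * (2 + 2 * (2 * pi)\<^sup>2) * (1 / (1 + (of_int k)\<^sup>2)))" .
    qed
    also have "\<dots> = 2 * pi * (C * (2 + 2 * (2 * pi)\<^sup>2) * (\<Sum>k\<in>{1 - int N..int N}. 1 / (1 + (of_int k)\<^sup>2)))"
      by (simp only: sum_distrib_left)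
    also have "\<dots> \<le> 2 * pi * (C * (2 + 2 * (2 * pi)\<^sup>2) * lattice_const)"
    proof (intro mult_left_mono C0)
      have "(\<Sum>k\<in>{1 - int N..int N}. 1 / (1 + (of_int k)\<^sup>2) :: real)
          = (\<integral>k. (if k \<in> {1 - int N..int N} then 1 / (1 + (of_int k)\<^sup>2) else 0) \<partial>count_space UNIV)"
      proof (subst lebesgue_integral_count_space_finite_support)
        show "finite {a \<in> UNIV. (if a \<in> {1 - int N..int N} then 1 / (1 + (of_int a)\<^sup>2) else 0 :: real) \<noteq> 0}"
          by (rule finite_subset[of _ "{1 - int N..int N}"]) auto
      qed (intro sum.mono_neutral_cong_right, auto)
      also have "\<dots> \<le> lattice_const" unfolding lattice_const_def
        by (intro integral_mono' integrable_int_inverse_square) auto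
      finally show "(\<Sum>k\<in>{1 - int N..int N}. 1 / (1 + (of_int k)\<^sup>2)) \<le> lattice_const" .
    qed simp
    finally show ?thesis .
  qed
  have conv: "(\<lambda>N. S N t) \<longlonglongrightarrow> 2 * of_real pi * \<i> * lattice_sum G (\<zeta> 0 t)" for t
  proof -
    have "integrable (count_space UNIV) (\<lambda>k::int. G (\<zeta> 0 t + 2 * of_real pi * \<i> * of_int k))"
      using Re\<zeta> by (intro lattice_integrable[of _ _ C] C) auto
    from lattice_partial_sums[OF this]
    have "(\<lambda>N. 2 * of_real pi * \<i> * (\<Sum>k\<in>{1 - int N..int N}. G (\<zeta> 0 t + 2 * of_real pi * \<i> * of_int k)))
      \<longlonglongrightarrow> 2 * of_real pi * \<i> * lattice_sum G (\<zeta> 0 t)"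
      unfolding lattice_sum_def by (intro tendsto_mult tendsto_const)
    then show ?thesis by (simp add: S_def \<zeta>_def sum_distrib_left)
  qed
  have "(\<lambda>N. integral {0..1} (S N)) \<longlonglongrightarrow> integral {0..1} (\<lambda>t. 2 * of_real pi * \<i> * lattice_sum G (\<zeta> 0 t))"
    by (rule dominated_convergence(2)[of _ _ "\<lambda>_. 2 * pi * (C * (2 + 2 * (2 * pi)\<^sup>2) * lattice_const)"])
      (use S_int bound conv in \<open>auto simp: integrable_on_def\<close>)
  moreover have "(\<lambda>N. integral {0..1} (S N)) \<longlonglongrightarrow> L"
  proof -
    have "filterlim (\<lambda>N. 2 * pi * real N) at_top sequentially"
      by (intro filterlim_tendsto_pos_mult_at_top[OF tendsto_const] filterlim_real_sequentially) simp
    from filterlim_compose[OF lim this]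
    show ?thesis by (simp add: integral_unique[OF S_int] \<zeta>_def mult_ac)
  qed
  ultimately show ?thesis using 1 LIMSEQ_unique by metis
qed

section \<open>The Airy function as a mean of lattice sums\<close>

text \<open>A convergence test for improper integrals in terms of primitives: the increments of f
  are dominated by those of a convergent g, which also gives the rate. It is applied with multiples
  of arctan and of a negative exponential.\<close>

lemma tendsto_at_top_dominated:
  fixes f :: "real \<Rightarrow> 'a::banach" and g :: "real \<Rightarrow> real"
  assumes le: "\<And>s t. 0 \<le> s \<Longrightarrow> s \<le> t \<Longrightarrow> norm (f t - f s) \<le> g t - g s"
    and g: "(g \<longlongrightarrow> l) at_top"
  obtains L where "(f \<longlongrightarrow> L) at_top" "\<And>t. 0 \<le> t \<Longrightarrow> norm (f t - L) \<le> l - g t"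
proof -
  have gn: "(\<lambda>n. g (real n)) \<longlonglongrightarrow> l"
    using filterlim_compose[OF g filterlim_real_sequentially] .
  have "Cauchy (\<lambda>n. f (real n))"
  proof (rule CauchyI)
    fix e :: real assume "0 < e"
    then obtain M where M: "\<And>m n. m \<ge> M \<Longrightarrow> n \<ge> M \<Longrightarrow> norm (g (real m) - g (real n)) < e"
      using CauchyD[OF LIMSEQ_imp_Cauchy[OF gn]] by blast
    have "norm (f (real m) - f (real n)) < e" if "m \<ge> M" "n \<ge> M" for m n
    proof (cases "n \<le> m")
      case True
      then show ?thesis using le[of n m] M[OF that] by simp
    next
      case False
      then show ?thesis using le[of m n] M[OF that(2,1)] by (simp add: norm_minus_commute)
    qed
    then show "\<exists>M. \<forall>m\<ge>M. \<forall>n\<ge>M. norm (f (real m) - f (real n)) < e" by blast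
  qed
  then obtain L where L: "(\<lambda>n. f (real n)) \<longlonglongrightarrow> L" using Cauchy_convergent convergent_def by blast
  have bd: "norm (f t - L) \<le> l - g t" if t: "0 \<le> t" for t
  proof (rule tendsto_le[OF trivial_limit_sequentially])
    show "(\<lambda>n. g (real n) - g t) \<longlonglongrightarrow> l - g t" by (intro tendsto_intros gn)
    show "(\<lambda>n. norm (f (real n) - f t)) \<longlonglongrightarrow> norm (f t - L)"
      unfolding norm_minus_commute[of "f t" L] by (intro tendsto_intros L)
    show "\<forall>\<^sub>F n in sequentially. norm (f (real n) - f t) \<le> g (real n) - g t"
      using eventually_ge_at_top[of "nat \<lceil>t\<rceil>"]
      by eventually_elim (intro le t, linarith)
  qed
  have "((\<lambda>t. f t - L) \<longlongrightarrow> 0) at_top"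
  proof (rule Lim_null_comparison)
    show "((\<lambda>t. l - g t) \<longlongrightarrow> 0) at_top" using tendsto_diff[OF tendsto_const[of l] g] by simp
    show "\<forall>\<^sub>F t in at_top. norm (f t - L) \<le> l - g t"
      using eventually_ge_at_top[of "0::real"] by eventually_elim (rule bd)
  qed
  then show ?thesis using that[of L] bd by (simp add: LIM_zero_iff)
qed

definition node :: "real \<Rightarrow> complex \<Rightarrow> complex" where
  "node h \<zeta> = of_real (sqrt h) * csqrt (2 * \<zeta>)"

definition airy_phase :: "real \<Rightarrow> complex \<Rightarrow> complex" where
  "airy_phase m u = exp (u ^ 3 / 3 - of_real m * u)"

text \<open>The factor \<open>h / node h \<zeta>\<close> is du / d\<zeta> for u =
  \<open>node h \<zeta>\<close>, so this is the Airy contour integrand pulled back to the variable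
  \<zeta>.\<close>

definition airy_node :: "real \<Rightarrow> real \<Rightarrow> complex \<Rightarrow> complex" where
  "airy_node h m \<zeta> = of_real h / node h \<zeta> * airy_phase m (node h \<zeta>)"

lemma norm_airy_phase:
  "cmod (airy_phase m u) = exp ((Re u) ^ 3 / 3 - Re u * (Im u)\<^sup>2 - m * Re u)"
proof -
  have "Re (u ^ 3) = (Re u) ^ 3 - 3 * Re u * (Im u)\<^sup>2"
    by (simp add: power3_eq_cube power2_eq_square algebra_simps)
  then have "Re (u ^ 3 / 3 - of_real m * u) = (Re u) ^ 3 / 3 - Re u * (Im u)\<^sup>2 - m * Re u"
    by (simp add: field_simps)
  then show ?thesis unfolding airy_phase_def norm_exp_eq_Re by simp
qed

text \<open>The vertical line through \<zeta> is mapped to a branch of the hyperbola p^2 - q^2 = 2 h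
  Re \<zeta> in the plane of u = p + i q. The last identity eliminates q from the estimates.\<close>

lemma node_facts:
  assumes "0 < h" "0 < Re \<zeta>"
  shows "0 < Re (node h \<zeta>)" "(Re (node h \<zeta>))\<^sup>2 = h * (cmod \<zeta> + Re \<zeta>)"
    "(node h \<zeta>)\<^sup>2 = 2 * of_real h * \<zeta>" "node h \<zeta> \<noteq> 0"
    "(Im (node h \<zeta>))\<^sup>2 = (Re (node h \<zeta>))\<^sup>2 - 2 * h * Re \<zeta>"
proof -
  have R: "Re (node h \<zeta>) = sqrt h * sqrt (cmod \<zeta> + Re \<zeta>)"
    by (simp add: node_def norm_mult)
  have pos: "0 < cmod \<zeta> + Re \<zeta>" using assms(2) by (simp add: add_nonneg_pos)
  show 1: "0 < Re (node h \<zeta>)" unfolding R using assms pos by simp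
  show "(Re (node h \<zeta>))\<^sup>2 = h * (cmod \<zeta> + Re \<zeta>)" unfolding R using assms pos by (simp add: power_mult_distrib)
  have "(of_real (sqrt h) :: complex)\<^sup>2 = of_real h" using assms by (simp flip: of_real_power)
  then show 3: "(node h \<zeta>)\<^sup>2 = 2 * of_real h * \<zeta>" by (simp add: node_def power_mult_distrib)
  show "node h \<zeta> \<noteq> 0" using 1 by auto
  have "Re ((node h \<zeta>)\<^sup>2) = 2 * h * Re \<zeta>" unfolding 3 by simp
  then show "(Im (node h \<zeta>))\<^sup>2 = (Re (node h \<zeta>))\<^sup>2 - 2 * h * Re \<zeta>" by (simp add: Re_power2)
qed

text \<open>The fourth power of p = Re u is what is wanted: p^2 is at least h |\<zeta>|, so decay
  like p^(-4) is quadratic decay in \<zeta>.\<close>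

lemma quartic_exp_bound:
  fixes \<beta> :: real
  shows "\<exists>C>0. \<forall>p\<ge>0. p ^ 4 * exp (\<beta> * p - 2/3 * p ^ 3) \<le> C"
proof -
  \<comment> \<open>The added 1 comes from p^4 \<le> 24 exp p. Beyond p = 1 + 2 c one has p^2 \<ge>
    2 c and the cubic term wins; below it c p is bounded.\<close>
  define c where "c = \<bar>\<beta> + 1\<bar>"
  have "p ^ 4 * exp (\<beta> * p - 2/3 * p ^ 3) \<le> 24 * exp (c * (1 + 2 * c))" if p: "0 \<le> p" for p :: real
  proof -
    have "p ^ 4 / fact 4 \<le> (\<Sum>k. p ^ k / fact k)"
      using sum_le_suminf[OF summable_exp[of p], of "{4}"] p by (simp add: divide_inverse mult.commute)
    also have "\<dots> = exp p" by (simp add: exp_def divide_inverse mult.commute scaleR_conv_of_real)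
    finally have 1: "p ^ 4 \<le> 24 * exp p" by (simp add: fact_numeral)
    have "(\<beta> + 1) * p \<le> c * p" unfolding c_def using p by (intro mult_right_mono) auto
    moreover have "c * p - 2/3 * p ^ 3 \<le> c * (1 + 2 * c)"
    proof (cases "p \<le> 1 + 2 * c")
      case True
      then have "c * p \<le> c * (1 + 2 * c)" by (intro mult_left_mono) (auto simp: c_def)
      moreover have "0 \<le> p ^ 3" using p by simp
      ultimately show ?thesis by linarith
    next
      case False
      have c0: "0 \<le> c" by (simp add: c_def)
      have "1 * p \<le> p * p" using False c0 by (intro mult_right_mono) auto
      then have "2 * c \<le> p * p" using False by linarith
      then have "0 \<le> p * (2/3 * (p * p) - c)" using p c0 by (intro mult_nonneg_nonneg) auto
      then have "c * p - 2/3 * p ^ 3 \<le> 0" by (simp add: algebra_simps power3_eq_cube)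
      also have "0 \<le> c * (1 + 2 * c)" using c0 by simp
      finally show ?thesis .
    qed
    ultimately have 2: "p + (\<beta> * p - 2/3 * p ^ 3) \<le> c * (1 + 2 * c)" by (simp add: algebra_simps)
    have "p ^ 4 * exp (\<beta> * p - 2/3 * p ^ 3) \<le> 24 * exp p * exp (\<beta> * p - 2/3 * p ^ 3)"
      by (intro mult_right_mono 1) simp
    also have "\<dots> = 24 * exp (p + (\<beta> * p - 2/3 * p ^ 3))" by (simp add: exp_add)
    also have "\<dots> \<le> 24 * exp (c * (1 + 2 * c))" using 2 by simp
    finally show ?thesis .
  qed
  then show ?thesis by (intro exI[of _ "24 * exp (c * (1 + 2 * c))"]) auto
qed

text \<open>On the hyperbola the real exponent p^3/3 - p q^2 - m p becomes 2 h (Re \<zeta>) p - 2/3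
  p^3 - m p. The cubic term yields the decay in Im \<zeta>, and p \<ge> sqrt (2 a) yields the decay
  in m. The constant depends on b and \<open>m0\<close> alone, which is what a limit in h
  requires.\<close>

lemma airy_node_bound:
  "\<exists>C>0. \<forall>h \<zeta> m a. 0 < h \<and> 0 < a \<and> a \<le> h * Re \<zeta> \<and> h * Re \<zeta> \<le> b \<and> m0 \<le> m \<longrightarrow>
     cmod (airy_node h m \<zeta>) \<le> C * h / sqrt (2 * a) * exp (- (m - m0) * sqrt (2 * a)) / (a\<^sup>2 + (h * Im \<zeta>)\<^sup>2)"
proof -
  obtain C where C: "0 < C" "\<And>p. 0 \<le> p \<Longrightarrow> p ^ 4 * exp ((2 * b - m0) * p - 2/3 * p ^ 3) \<le> C"
    using quartic_exp_bound by blast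
  have "cmod (airy_node h m \<zeta>) \<le> C * h / sqrt (2 * a) * exp (- (m - m0) * sqrt (2 * a)) / (a\<^sup>2 + (h * Im \<zeta>)\<^sup>2)"
    if h: "0 < h" and a: "0 < a" "a \<le> h * Re \<zeta>" "h * Re \<zeta> \<le> b" and m: "m0 \<le> m" for h \<zeta> m a
  proof -
    have \<zeta>: "0 < Re \<zeta>" using h a by (metis less_le_trans zero_less_mult_pos)
    define p where "p = Re (node h \<zeta>)"
    note nf = node_facts[OF h \<zeta>, folded p_def]
    have p2: "2 * a \<le> p\<^sup>2"
    proof -
      have "h * Re \<zeta> \<le> h * cmod \<zeta>" using h complex_Re_le_cmod by (intro mult_left_mono) auto
      then show ?thesis unfolding nf(2) using a by (simp add: distrib_left)
    qed
    have p: "sqrt (2 * a) \<le> p" using p2 nf(1) by (simp add: real_le_lsqrt)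
    have p4: "a\<^sup>2 + (h * Im \<zeta>)\<^sup>2 \<le> p ^ 4"
    proof -
      have "a\<^sup>2 \<le> (h * Re \<zeta>)\<^sup>2" using a by (intro power_mono) auto
      then have "a\<^sup>2 + (h * Im \<zeta>)\<^sup>2 \<le> (h * cmod \<zeta>)\<^sup>2"
        by (simp add: power_mult_distrib cmod_power2 distrib_left)
      also have "\<dots> \<le> (p\<^sup>2)\<^sup>2" unfolding nf(2) using h \<zeta> by (intro power_mono mult_left_mono) auto
      finally show ?thesis by (simp flip: power_mult)
    qed
    have den: "0 < a\<^sup>2 + (h * Im \<zeta>)\<^sup>2" using a by (simp add: add_pos_nonneg)
    have "(Re (node h \<zeta>)) ^ 3 / 3 - Re (node h \<zeta>) * (Im (node h \<zeta>))\<^sup>2 - m * Re (node h \<zeta>)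
        = 2 * (h * Re \<zeta>) * p - 2/3 * p ^ 3 - m * p"
      unfolding nf(5) p_def[symmetric] by (simp add: power3_eq_cube power2_eq_square algebra_simps)
    also have "\<dots> \<le> ((2 * b - m0) * p - 2/3 * p ^ 3) + (- (m - m0) * sqrt (2 * a))"
    proof -
      have "h * Re \<zeta> * p \<le> b * p" using a nf(1) by (intro mult_right_mono) auto
      moreover have "(m - m0) * sqrt (2 * a) \<le> (m - m0) * p" using m p by (intro mult_left_mono) auto
      ultimately show ?thesis by (simp add: algebra_simps)
    qed
    finally have "cmod (airy_phase m (node h \<zeta>)) \<le> exp ((2 * b - m0) * p - 2/3 * p ^ 3) * exp (- (m - m0) * sqrt (2 * a))"
      unfolding norm_airy_phase exp_add[symmetric] by simp
    also have "\<dots> \<le> C / p ^ 4 * exp (- (m - m0) * sqrt (2 * a))"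
      using C(2)[of p] nf(1) by (intro mult_right_mono) (auto simp: field_simps)
    also have "\<dots> \<le> C / (a\<^sup>2 + (h * Im \<zeta>)\<^sup>2) * exp (- (m - m0) * sqrt (2 * a))"
      using p4 den C(1) by (intro mult_right_mono frac_le) auto
    finally have 1: "cmod (airy_phase m (node h \<zeta>)) \<le> C / (a\<^sup>2 + (h * Im \<zeta>)\<^sup>2) * exp (- (m - m0) * sqrt (2 * a))" .
    have "p \<le> cmod (node h \<zeta>)" unfolding p_def by (rule complex_Re_le_cmod)
    then have 2: "h / cmod (node h \<zeta>) \<le> h / sqrt (2 * a)" using p a h by (intro frac_le) auto
    have "cmod (airy_node h m \<zeta>) = h / cmod (node h \<zeta>) * cmod (airy_phase m (node h \<zeta>))"
      unfolding airy_node_def norm_mult norm_divide using h by simp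
    also have "\<dots> \<le> h / sqrt (2 * a) * (C / (a\<^sup>2 + (h * Im \<zeta>)\<^sup>2) * exp (- (m - m0) * sqrt (2 * a)))"
      using h a by (intro mult_mono 1 2) auto
    finally show ?thesis by (simp add: mult_ac)
  qed
  then show ?thesis using C(1) by (intro exI[of _ C] conjI) auto
qed

lemma node_has_derivative:
  assumes "0 < h" "0 < Re \<zeta>"
  shows "(node h has_field_derivative of_real h / node h \<zeta>) (at \<zeta>)"
proof -
  have "2 * \<zeta> \<notin> \<real>\<^sub>\<le>\<^sub>0" using assms(2) by (auto simp: complex_nonpos_Reals_iff)
  then have "(node h has_field_derivative of_real (sqrt h) * (inverse (2 * csqrt (2 * \<zeta>)) * 2)) (at \<zeta>)"
    unfolding node_def[abs_def] by (auto intro!: derivative_eq_intros simp: field_simps)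
  moreover have "csqrt (2 * \<zeta>) \<noteq> 0" "(of_real (sqrt h) :: complex) \<noteq> 0" using assms by auto
  moreover have "(of_real h :: complex) = of_real (sqrt h) * of_real (sqrt h)"
    using assms(1) by (simp flip: of_real_mult)
  ultimately show ?thesis by (simp add: node_def field_simps)
qed

lemma node_holomorphic:
  assumes "0 < h" shows "node h holomorphic_on right_half"
  using node_has_derivative[OF assms] unfolding holomorphic_on_open[OF open_halfspace_Re_gt] by blast

lemma airy_node_holomorphic:
  assumes "0 < h" shows "airy_node h m holomorphic_on right_half"
  unfolding airy_node_def[abs_def] airy_phase_def
  by (intro holomorphic_intros node_holomorphic assms) (use node_facts(4)[OF assms] in auto)

lemma airy_primitive:
  obtains \<Phi> where "\<And>u. (\<Phi> has_field_derivative airy_phase m u) (at u)"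
proof -
  have "airy_phase m holomorphic_on UNIV" unfolding airy_phase_def[abs_def] by (intro holomorphic_intros) auto
  from holomorphic_convex_primitive'[OF _ _ this] obtain g where
    "\<And>x. x \<in> UNIV \<Longrightarrow> (g has_field_derivative airy_phase m x) (at x within UNIV)" by auto
  then show ?thesis using that[of g] by simp
qed

lemma norm_diff_le_dominated:
  fixes f :: "real \<Rightarrow> complex" and \<phi> :: "real \<Rightarrow> real"
  assumes "a \<le> b"
    and f: "\<And>x. a \<le> x \<Longrightarrow> x \<le> b \<Longrightarrow> (f has_vector_derivative f' x) (at x)"
    and \<phi>: "\<And>x. a \<le> x \<Longrightarrow> x \<le> b \<Longrightarrow> (\<phi> has_real_derivative \<phi>' x) (at x)"
    and le: "\<And>x. a \<le> x \<Longrightarrow> x \<le> b \<Longrightarrow> cmod (f' x) \<le> \<phi>' x"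
  shows "cmod (f b - f a) \<le> \<phi> b - \<phi> a"
proof (cases "a = b")
  case False
  then have "a < b" using assms(1) by simp
  then show ?thesis
  proof (rule differentiable_bound_general)
    show "continuous_on {a..b} f"
      using f by (intro continuous_at_imp_continuous_on ballI has_vector_derivative_continuous) auto
    show "continuous_on {a..b} \<phi>"
      using \<phi> by (intro continuous_at_imp_continuous_on ballI DERIV_isCont) auto
    show "(f has_vector_derivative f' x) (at x)" if "a < x" "x < b" for x using f[of x] that by simp
    show "(\<phi> has_vector_derivative \<phi>' x) (at x)" if "a < x" "x < b" for x
      using \<phi>[of x] that by (simp add: has_real_derivative_iff_has_vector_derivative)
    show "cmod (f' x) \<le> \<phi>' x" if "a < x" "x < b" for x using le[of x] that by simp
  qed
qed simp

text \<open>The form for fixed h, with a constant that may depend on h. It serves the qualitative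
  facts (convergence, holomorphy, measurability), while the rates use a version uniform in
  h.\<close>

lemma airy_node_strip_bound:
  assumes h: "0 < h" and a: "0 < a"
  shows "\<exists>C>0. \<forall>\<zeta> m. a \<le> Re \<zeta> \<and> Re \<zeta> \<le> b \<and> m0 \<le> m \<longrightarrow>
     cmod (airy_node h m \<zeta>) \<le> C * exp (- (m - m0) * sqrt (2 * (h * a))) / (1 + (Im \<zeta>)\<^sup>2)"
proof -
  from airy_node_bound[of "h * b" m0] obtain C where C': "0 < C \<and> (\<forall>h' \<zeta> m a'. 0 < h' \<and> 0 < a' \<and> a' \<le> h' * Re \<zeta> \<and> h' * Re \<zeta> \<le> h * b \<and> m0 \<le> m \<longrightarrow>
      cmod (airy_node h' m \<zeta>) \<le> C * h' / sqrt (2 * a') * exp (- (m - m0) * sqrt (2 * a')) / (a'\<^sup>2 + (h' * Im \<zeta>)\<^sup>2))" ..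
  note C = conjunct1[OF C'] and bd = conjunct2[OF C', rule_format]
  define d where "d = min ((h * a)\<^sup>2) (h\<^sup>2)"
  have d: "0 < d" using h a by (simp add: d_def)
  let ?K = "C * h / sqrt (2 * (h * a))"
  have K: "0 < ?K" using C h a by simp
  have "cmod (airy_node h m \<zeta>) \<le> ?K / d * exp (- (m - m0) * sqrt (2 * (h * a))) / (1 + (Im \<zeta>)\<^sup>2)"
    if \<zeta>: "a \<le> Re \<zeta> \<and> Re \<zeta> \<le> b \<and> m0 \<le> m" for \<zeta> m
  proof -
    let ?E = "exp (- (m - m0) * sqrt (2 * (h * a)))"
    have "cmod (airy_node h m \<zeta>) \<le> ?K * ?E / ((h * a)\<^sup>2 + (h * Im \<zeta>)\<^sup>2)"
      using \<zeta> h a by (intro bd) auto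
    also have "\<dots> \<le> ?K * ?E / (d * (1 + (Im \<zeta>)\<^sup>2))"
    proof (intro divide_left_mono)
      have "d * (Im \<zeta>)\<^sup>2 \<le> h\<^sup>2 * (Im \<zeta>)\<^sup>2" by (intro mult_right_mono) (auto simp: d_def)
      moreover have "d \<le> (h * a)\<^sup>2" by (simp add: d_def)
      ultimately show "d * (1 + (Im \<zeta>)\<^sup>2) \<le> (h * a)\<^sup>2 + (h * Im \<zeta>)\<^sup>2"
        by (simp add: distrib_left power_mult_distrib)
      show "0 \<le> ?K * ?E" by (rule mult_nonneg_nonneg[OF less_imp_le[OF K] exp_ge_zero])
      have "0 < 1 + (Im \<zeta>)\<^sup>2" "0 < (h * a)\<^sup>2 + (h * Im \<zeta>)\<^sup>2" using h a by (auto intro: add_pos_nonneg)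
      then show "0 < ((h * a)\<^sup>2 + (h * Im \<zeta>)\<^sup>2) * (d * (1 + (Im \<zeta>)\<^sup>2))" using d by (intro mult_pos_pos)
    qed
    finally show ?thesis by simp
  qed
  moreover have "0 < ?K / d" by (rule divide_pos_pos[OF K d])
  ultimately show ?thesis by blast
qed

lemma airy_node_decay:
  assumes "0 < h"
  shows "halfplane_decay (airy_node h m)"
  unfolding halfplane_decay_def
proof (intro conjI allI impI airy_node_holomorphic assms)
  fix a b :: real assume a: "0 < a"
  from airy_node_strip_bound[OF assms a, of b m] obtain C where "0 < C \<and> (\<forall>\<zeta> m'. a \<le> Re \<zeta> \<and> Re \<zeta> \<le> b \<and> m \<le> m' \<longrightarrow>
     cmod (airy_node h m' \<zeta>) \<le> C * exp (- (m' - m) * sqrt (2 * (h * a))) / (1 + (Im \<zeta>)\<^sup>2))" ..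
  from conjunct2[OF this, rule_format, of _ m]
  show "\<exists>C. \<forall>\<zeta>. a \<le> Re \<zeta> \<and> Re \<zeta> \<le> b \<longrightarrow> cmod (airy_node h m \<zeta>) \<le> C / (1 + (Im \<zeta>)\<^sup>2)"
    by (intro exI[of _ C]) simp
qed

text \<open>The line Re \<zeta> = a parametrized by the imaginary part s of u: on the hyperbola Re u
  = sqrt (s^2 + 2 h a), and the imaginary part of u^2 = 2 h \<zeta> gives h Im \<zeta> = s Re
  u.\<close>

lemma node_param:
  assumes "0 < h" "0 < a"
  shows "node h (of_real a + \<i> * of_real (s * sqrt (s\<^sup>2 + 2 * (h * a)) / h))
    = of_real (sqrt (s\<^sup>2 + 2 * (h * a))) + \<i> * of_real s"
proof -
  let ?p = "sqrt (s\<^sup>2 + 2 * (h * a))" and ?\<zeta> = "of_real a + \<i> * of_real (s * sqrt (s\<^sup>2 + 2 * (h * a)) / h)"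
  define w where "w = (of_real ?p + \<i> * of_real s) / of_real (sqrt h)"
  have "0 < s\<^sup>2 + 2 * (h * a)" using assms by (simp add: add_nonneg_pos)
  then have p: "0 < ?p" "?p\<^sup>2 = s\<^sup>2 + 2 * (h * a)" by auto
  have "w\<^sup>2 = (of_real ?p + \<i> * of_real s)\<^sup>2 / of_real h"
    using assms by (simp add: w_def power_divide flip: of_real_power)
  also have "(of_real ?p + \<i> * of_real s)\<^sup>2 = of_real (?p\<^sup>2 - s\<^sup>2) + 2 * \<i> * of_real (s * ?p)"
  proof -
    have "(of_real p + \<i> * of_real s)\<^sup>2 = of_real (p\<^sup>2 - s\<^sup>2) + 2 * \<i> * of_real (s * p)" for p :: real
      by (simp add: power2_eq_square algebra_simps)
    then show ?thesis .
  qed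
  also have "\<dots> = of_real (2 * (h * a)) + 2 * \<i> * of_real (s * ?p)" unfolding p(2) by simp
  also have "\<dots> / of_real h = 2 * ?\<zeta>" using assms by (simp add: field_simps)
  finally have w2: "w\<^sup>2 = 2 * ?\<zeta>" .
  have "0 < Re w" using p assms by (simp add: w_def)
  then have "csqrt (w\<^sup>2) = w" by (simp add: csqrt_square)
  then show ?thesis using assms unfolding node_def w2[symmetric] by (simp add: w_def)
qed

text \<open>At u = i t the exponent u^3/3 - m u is - i (t^3/3 + m t), so the values at i t and - i t
  combine to a cosine. The truncated integral in \<open>airy_Ai\<close> is therefore a difference of
  values of the Airy primitive on the imaginary axis.\<close>

lemma airy_cos_primitive:
  assumes \<Phi>: "\<And>u. (\<Phi> has_field_derivative airy_phase m u) (at u)" and S: "0 \<le> S"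
  shows "of_real (integral {0..S} (\<lambda>t. cos (t ^ 3 / 3 + m * t))) = (\<Phi> (\<i> * of_real S) - \<Phi> (- \<i> * of_real S)) / (2 * \<i>)"
proof -
  have ph: "airy_phase m (\<i> * of_real t) = exp (- \<i> * of_real (t ^ 3 / 3 + m * t))" for t
    unfolding airy_phase_def by (rule arg_cong[where f=exp]) (simp add: power3_eq_cube algebra_simps)
  have "((\<lambda>t. of_real (cos (t ^ 3 / 3 + m * t)) :: complex) has_integral
      ((\<Phi> (\<i> * of_real S) - \<Phi> (- \<i> * of_real S)) / (2 * \<i>) - (\<Phi> (\<i> * of_real 0) - \<Phi> (- \<i> * of_real 0)) / (2 * \<i>))) {0..S}"
  proof (rule fundamental_theorem_of_calculus[OF S])
    fix t :: real
    have v: "((\<lambda>t. \<Phi> (c * of_real t)) has_vector_derivative c * airy_phase m (c * of_real t)) (at t within {0..S})" for c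
    proof -
      have "((\<lambda>t. c * of_real t) has_vector_derivative c) (at t within {0..S})"
        by (auto intro!: derivative_eq_intros)
      from field_vector_diff_chain_within[OF this, of \<Phi>, OF has_field_derivative_at_within[OF \<Phi>]]
      show ?thesis by (simp add: o_def)
    qed
    have "((\<lambda>t. (\<Phi> (\<i> * of_real t) - \<Phi> (- \<i> * of_real t)) / (2 * \<i>)) has_vector_derivative
        (\<i> * airy_phase m (\<i> * of_real t) - (- \<i>) * airy_phase m (- \<i> * of_real t)) / (2 * \<i>)) (at t within {0..S})"
      by (intro has_vector_derivative_divide has_vector_derivative_diff v)
    moreover have "(\<i> * airy_phase m (\<i> * of_real t) - (- \<i>) * airy_phase m (- \<i> * of_real t)) / (2 * \<i>)
        = of_real (cos (t ^ 3 / 3 + m * t))"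
    proof -
      have c: "(\<i> * exp (- \<i> * of_real x) - (- \<i>) * exp (- \<i> * of_real (- x))) / (2 * \<i>) = of_real (cos x)" for x
        by (simp add: cos_exp_eq cos_of_real[symmetric] divide_simps) (simp add: algebra_simps)
      have "(- t) ^ 3 / 3 + m * (- t) = - (t ^ 3 / 3 + m * t)" "- \<i> * of_real t = \<i> * of_real (- t)" by simp_all
      then have "airy_phase m (- \<i> * of_real t) = exp (- \<i> * of_real (- (t ^ 3 / 3 + m * t)))"
        using ph[of "- t"] by (simp only:)
      then show ?thesis unfolding ph[of t] using c[of "t ^ 3 / 3 + m * t"] by simp
    qed
    ultimately show "((\<lambda>t. (\<Phi> (\<i> * of_real t) - \<Phi> (- \<i> * of_real t)) / (2 * \<i>)) has_vector_derivative
        of_real (cos (t ^ 3 / 3 + m * t))) (at t within {0..S})" by simp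
  qed
  note 1 = this
  have 2: "((\<lambda>t. of_real (cos (t ^ 3 / 3 + m * t)) :: complex) has_integral
      of_real (integral {0..S} (\<lambda>t. cos (t ^ 3 / 3 + m * t)))) {0..S}"
    by (intro has_integral_of_real integrable_integral integrable_continuous_interval) (auto intro!: continuous_intros)
  show ?thesis using has_integral_unique[OF 2 1] by simp
qed

text \<open>The horizontal segment at height S from the imaginary axis to the hyperbola contributes
  nothing in the limit, since the integrand on it is at most exp (- \<kappa> s) with a rate that
  grows like S^2. The sign \<sigma> covers the upper and the lower end at once.\<close>

lemma airy_shift_to_axis:
  assumes \<Phi>: "\<And>u. (\<Phi> has_field_derivative airy_phase m u) (at u)" and A: "0 < A" and \<sigma>: "\<sigma>\<^sup>2 = 1"
  shows "((\<lambda>S. \<Phi> (of_real (sqrt (S\<^sup>2 + 2 * A)) + \<i> * of_real (\<sigma> * S)) - \<Phi> (\<i> * of_real (\<sigma> * S))) \<longlongrightarrow> 0) at_top"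
proof (rule Lim_null_comparison)
  \<comment> \<open>From s^2 \<le> S^2 + 2 A on the segment: s^3/3 - s S^2 - m s is at most s ((S^2
    + 2 A)/3 - S^2 - m), which is - \<kappa> s.\<close>
  define \<kappa> where "\<kappa> S = 2/3 * S\<^sup>2 - 2/3 * A + m" for S
  have lim: "filterlim \<kappa> at_top at_top" unfolding \<kappa>_def by real_asymp
  show "((\<lambda>S. 1 / \<kappa> S) \<longlongrightarrow> 0) at_top"
    using tendsto_inverse_0_at_top[OF lim] by (simp add: inverse_eq_divide)
  have "\<forall>\<^sub>F S in at_top. 0 < \<kappa> S" using lim by (simp add: filterlim_at_top_dense)
  then show "\<forall>\<^sub>F S in at_top. cmod (\<Phi> (of_real (sqrt (S\<^sup>2 + 2 * A)) + \<i> * of_real (\<sigma> * S)) - \<Phi> (\<i> * of_real (\<sigma> * S))) \<le> 1 / \<kappa> S"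
  proof eventually_elim
    case (elim S)
    let ?p = "sqrt (S\<^sup>2 + 2 * A)"
    define f where "f s = \<Phi> (of_real s + \<i> * of_real (\<sigma> * S))" for s
    have "cmod (f ?p - f 0) \<le> - exp (- \<kappa> S * ?p) / \<kappa> S - - exp (- \<kappa> S * 0) / \<kappa> S"
    proof (rule norm_diff_le_dominated)
      show "0 \<le> ?p" using A by simp
      fix s assume s: "0 \<le> s" "s \<le> ?p"
      have "((\<lambda>s. of_real s + \<i> * of_real (\<sigma> * S)) has_vector_derivative 1) (at s)"
        by (auto intro!: derivative_eq_intros)
      from field_vector_diff_chain_at[OF this, of \<Phi>, OF \<Phi>]
      show "(f has_vector_derivative airy_phase m (of_real s + \<i> * of_real (\<sigma> * S))) (at s)"
        by (simp add: o_def f_def[abs_def])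
      show "((\<lambda>s. - exp (- \<kappa> S * s) / \<kappa> S) has_real_derivative exp (- \<kappa> S * s)) (at s)"
        using elim by (auto intro!: derivative_eq_intros)
      have "s\<^sup>2 \<le> S\<^sup>2 + 2 * A" using s A by (metis add_nonneg_nonneg less_imp_le mult_nonneg_nonneg power_mono real_sqrt_pow2 zero_le_numeral zero_le_power2)
      then have "s * s\<^sup>2 \<le> s * (S\<^sup>2 + 2 * A)" using s by (intro mult_left_mono)
      then have "s ^ 3 / 3 - s * (\<sigma> * S)\<^sup>2 - m * s \<le> - \<kappa> S * s"
        unfolding \<kappa>_def power_mult_distrib \<sigma> by (simp add: power3_eq_cube power2_eq_square algebra_simps)
      then show "cmod (airy_phase m (of_real s + \<i> * of_real (\<sigma> * S))) \<le> exp (- \<kappa> S * s)"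
        unfolding norm_airy_phase by simp
    qed
    also have "\<dots> \<le> 1 / \<kappa> S" using elim by simp
    finally show ?case by (simp add: f_def)
  qed
qed

text \<open>\<open>\<Gamma>\<close> is the Airy primitive composed with \<open>node h\<close>. Along
  the vertical line its two end limits exist by absolute convergence, with arctan as the majorant;
  the vanishing segments carry them to the imaginary axis. This also proves that the improper limit
  in the definition of \<open>airy_Ai\<close> exists.\<close>

lemma airy_node_primitive_limit:
  assumes h: "0 < h" and a: "0 < a"
  obtains \<Gamma> where "\<And>\<zeta>. 0 < Re \<zeta> \<Longrightarrow> (\<Gamma> has_field_derivative airy_node h m \<zeta>) (at \<zeta>)"
    "((\<lambda>T. \<Gamma> (of_real a + \<i> * of_real T) - \<Gamma> (of_real a - \<i> * of_real T))
       \<longlongrightarrow> 2 * of_real pi * \<i> * of_real (airy_Ai m)) at_top"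
proof -
  obtain \<Phi> where \<Phi>: "\<And>u. (\<Phi> has_field_derivative airy_phase m u) (at u)" using airy_primitive by blast
  define \<Gamma> where "\<Gamma> \<zeta> = \<Phi> (node h \<zeta>)" for \<zeta>
  have \<Gamma>: "(\<Gamma> has_field_derivative airy_node h m \<zeta>) (at \<zeta>)" if "0 < Re \<zeta>" for \<zeta>
    unfolding \<Gamma>_def[abs_def] airy_node_def mult.commute[of "of_real h / _"]
    by (rule DERIV_chain2[OF \<Phi> node_has_derivative[OF h that]])
  obtain C where C: "\<And>\<xi>. a \<le> Re \<xi> \<and> Re \<xi> \<le> a \<Longrightarrow> cmod (airy_node h m \<xi>) \<le> C / (1 + (Im \<xi>)\<^sup>2)"
    using airy_node_decay[OF h, of m] a unfolding halfplane_decay_def by meson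
  have lim: "\<exists>l. ((\<lambda>T. \<Gamma> (of_real a + \<i> * of_real (\<sigma> * T))) \<longlongrightarrow> l) at_top" if \<sigma>: "\<sigma>\<^sup>2 = 1" for \<sigma>
  proof -
    define f where "f T = \<Gamma> (of_real a + \<i> * of_real (\<sigma> * T))" for T
    have "((\<lambda>T. C * arctan T) \<longlongrightarrow> C * (pi / 2)) at_top" by (intro tendsto_intros tendsto_arctan_at_top)
    moreover have "cmod (f t - f s) \<le> C * arctan t - C * arctan s" if "s \<le> t" for s t
    proof (rule norm_diff_le_dominated[OF that])
      fix x
      have "((\<lambda>T. of_real a + \<i> * of_real (\<sigma> * T)) has_vector_derivative (\<i> * of_real \<sigma>)) (at x)"
        by (auto intro!: derivative_eq_intros)
      from field_vector_diff_chain_at[OF this, of \<Gamma>, OF \<Gamma>] a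
      show "(f has_vector_derivative (\<i> * of_real \<sigma> * airy_node h m (of_real a + \<i> * of_real (\<sigma> * x)))) (at x)"
        by (simp add: o_def f_def[abs_def])
      show "((\<lambda>x. C * arctan x) has_real_derivative C * inverse (1 + x\<^sup>2)) (at x)"
        by (auto intro!: derivative_eq_intros)
      have "\<bar>\<sigma>\<bar> = 1" using \<sigma> by (simp add: abs_square_eq_1)
      then show "cmod (\<i> * of_real \<sigma> * airy_node h m (of_real a + \<i> * of_real (\<sigma> * x))) \<le> C * inverse (1 + x\<^sup>2)"
        using C[of "of_real a + \<i> * of_real (\<sigma> * x)"] \<sigma> by (simp add: norm_mult power_mult_distrib divide_inverse)
    qed
    ultimately obtain L where "(f \<longlongrightarrow> L) at_top"
      using tendsto_at_top_dominated[of f "\<lambda>T. C * arctan T" "C * (pi / 2)"] by blast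
    then show ?thesis unfolding f_def by (rule exI)
  qed
  have axis: "((\<lambda>S. \<Phi> (\<i> * of_real (\<sigma> * S))) \<longlongrightarrow> l) at_top"
    if \<sigma>: "\<sigma>\<^sup>2 = 1" and l: "((\<lambda>T. \<Gamma> (of_real a + \<i> * of_real (\<sigma> * T))) \<longlongrightarrow> l) at_top" for \<sigma> l
  proof -
    let ?A = "h * a"
    have A: "0 < ?A" using h a by simp
    have T: "filterlim (\<lambda>S. S * sqrt (S\<^sup>2 + 2 * ?A) / h) at_top at_top"
    proof (rule filterlim_at_top_mono)
      show "filterlim (\<lambda>S. sqrt (2 * ?A) / h * S) at_top at_top"
        using h A by (intro filterlim_tendsto_pos_mult_at_top[OF tendsto_const] filterlim_ident) simp
      show "\<forall>\<^sub>F S in at_top. sqrt (2 * ?A) / h * S \<le> S * sqrt (S\<^sup>2 + 2 * ?A) / h"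
        using eventually_ge_at_top[of "0::real"]
      proof eventually_elim
        case (elim S)
        then have "S * sqrt (2 * ?A) \<le> S * sqrt (S\<^sup>2 + 2 * ?A)" by (intro mult_left_mono real_sqrt_le_mono) auto
        then show ?case using h by (simp add: divide_right_mono mult.commute)
      qed
    qed
    have "\<Gamma> (of_real a + \<i> * of_real (\<sigma> * (S * sqrt (S\<^sup>2 + 2 * ?A) / h))) = \<Phi> (of_real (sqrt (S\<^sup>2 + 2 * ?A)) + \<i> * of_real (\<sigma> * S))" for S
      using node_param[OF h a, of "\<sigma> * S"] unfolding \<Gamma>_def power_mult_distrib \<sigma> by (simp add: mult.assoc)
    with filterlim_compose[OF l T]
    have "((\<lambda>S. \<Phi> (of_real (sqrt (S\<^sup>2 + 2 * ?A)) + \<i> * of_real (\<sigma> * S))) \<longlongrightarrow> l) at_top" by simp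
    from tendsto_diff[OF this airy_shift_to_axis[OF \<Phi> A \<sigma>]] show ?thesis by simp
  qed
  obtain l1 where l1: "((\<lambda>T. \<Gamma> (of_real a + \<i> * of_real (1 * T))) \<longlongrightarrow> l1) at_top" using lim[of 1] by auto
  obtain l2 where l2: "((\<lambda>T. \<Gamma> (of_real a + \<i> * of_real ((- 1) * T))) \<longlongrightarrow> l2) at_top" using lim[of "- 1"] by auto
  define I where "I S = integral {0..S} (\<lambda>t. cos (t ^ 3 / 3 + m * t))" for S
  have "((\<lambda>S. (\<Phi> (\<i> * of_real (1 * S)) - \<Phi> (\<i> * of_real ((- 1) * S))) / (2 * \<i>)) \<longlongrightarrow> (l1 - l2) / (2 * \<i>)) at_top"
    by (rule tendsto_divide[OF tendsto_diff[OF axis[OF _ l1] axis[OF _ l2]] tendsto_const]) auto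
  moreover have "\<forall>\<^sub>F S in at_top. (\<Phi> (\<i> * of_real (1 * S)) - \<Phi> (\<i> * of_real ((- 1) * S))) / (2 * \<i>) = of_real (I S)"
    using eventually_ge_at_top[of "0::real"]
    by eventually_elim (simp add: I_def airy_cos_primitive[OF \<Phi>])
  ultimately have I: "((\<lambda>S. of_real (I S)) \<longlongrightarrow> (l1 - l2) / (2 * \<i>)) at_top"
    by (rule Lim_transform_eventually)
  from tendsto_Re[OF this] have R: "(I \<longlongrightarrow> Re ((l1 - l2) / (2 * \<i>))) at_top" by simp
  have "airy_Ai m = Re ((l1 - l2) / (2 * \<i>)) / pi"
    unfolding airy_Ai_def I_def[abs_def, symmetric] using tendsto_Lim[OF _ R] by simp
  then have "of_real (pi * airy_Ai m) = complex_of_real (Re ((l1 - l2) / (2 * \<i>)))" by simp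
  \<comment> \<open>\<open>Lim\<close> was evaluated through real parts only. Being a limit of real
    numbers, the complex limit equals its real part.\<close>
  also have "\<dots> = (l1 - l2) / (2 * \<i>)"
    by (rule tendsto_unique[OF _ tendsto_of_real[OF R] I]) simp
  finally have "l1 - l2 = 2 * of_real pi * \<i> * of_real (airy_Ai m)" by (simp add: field_simps)
  then have L: "((\<lambda>T. \<Gamma> (of_real a + \<i> * of_real T) - \<Gamma> (of_real a - \<i> * of_real T))
       \<longlongrightarrow> 2 * of_real pi * \<i> * of_real (airy_Ai m)) at_top"
    using tendsto_diff[OF l1 l2] by simp
  show ?thesis
  proof (rule that)
    fix \<zeta> :: complex assume "0 < Re \<zeta>"
    then show "(\<Gamma> has_field_derivative airy_node h m \<zeta>) (at \<zeta>)" by (rule \<Gamma>)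
  qed (rule L)
qed

lemma airy_node_mean:
  assumes "0 < h" "0 < r" "r < 1"
  shows "contour_integral (circlepath 0 r) (\<lambda>z. disc_sum (airy_node h m) z / z) / (2 * of_real pi * \<i>) = of_real (airy_Ai m)"
proof -
  have a: "0 < - ln r" using assms by simp
  define a where "a = - ln r"
  have "contour_integral (circlepath 0 (exp (- a))) (\<lambda>z. disc_sum (airy_node h m) z / z)
      = 2 * of_real pi * \<i> * of_real (airy_Ai m)"
  proof (rule airy_node_primitive_limit[OF assms(1) a[folded a_def], of m])
    fix \<Gamma> assume \<Gamma>: "\<And>\<zeta>. 0 < Re \<zeta> \<Longrightarrow> (\<Gamma> has_field_derivative airy_node h m \<zeta>) (at \<zeta>)"
      and lim: "((\<lambda>T. \<Gamma> (of_real a + \<i> * of_real T) - \<Gamma> (of_real a - \<i> * of_real T))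
        \<longlongrightarrow> 2 * of_real pi * \<i> * of_real (airy_Ai m)) at_top"
    show "contour_integral (circlepath 0 (exp (- a))) (\<lambda>z. disc_sum (airy_node h m) z / z)
      = 2 * of_real pi * \<i> * of_real (airy_Ai m)"
    proof (rule disc_sum_mean)
      show "halfplane_decay (airy_node h m)" by (rule airy_node_decay[OF assms(1)])
      show "(\<Gamma> has_field_derivative airy_node h m \<zeta>) (at \<zeta>)" if "0 < Re \<zeta>" for \<zeta> by (rule \<Gamma>[OF that])
      show "0 < a" using a by (simp add: a_def)
    qed (rule lim)
  qed
  then show ?thesis using assms by (simp add: a_def)
qed

section \<open>Polylogarithms and the function Q\<close>

text \<open>This is Li_s(z) / z with the singularity at 0 removed. It gives Li_s(z) = O(z), and the
  integrand of \<open>B_fun\<close> becomes y times a square of holomorphic functions.\<close>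

definition polylog_quotient :: "real \<Rightarrow> complex \<Rightarrow> complex" where
  "polylog_quotient s z = (\<Sum>k. of_real (1 / real (Suc k) powr s) * z ^ k)"

lemma polylog_quotient_term:
  assumes "0 \<le> s"
  shows "norm (complex_of_real (1 / real (Suc k) powr s) * z ^ k) \<le> cmod z ^ k"
proof -
  have "1 \<le> real (Suc k) powr s" using assms by (intro ge_one_powr_ge_zero) auto
  then have "1 / real (Suc k) powr s \<le> 1" by (simp add: divide_le_eq_1)
  then have "\<bar>1 / real (Suc k) powr s\<bar> * cmod z ^ k \<le> 1 * cmod z ^ k" by (intro mult_right_mono) auto
  then show ?thesis unfolding norm_mult norm_power norm_of_real by simp
qed

lemma polylog_quotient_summable:
  assumes "0 \<le> s" "cmod z < 1"
  shows "summable (\<lambda>k. complex_of_real (1 / real (Suc k) powr s) * z ^ k)"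
proof (rule summable_comparison_test')
  show "summable (\<lambda>k. cmod z ^ k)" using assms(2) by (intro summable_geometric) simp
qed (rule polylog_quotient_term[OF assms(1)])

lemma polylog_quotient_bound:
  assumes "0 \<le> s" "cmod z < 1"
  shows "cmod (polylog_quotient s z) \<le> 1 / (1 - cmod z)"
proof -
  have "cmod (polylog_quotient s z) \<le> (\<Sum>k. cmod z ^ k)"
    unfolding polylog_quotient_def
    by (intro norm_suminf_le polylog_quotient_term summable_geometric) (use assms in auto)
  also have "\<dots> = 1 / (1 - cmod z)" using assms by (intro suminf_geometric) auto
  finally show ?thesis .
qed

lemma polylog_quotient_holomorphic:
  assumes "0 \<le> s"
  shows "polylog_quotient s holomorphic_on ball 0 1"
proof (rule power_series_holomorphic)
  fix w :: complex assume "w \<in> ball 0 1"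
  then show "(\<lambda>k. complex_of_real (1 / real (Suc k) powr s) * (w - 0) ^ k) sums polylog_quotient s w"
    unfolding polylog_quotient_def using polylog_quotient_summable[OF assms, of w] by (simp add: summable_sums)
qed

lemma Li_eq:
  assumes "0 \<le> s" "cmod z < 1"
  shows "Li s z = z * polylog_quotient s z"
proof -
  have "z ^ Suc k / of_real (real (Suc k) powr s) = z * (of_real (1 / real (Suc k) powr s) * z ^ k)" for k
    by simp
  then have "Li s z = (\<Sum>k. z * (of_real (1 / real (Suc k) powr s) * z ^ k))"
    using assms by (simp only: Li_def polylog_series_def if_True)
  also have "\<dots> = z * polylog_quotient s z"
    unfolding polylog_quotient_def by (rule suminf_mult[OF polylog_quotient_summable[OF assms]])
  finally show ?thesis .
qed

lemma Li_holomorphic: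
  assumes "0 \<le> s" shows "Li s holomorphic_on ball 0 1"
proof -
  have "(\<lambda>z. z * polylog_quotient s z) holomorphic_on ball 0 1"
    by (intro holomorphic_on_mult holomorphic_on_ident polylog_quotient_holomorphic assms)
  then show ?thesis
    by (rule holomorphic_transform) (simp add: Li_eq[OF assms])
qed

lemma norm_Li_le:
  assumes "0 \<le> s" "cmod z < 1"
  shows "cmod (Li s z) \<le> cmod z / (1 - cmod z)"
  using mult_left_mono[OF polylog_quotient_bound[OF assms], of "cmod z"]
  by (simp add: Li_eq[OF assms] norm_mult)

lemma inverse_sqrt_2pi_le: "1 / sqrt (2 * pi) \<le> 1"
proof -
  have "1 \<le> sqrt (2 * pi)" using pi_gt3 by (subst real_le_rsqrt) auto
  then show ?thesis by (simp add: divide_le_eq_1)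
qed

lemma norm_A1_A2_le:
  assumes "cmod z \<le> 1/2"
  shows "cmod (A1 z) \<le> 2 * cmod z" "cmod (A2 z) \<le> 2 * cmod z"
proof -
  have *: "cmod (- (1 / of_real (sqrt (2 * pi))) * Li s z) \<le> 2 * cmod z" if "0 \<le> s" for s
  proof -
    have "cmod (- (1 / of_real (sqrt (2 * pi))) * Li s z) = 1 / sqrt (2 * pi) * cmod (Li s z)"
      by (simp add: norm_mult norm_divide)
    also have "\<dots> \<le> 1 * (cmod z / (1 - cmod z))"
      using assms that by (intro mult_mono inverse_sqrt_2pi_le norm_Li_le) auto
    also have "\<dots> \<le> 1 * (cmod z / (1/2))"
      using assms by (intro mult_left_mono divide_left_mono) auto
    finally show ?thesis by simp
  qed
  show "cmod (A1 z) \<le> 2 * cmod z" "cmod (A2 z) \<le> 2 * cmod z"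
    unfolding A1_def A2_def by (rule *; simp)+
qed

lemma convex_primitive:
  assumes "convex S" "open S" "f holomorphic_on S"
  shows "\<exists>F. \<forall>x\<in>S. (F has_field_derivative f x) (at x)"
proof (rule holomorphic_convex_primitive'[OF assms])
  fix F assume "\<And>x. x \<in> S \<Longrightarrow> (F has_field_derivative f x) (at x within S)"
  then show ?thesis using at_within_open[OF _ assms(2)] by (intro exI[of _ F]) simp
qed

lemma B_fun_holomorphic: "B_fun holomorphic_on ball 0 1"
proof -
  let ?g = "\<lambda>y. (Li (1/2) y)\<^sup>2 / y" and ?B = "ball (0::complex) 1"
  have "(\<lambda>y. y * (polylog_quotient (1/2) y)\<^sup>2) holomorphic_on ?B"
    by (intro holomorphic_intros polylog_quotient_holomorphic) simp
  \<comment> \<open>At y = 0 division by zero gives the value 0, which is also the value of the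
    holomorphic expression above.\<close>
  then have g: "?g holomorphic_on ?B"
    by (rule holomorphic_transform) (simp add: Li_eq power2_eq_square)
  obtain F where F: "\<forall>x\<in>?B. (F has_field_derivative ?g x) (at x)"
    using convex_primitive[OF convex_ball open_ball g] ..
  note Fw = has_field_derivative_at_within[OF F[rule_format]]
  have "contour_integral (linepath 0 z) ?g = F z - F 0" if "z \<in> ?B" for z
  proof (rule contour_integral_unique)
    have "path_image (linepath 0 z) \<subseteq> ?B"
      using that by (simp add: closed_segment_subset)
    from contour_integral_primitive[OF Fw valid_path_linepath this]
    show "(?g has_contour_integral (F z - F 0)) (linepath 0 z)" by simp
  qed
  moreover have "F holomorphic_on ?B"
    unfolding holomorphic_on_open[OF open_ball] using F by blast
  then have "(\<lambda>z. 1 / (4 * of_real pi) * (F z - F 0)) holomorphic_on ?B" by (intro holomorphic_intros) auto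
  ultimately show ?thesis
    using holomorphic_transform[of "\<lambda>z. 1 / (4 * of_real pi) * (F z - F 0)" ?B B_fun] by (simp add: B_fun_def)
qed

lemma B_fun_0: "B_fun 0 = 0"
  by (simp add: B_fun_def)

definition prefactor :: "real \<Rightarrow> real \<Rightarrow> complex \<Rightarrow> complex" where
  "prefactor x \<tau> z = exp (of_real x * A1 z + of_real \<tau> * A2 z + A3 z + B_fun z)"

lemma A3_holomorphic: "A3 holomorphic_on ball 0 1"
proof -
  have "1 - z \<notin> \<real>\<^sub>\<le>\<^sub>0" if "z \<in> ball 0 1" for z :: complex
    using that complex_Re_le_cmod[of z] by (auto simp: complex_nonpos_Reals_iff)
  then show ?thesis unfolding A3_def[abs_def] by (intro holomorphic_intros) auto
qed

lemma prefactor_holomorphic: "prefactor x \<tau> holomorphic_on ball 0 1"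
  unfolding prefactor_def[abs_def] A1_def A2_def
  by (intro holomorphic_on_exp' holomorphic_on_add holomorphic_on_mult
      holomorphic_on_const Li_holomorphic A3_holomorphic B_fun_holomorphic) simp_all

lemma prefactor_0: "prefactor x \<tau> 0 = 1"
  by (simp add: prefactor_def A1_def A2_def A3_def B_fun_0 Li_eq)

text \<open>Only \<open>A1\<close> carries the factor x, and it is O(z); this puts |z| into the
  growth rate. The term with \<open>A2\<close> is bounded since \<open>\<tau>\<close> is at most 1,
  and \<open>A3 + B_fun\<close> is bounded by compactness.\<close>

lemma prefactor_bound:
  "\<exists>C>0. \<forall>x \<tau> z. 0 \<le> \<tau> \<and> \<tau> \<le> 1 \<and> cmod z \<le> 1/2 \<longrightarrow> cmod (prefactor x \<tau> z) \<le> C * exp (2 * \<bar>x\<bar> * cmod z)"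
proof -
  have "(\<lambda>z. A3 z + B_fun z) holomorphic_on cball 0 (1/2)"
    by (rule holomorphic_on_subset[OF holomorphic_on_add[OF A3_holomorphic B_fun_holomorphic]]) auto
  then have "compact ((\<lambda>z. A3 z + B_fun z) ` cball 0 (1/2))"
    by (intro compact_continuous_image holomorphic_on_imp_continuous_on compact_cball)
  then have "bounded ((\<lambda>z. A3 z + B_fun z) ` cball 0 (1/2))" by (rule compact_imp_bounded)
  then obtain M where M': "\<forall>y\<in>(\<lambda>z. A3 z + B_fun z) ` cball 0 (1/2). cmod y \<le> M"
    unfolding bounded_iff ..
  have M: "cmod (A3 z + B_fun z) \<le> M" if "cmod z \<le> 1/2" for z
    using that by (intro M'[rule_format] imageI) simp
  have "cmod (prefactor x \<tau> z) \<le> exp (1 + M) * exp (2 * \<bar>x\<bar> * cmod z)"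
    if "0 \<le> \<tau>" "\<tau> \<le> 1" "cmod z \<le> 1/2" for x \<tau> z
  proof -
    have "cmod (of_real x * A1 z + of_real \<tau> * A2 z + A3 z + B_fun z)
      \<le> cmod (of_real x * A1 z) + cmod (of_real \<tau> * A2 z) + cmod (A3 z + B_fun z)"
      using norm_triangle_ineq[of "of_real x * A1 z" "of_real \<tau> * A2 z"]
        norm_triangle_ineq[of "of_real x * A1 z + of_real \<tau> * A2 z" "A3 z + B_fun z"]
      by (simp add: add.assoc)
    also have "\<dots> \<le> \<bar>x\<bar> * (2 * cmod z) + 1 * 1 + M"
    proof (intro add_mono M that)
      show "cmod (of_real x * A1 z) \<le> \<bar>x\<bar> * (2 * cmod z)"
        unfolding norm_mult norm_of_real using norm_A1_A2_le(1)[OF that(3)] by (intro mult_left_mono) auto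
      show "cmod (of_real \<tau> * A2 z) \<le> 1 * 1"
        unfolding norm_mult norm_of_real using norm_A1_A2_le(2)[OF that(3)] that by (intro mult_mono) auto
    qed
    finally have "Re (of_real x * A1 z + of_real \<tau> * A2 z + A3 z + B_fun z) \<le> (1 + M) + 2 * \<bar>x\<bar> * cmod z"
      using complex_Re_le_cmod[of "of_real x * A1 z + of_real \<tau> * A2 z + A3 z + B_fun z"] by simp
    then show ?thesis
      unfolding prefactor_def norm_exp_eq_Re exp_add[symmetric] by (rule iffD2[OF exp_le_cancel_iff])
  qed
  then show ?thesis by (intro exI[of _ "exp (1 + M)"]) auto
qed

section \<open>The sector and the function Q on it\<close>

definition sector :: "complex set" where
  "sector = {s. Re s + Im s < 0} \<inter> {s. Re s - Im s < 0}"

text \<open>The product of the two linear forms that cut out the sector is Re (s^2). So on the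
  sector exp (- s^2 / 2) has modulus less than 1, where the polylogarithm is given by its
  series.\<close>

lemma sector_iff: "s \<in> sector \<longleftrightarrow> Re s < 0 \<and> 0 < Re (s\<^sup>2)"
proof -
  have "0 < Re (s\<^sup>2) \<longleftrightarrow> 0 < (Re s + Im s) * (Re s - Im s)"
    by (simp add: Re_power2 power2_eq_square algebra_simps)
  then show ?thesis by (auto simp: sector_def zero_less_mult_iff)
qed

lemma open_sector: "open sector"
  unfolding sector_def by (intro open_Int open_Collect_less continuous_intros)

lemma convex_sector: "convex sector"
proof -
  have "{s. Re s + Im s < 0} = {s. (1 + \<i>) \<bullet> s < 0}" "{s. Re s - Im s < 0} = {s. (1 - \<i>) \<bullet> s < 0}"
    by (auto simp: inner_complex_def)
  then show ?thesis unfolding sector_def by (simp add: convex_Int convex_halfspace_lt)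
qed

lemma node_1: "node 1 \<zeta> = csqrt (2 * \<zeta>)"
  by (simp add: node_def)

lemma minus_node_in_sector:
  assumes "0 < Re \<zeta>" shows "- node 1 \<zeta> \<in> sector"
  using node_facts[of 1 \<zeta>] assms by (simp add: sector_iff)

definition q_fun :: "complex \<Rightarrow> complex" where
  "q_fun \<zeta> = Q_fun (- node 1 \<zeta>)"

lemma exp_right_half:
  assumes "a \<le> Re \<zeta>" "0 < a"
  shows "cmod (Li (1/2) (exp (- \<zeta>))) \<le> exp (- Re \<zeta>) / (1 - exp (- a))" "cmod (exp (- \<zeta>)) < 1"
proof -
  show 1: "cmod (exp (- \<zeta>)) < 1" using assms by (simp add: norm_exp_eq_Re)
  have "exp (- Re \<zeta>) \<le> exp (- a)" "exp (- a) < 1" using assms by auto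
  then have "exp (- Re \<zeta>) / (1 - exp (- Re \<zeta>)) \<le> exp (- Re \<zeta>) / (1 - exp (- a))"
    by (intro divide_left_mono mult_pos_pos) auto
  then show "cmod (Li (1/2) (exp (- \<zeta>))) \<le> exp (- Re \<zeta>) / (1 - exp (- a))"
    using norm_Li_le[OF _ 1, of "1/2"] by (simp add: norm_exp_eq_Re)
qed

text \<open>In the coordinate zeta = xi^2 / 2 the path of integration can be taken horizontal, along which
  the integrand decays exponentially.\<close>
lemma q_fun_primitive:
  obtains c :: complex and H where "\<And>\<zeta>. 0 < Re \<zeta> \<Longrightarrow> q_fun \<zeta> = of_real (sqrt (2 / pi)) * (H \<zeta> - c)"
    "H holomorphic_on right_half"
    "\<And>\<zeta> a. 0 < a \<Longrightarrow> a \<le> Re \<zeta> \<Longrightarrow> cmod (H \<zeta> - c) \<le> 1 / ((1 - exp (- a)) * sqrt (2 * a)) * exp (- Re \<zeta>)"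
proof -
  define f where "f s = Li (1/2) (exp (- (s\<^sup>2) / 2))" for s :: complex
  have f: "f holomorphic_on sector"
  proof -
    have "(Li (1/2) \<circ> (\<lambda>s. exp (- (s\<^sup>2) / 2))) holomorphic_on sector"
      by (rule holomorphic_on_compose_gen[OF _ Li_holomorphic])
        (auto intro!: holomorphic_intros simp: sector_iff norm_exp_eq_Re)
    then show ?thesis by (simp add: o_def f_def[abs_def])
  qed
  obtain F where F: "\<forall>s\<in>sector. (F has_field_derivative f s) (at s)"
    using convex_primitive[OF convex_sector open_sector f] ..
  have F_int: "contour_integral (linepath a b) f = F b - F a" if "a \<in> sector" "b \<in> sector" for a b
  proof (rule contour_integral_unique)
    have "path_image (linepath a b) \<subseteq> sector"
      using that convex_sector by (simp add: closed_segment_subset)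
    from contour_integral_primitive[OF has_field_derivative_at_within[OF F[rule_format]] valid_path_linepath this]
    show "(f has_contour_integral (F b - F a)) (linepath a b)" by simp
  qed
  define H where "H \<zeta> = F (- node 1 \<zeta>)" for \<zeta>
  define H' where "H' \<zeta> = - (Li (1/2) (exp (- \<zeta>)) / node 1 \<zeta>)" for \<zeta>
  have H: "(H has_field_derivative H' \<zeta>) (at \<zeta>)" if "0 < Re \<zeta>" for \<zeta>
  proof -
    have "((\<lambda>\<zeta>. - node 1 \<zeta>) has_field_derivative - (of_real 1 / node 1 \<zeta>)) (at \<zeta>)"
      by (intro DERIV_minus node_has_derivative that) simp
    from DERIV_chain2[OF F[rule_format, OF minus_node_in_sector[OF that]] this]
    have 1: "((\<lambda>\<zeta>. F (- node 1 \<zeta>)) has_field_derivative f (- node 1 \<zeta>) * - (of_real 1 / node 1 \<zeta>)) (at \<zeta>)" .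
    have "f (- node 1 \<zeta>) = Li (1/2) (exp (- \<zeta>))"
      using node_facts(3)[of 1 \<zeta>] that by (simp add: f_def)
    then have "f (- node 1 \<zeta>) * - (of_real 1 / node 1 \<zeta>) = H' \<zeta>" by (simp add: H'_def)
    with 1 show ?thesis unfolding H_def[abs_def] by (simp only:)
  qed
  have H': "cmod (H' \<zeta>) \<le> 1 / ((1 - exp (- a)) * sqrt (2 * a)) * exp (- Re \<zeta>)" if a: "0 < a" "a \<le> Re \<zeta>" for a \<zeta>
  proof -
    have "(sqrt (2 * a))\<^sup>2 \<le> (Re (node 1 \<zeta>))\<^sup>2"
      using node_facts(2)[of 1 \<zeta>] a complex_Re_le_cmod[of \<zeta>] by simp
    then have "sqrt (2 * a) \<le> Re (node 1 \<zeta>)"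
      by (rule power2_le_imp_le) (rule less_imp_le[OF node_facts(1)], use a in simp_all)
    also have "\<dots> \<le> cmod (node 1 \<zeta>)" by (rule complex_Re_le_cmod)
    finally have "cmod (H' \<zeta>) \<le> (exp (- Re \<zeta>) / (1 - exp (- a))) / sqrt (2 * a)"
      unfolding H'_def norm_minus_cancel norm_divide using a by (intro frac_le exp_right_half) auto
    then show ?thesis by (simp add: field_simps)
  qed
  have lim: "\<exists>c. ((\<lambda>t. H (\<zeta> + of_real t)) \<longlongrightarrow> c) at_top \<and> cmod (H \<zeta> - c) \<le> 1 / ((1 - exp (- a)) * sqrt (2 * a)) * exp (- Re \<zeta>)"
    if a: "0 < a" "a \<le> Re \<zeta>" for a \<zeta>
  proof -
    let ?K = "1 / ((1 - exp (- a)) * sqrt (2 * a))"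
    define g where "g t = - ?K * exp (- (Re \<zeta> + t))" for t
    have "((\<lambda>t. exp (- (Re \<zeta> + t))) \<longlongrightarrow> 0) at_top" by real_asymp
    from tendsto_mult_right_zero[OF this, of "- ?K"] have g0: "(g \<longlongrightarrow> 0) at_top" by (simp add: g_def[abs_def])
    have bd: "cmod (H (\<zeta> + of_real t) - H (\<zeta> + of_real s)) \<le> g t - g s" if "0 \<le> s" "s \<le> t" for s t
    proof (rule norm_diff_le_dominated[OF that(2)])
      fix x assume x: "s \<le> x" "x \<le> t"
      have "((\<lambda>x. \<zeta> + of_real x) has_vector_derivative 1) (at x)" by (auto intro!: derivative_eq_intros)
      from field_vector_diff_chain_at[OF this, of H, OF H] x that a
      show "((\<lambda>x. H (\<zeta> + of_real x)) has_vector_derivative H' (\<zeta> + of_real x)) (at x)" by (simp add: o_def)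
      show "(g has_real_derivative ?K * exp (- (Re \<zeta> + x))) (at x)"
        unfolding g_def by (rule derivative_eq_intros refl | simp)+
      show "cmod (H' (\<zeta> + of_real x)) \<le> ?K * exp (- (Re \<zeta> + x))"
        using H'[of a "\<zeta> + of_real x"] x that a by simp
    qed
    show ?thesis
    proof (rule tendsto_at_top_dominated[of "\<lambda>t. H (\<zeta> + of_real t)" g 0, OF bd g0])
      fix c assume "((\<lambda>t. H (\<zeta> + of_real t)) \<longlongrightarrow> c) at_top"
        and "\<And>t. 0 \<le> t \<Longrightarrow> cmod (H (\<zeta> + of_real t) - c) \<le> 0 - g t"
      from this(1) this(2)[of 0] show ?thesis by (intro exI[of _ c]) (simp add: g_def)
    qed
  qed
  obtain c where c: "((\<lambda>t. H (1 + of_real t)) \<longlongrightarrow> c) at_top" using lim[of 1 1] by auto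
  have same: "((\<lambda>t. H (\<zeta> + of_real t)) \<longlongrightarrow> c) at_top" if "0 < Re \<zeta>" for \<zeta>
  proof -
    define b where "b = min 1 (Re \<zeta>)"
    have b: "0 < b" using that by (simp add: b_def)
    let ?K = "1 / ((1 - exp (- b)) * sqrt (2 * b))"
    have K: "0 \<le> ?K" using b by simp
    have "((\<lambda>t. H (\<zeta> + of_real t) - H (1 + of_real t)) \<longlongrightarrow> 0) at_top"
    proof (rule Lim_null_comparison)
      have "((\<lambda>t. exp (- (b + t))) \<longlongrightarrow> 0) at_top" by real_asymp
      from tendsto_mult_right_zero[OF this, of "cmod (\<zeta> - 1) * ?K"]
      show "((\<lambda>t. cmod (\<zeta> - 1) * ?K * exp (- (b + t))) \<longlongrightarrow> 0) at_top" .
      show "\<forall>\<^sub>F t in at_top. cmod (H (\<zeta> + of_real t) - H (1 + of_real t)) \<le> cmod (\<zeta> - 1) * ?K * exp (- (b + t))"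
        using eventually_ge_at_top[of "0::real"]
      proof eventually_elim
        case (elim t)
        have "cmod (H (\<zeta> + of_real t) - H (1 + of_real t)) \<le> (?K * exp (- (b + t))) * cmod ((\<zeta> + of_real t) - (1 + of_real t))"
        proof (rule field_differentiable_bound[of "{\<zeta>. b + t \<le> Re \<zeta>}"])
          show "convex {\<zeta>. b + t \<le> Re \<zeta>}" using convex_halfspace_Re_ge[of "b + t"] by simp
          fix v assume v: "v \<in> {\<zeta>. b + t \<le> Re \<zeta>}"
          show "(H has_field_derivative H' v) (at v within {\<zeta>. b + t \<le> Re \<zeta>})"
            by (rule has_field_derivative_at_within[OF H]) (use v b elim in simp)
          have "cmod (H' v) \<le> ?K * exp (- Re v)" by (rule H'[OF b]) (use v elim in simp)
          also have "\<dots> \<le> ?K * exp (- (b + t))" using v by (intro mult_left_mono K) simp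
          finally show "cmod (H' v) \<le> ?K * exp (- (b + t))" .
        qed (auto simp: b_def)
        then show ?case by (simp add: mult_ac)
      qed
    qed
    from tendsto_add[OF this c] show ?thesis by simp
  qed
  have Hc: "cmod (H \<zeta> - c) \<le> 1 / ((1 - exp (- a)) * sqrt (2 * a)) * exp (- Re \<zeta>)" if a: "0 < a" "a \<le> Re \<zeta>" for a \<zeta>
  proof -
    from lim[OF a] obtain c' where c'': "((\<lambda>t. H (\<zeta> + of_real t)) \<longlongrightarrow> c') at_top \<and>
      cmod (H \<zeta> - c') \<le> 1 / ((1 - exp (- a)) * sqrt (2 * a)) * exp (- Re \<zeta>)" ..
    note c' = conjunct1[OF c''] conjunct2[OF c'']
    have "c' = c" by (rule tendsto_unique[OF _ c'(1) same]) (use a in auto)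
    then show ?thesis using c'(2) by simp
  qed
  have FT: "((\<lambda>T. F (- of_real T)) \<longlongrightarrow> c) at_top"
  proof -
    have T: "filterlim (\<lambda>T::real. T\<^sup>2 / 2 - 1) at_top at_top" by real_asymp
    have "\<forall>\<^sub>F T in at_top. H (1 + of_real (T\<^sup>2 / 2 - 1)) = F (- of_real T)"
      using eventually_gt_at_top[of "0::real"]
    proof eventually_elim
      case (elim T)
      have "csqrt ((of_real T)\<^sup>2) = of_real T" using elim by (intro csqrt_square) auto
      then show ?case by (simp add: H_def node_1 distrib_left flip: of_real_power)
    qed
    with filterlim_compose[OF c T] show ?thesis by (rule Lim_transform_eventually)
  qed
  have Q: "Q_fun \<xi> = of_real (sqrt (2 / pi)) * (F \<xi> - c)" if \<xi>: "\<xi> \<in> sector" for \<xi>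
  proof -
    have "((\<lambda>T. contour_integral (linepath (- of_real T) \<xi>) f) \<longlongrightarrow> F \<xi> - c) at_top"
    proof (rule Lim_transform_eventually)
      show "((\<lambda>T. F \<xi> - F (- of_real T)) \<longlongrightarrow> F \<xi> - c) at_top" by (intro tendsto_diff tendsto_const FT)
      show "\<forall>\<^sub>F T in at_top. F \<xi> - F (- of_real T) = contour_integral (linepath (- of_real T) \<xi>) f"
        using eventually_gt_at_top[of "0::real"]
        by eventually_elim (rule F_int[OF _ \<xi>, symmetric], simp add: sector_def)
    qed
    from tendsto_Lim[OF trivial_limit_at_top_linorder this] show ?thesis
      unfolding Q_fun_def f_def[abs_def] by (rule arg_cong)
  qed
  show ?thesis
  proof (rule that[of H c])
    show "q_fun \<zeta> = of_real (sqrt (2 / pi)) * (H \<zeta> - c)" if "0 < Re \<zeta>" for \<zeta>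
      unfolding q_fun_def H_def by (rule Q[OF minus_node_in_sector[OF that]])
    show "H holomorphic_on right_half"
      unfolding holomorphic_on_open[OF open_halfspace_Re_gt] using H by blast
  qed (rule Hc)
qed

lemma q_fun_holomorphic: "q_fun holomorphic_on right_half"
proof (rule q_fun_primitive)
  fix c H assume q: "\<And>\<zeta>. 0 < Re \<zeta> \<Longrightarrow> q_fun \<zeta> = of_real (sqrt (2 / pi)) * (H \<zeta> - c)"
    and H: "H holomorphic_on right_half"
  have "(\<lambda>\<zeta>. of_real (sqrt (2 / pi)) * (H \<zeta> - c)) holomorphic_on right_half"
    by (intro holomorphic_on_mult holomorphic_on_diff holomorphic_on_const H)
  then show ?thesis by (rule holomorphic_transform) (simp add: q)
qed

lemma q_fun_bound:
  assumes "0 < a"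
  shows "\<exists>C>0. \<forall>\<zeta>. a \<le> Re \<zeta> \<longrightarrow> cmod (q_fun \<zeta>) \<le> C * exp (- Re \<zeta>)"
proof (rule q_fun_primitive)
  fix c H assume q: "\<And>\<zeta>. 0 < Re \<zeta> \<Longrightarrow> q_fun \<zeta> = of_real (sqrt (2 / pi)) * (H \<zeta> - c)"
    and H: "\<And>\<zeta> a. 0 < a \<Longrightarrow> a \<le> Re \<zeta> \<Longrightarrow> cmod (H \<zeta> - c) \<le> 1 / ((1 - exp (- a)) * sqrt (2 * a)) * exp (- Re \<zeta>)"
  let ?C = "sqrt (2 / pi) * (1 / ((1 - exp (- a)) * sqrt (2 * a)))"
  have "cmod (q_fun \<zeta>) \<le> ?C * exp (- Re \<zeta>)" if "a \<le> Re \<zeta>" for \<zeta>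
  proof -
    have "cmod (q_fun \<zeta>) = sqrt (2 / pi) * cmod (H \<zeta> - c)"
      using q[of \<zeta>] assms that unfolding norm_mult by (simp add: norm_mult)
    also have "\<dots> \<le> sqrt (2 / pi) * (1 / ((1 - exp (- a)) * sqrt (2 * a)) * exp (- Re \<zeta>))"
      by (intro mult_left_mono H assms that) simp
    finally show ?thesis by (simp only: mult.assoc)
  qed
  moreover have "0 < ?C" using assms by simp
  ultimately show ?thesis by blast
qed

text \<open>The equation exp (- \<xi>^2 / 2) = z means that \<xi>^2 / 2 is a point of the lattice,
  and of the two square roots exactly one has negative real part, namely minus the principal
  one.\<close>

lemma S_minus_bij:
  assumes \<zeta>: "0 < Re \<zeta>" and z: "exp (- \<zeta>) = z"
  shows "bij_betw (\<lambda>k::int. - node 1 (\<zeta> + 2 * of_real pi * \<i> * of_int k)) UNIV (S_minus z)"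
proof -
  define x where "x k = \<zeta> + 2 * of_real pi * \<i> * of_int k" for k :: int
  have Rx: "0 < Re (x k)" for k using \<zeta> by (simp add: x_def)
  have sq: "(node 1 (x k))\<^sup>2 = 2 * x k" for k using node_facts(3)[OF _ Rx, of 1 k] by simp
  have "inj (\<lambda>k. - node 1 (x k))"
  proof (rule injI)
    fix k l assume "- node 1 (x k) = - node 1 (x l)"
    then have "2 * x k = 2 * x l" using sq by (metis neg_equal_iff_equal)
    then show "k = l" by (simp add: x_def)
  qed
  moreover have "- node 1 (x k) \<in> S_minus z" for k
  proof -
    have "exp (- x k) = exp (- \<zeta>)" unfolding exp_eq by (intro exI[of _ "- k"]) (simp add: x_def algebra_simps)
    then show ?thesis using node_facts(1)[OF _ Rx, of 1 k] z by (simp add: S_minus_def sq)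
  qed
  moreover have "\<xi> \<in> range (\<lambda>k. - node 1 (x k))" if "\<xi> \<in> S_minus z" for \<xi>
  proof -
    have "exp (- (\<xi>\<^sup>2) / 2) = exp (- \<zeta>)" using that z by (simp add: S_minus_def)
    then obtain n :: int where "- (\<xi>\<^sup>2) / 2 = - \<zeta> + of_real (of_int (2 * n) * pi) * \<i>" unfolding exp_eq by blast
    then have "\<xi>\<^sup>2 = 2 * x (- n)" by (simp add: x_def field_simps)
    then have "csqrt ((- \<xi>)\<^sup>2) = node 1 (x (- n))" by (simp add: node_1)
    moreover have "csqrt ((- \<xi>)\<^sup>2) = - \<xi>" using that by (intro csqrt_square) (simp add: S_minus_def)
    ultimately have "\<xi> = - node 1 (x (- n))" by simp
    then show ?thesis by blast
  qed
  ultimately show ?thesis unfolding x_def bij_betw_def by blast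
qed

section \<open>The kernel on the half line\<close>

abbreviation half_line :: "real measure" where "half_line \<equiv> restrict_space lborel {0<..}"

lemma space_half_line: "space half_line = {0<..}"
  by (simp add: space_restrict_space)

lemma sigma_finite_half_line: "sigma_finite_measure half_line"
  by (rule sigma_finite_measure_restrict_space[OF sigma_finite_lborel]) simp

lemma exp_integrable_half_line:
  fixes c :: real
  assumes "0 < c"
  shows "integrable half_line (\<lambda>s. exp (- c * s))"
proof -
  have "set_integrable lborel (einterval (ereal 0) \<infinity>) (\<lambda>s. exp (- c * s))"
  proof (rule interval_integral_FTC_nonneg(1)[where F = "\<lambda>s. - exp (- c * s) / c" and A = "- 1 / c" and B = 0])
    show "DERIV (\<lambda>s. - exp (- c * s) / c) s :> exp (- c * s)" for s
      using assms by (auto intro!: derivative_eq_intros)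
    have "((\<lambda>s. - exp (- c * s) / c) \<longlongrightarrow> - exp (- c * 0) / c) (at_right 0)"
      using assms by (intro tendsto_intros) auto
    then show "(((\<lambda>s. - exp (- c * s) / c) \<circ> real_of_ereal) \<longlongrightarrow> - 1 / c) (at_right (ereal 0))"
      by (simp only: ereal_tendsto_simps) simp
    have "filterlim (\<lambda>s. c * s) at_top at_top"
      using assms by (intro filterlim_tendsto_pos_mult_at_top[OF tendsto_const] filterlim_ident)
    then have "filterlim (\<lambda>s. - c * s) at_bot at_top" by (simp add: filterlim_uminus_at_bot)
    then have "((\<lambda>s. exp (- c * s)) \<longlongrightarrow> 0) at_top" by (rule filterlim_compose[OF exp_at_bot])
    then have "((\<lambda>s. - exp (- c * s) / c) \<longlongrightarrow> - 0 / c) at_top" using assms by (intro tendsto_intros) auto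
    then show "(((\<lambda>s. - exp (- c * s) / c) \<circ> real_of_ereal) \<longlongrightarrow> 0) (at_left \<infinity>)"
      by (simp only: ereal_tendsto_simps) simp
  qed (auto intro!: continuous_intros)
  then show ?thesis by (simp add: integrable_restrict_space set_integrable_def)
qed

lemma exp_integral_half_line:
  fixes c :: complex
  assumes "Re c < 0"
  shows "(\<integral>s. exp (of_real s * c) \<partial>half_line) = - 1 / c"
proof -
  have c: "c \<noteq> 0" using assms by auto
  have n: "cmod (exp (of_real s * c)) = exp (- (- Re c) * s)" for s by (simp add: norm_exp_eq_Re mult.commute)
  have m: "(\<lambda>s::real. exp (of_real s * c)) \<in> borel_measurable borel"
    by (intro borel_measurable_continuous_onI continuous_intros)
  have "integrable half_line (\<lambda>s. exp (of_real s * c))"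
    by (rule Bochner_Integration.integrable_bound[OF exp_integrable_half_line[of "- Re c"]])
      (use assms n m in \<open>auto intro!: measurable_restrict_space1\<close>)
  then have si: "set_integrable lborel {0<..} (\<lambda>s. exp (of_real s * c))"
    by (simp add: integrable_restrict_space set_integrable_def)
  have "(\<integral>s. exp (of_real s * c) \<partial>half_line) = (LINT s:{0<..}|lborel. exp (of_real s * c))"
    by (simp add: integral_restrict_space set_lebesgue_integral_def)
  also have "\<dots> = (LBINT s=ereal 0..\<infinity>. exp (of_real s * c))"
    by (simp add: interval_integral_to_infinity_eq)
  also have "\<dots> = 0 - 1 / c"
  proof (rule interval_integral_FTC_integrable[where F = "\<lambda>s. exp (of_real s * c) / c"])
    show "((\<lambda>s. exp (of_real s * c) / c) has_vector_derivative exp (of_real s * c)) (at s)" for s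
    proof -
      have "((\<lambda>z. exp (z * c) / c) has_field_derivative exp (of_real s * c)) (at (of_real s))"
        using c by (auto intro!: derivative_eq_intros)
      from has_vector_derivative_real_field[OF this] show ?thesis .
    qed
    show "isCont (\<lambda>s. exp (of_real s * c)) s" for s :: real by (intro continuous_intros)
    show "set_integrable lborel (einterval (ereal 0) \<infinity>) (\<lambda>s. exp (of_real s * c))" using si by simp
    have "((\<lambda>s. exp (of_real s * c) / c) \<longlongrightarrow> exp (of_real 0 * c) / c) (at_right 0)"
      using c by (intro tendsto_intros) auto
    then show "(((\<lambda>s. exp (of_real s * c) / c) \<circ> real_of_ereal) \<longlongrightarrow> 1 / c) (at_right (ereal 0))"
      by (simp only: ereal_tendsto_simps) simp
    have "filterlim (\<lambda>s. - Re c * s) at_top at_top"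
      using assms by (intro filterlim_tendsto_pos_mult_at_top[OF tendsto_const] filterlim_ident) simp
    then have "filterlim (\<lambda>s. - (- Re c) * s) at_bot at_top" by (simp add: filterlim_uminus_at_bot)
    then have "((\<lambda>s. exp (- (- Re c) * s)) \<longlongrightarrow> 0) at_top" by (rule filterlim_compose[OF exp_at_bot])
    then have "((\<lambda>s. exp (of_real s * c)) \<longlongrightarrow> 0) at_top"
      unfolding n[symmetric] by (rule tendsto_norm_zero_cancel)
    then have "((\<lambda>s. exp (of_real s * c) / c) \<longlongrightarrow> 0 / c) at_top" using c by (intro tendsto_intros) auto
    then show "(((\<lambda>s. exp (of_real s * c) / c) \<circ> real_of_ereal) \<longlongrightarrow> 0) (at_left \<infinity>)"
      by (simp only: ereal_tendsto_simps) simp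
  qed simp
  finally show ?thesis by simp
qed

lemma weighted_half_line:
  assumes "0 < c"
  shows "weighted_space half_line (\<lambda>s. exp (- c * s))"
proof -
  interpret sigma_finite_measure half_line by (rule sigma_finite_half_line)
  have "integrable half_line (\<lambda>s. exp (- (2 * c) * s))" using assms by (intro exp_integrable_half_line) simp
  moreover have "exp (- (2 * c) * s) = exp (- c * s) * exp (- c * s)" for s by (simp flip: exp_add)
  ultimately show ?thesis by unfold_locales auto
qed

text \<open>\<open>Psi\<close> contains - Q / 2, and each point of the sum carries exp of
  \<open>Psi\<close> twice, once from each factor of the kernel; hence the full Q in the
  exponent.\<close>

definition tasep_node :: "real \<Rightarrow> real \<Rightarrow> complex \<Rightarrow> complex" where
  "tasep_node h m \<zeta> = airy_node h m \<zeta> * exp (- q_fun \<zeta>)"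

definition tasep_kernel :: "real \<Rightarrow> real \<Rightarrow> complex \<Rightarrow> real \<Rightarrow> real \<Rightarrow> complex" where
  "tasep_kernel h m z s t = disc_sum (tasep_node h (m + s + t)) z"

lemma tasep_node_strip_bound:
  assumes h: "0 < h" and a: "0 < a"
  shows "\<exists>C>0. \<forall>\<zeta> m. a \<le> Re \<zeta> \<and> Re \<zeta> \<le> b \<and> m0 \<le> m \<longrightarrow>
     cmod (tasep_node h m \<zeta>) \<le> C * exp (- (m - m0) * sqrt (2 * (h * a))) / (1 + (Im \<zeta>)\<^sup>2)"
proof -
  from airy_node_strip_bound[OF h a, of b m0] obtain C where C: "0 < C \<and> (\<forall>\<zeta> m. a \<le> Re \<zeta> \<and> Re \<zeta> \<le> b \<and> m0 \<le> m \<longrightarrow>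
     cmod (airy_node h m \<zeta>) \<le> C * exp (- (m - m0) * sqrt (2 * (h * a))) / (1 + (Im \<zeta>)\<^sup>2))" ..
  from q_fun_bound[OF a] obtain D where D: "0 < D \<and> (\<forall>\<zeta>. a \<le> Re \<zeta> \<longrightarrow> cmod (q_fun \<zeta>) \<le> D * exp (- Re \<zeta>))" ..
  have "cmod (tasep_node h m \<zeta>) \<le> C * exp D * exp (- (m - m0) * sqrt (2 * (h * a))) / (1 + (Im \<zeta>)\<^sup>2)"
    if \<zeta>: "a \<le> Re \<zeta> \<and> Re \<zeta> \<le> b \<and> m0 \<le> m" for \<zeta> m
  proof -
    let ?E = "C * exp (- (m - m0) * sqrt (2 * (h * a))) / (1 + (Im \<zeta>)\<^sup>2)"
    have 1: "cmod (airy_node h m \<zeta>) \<le> ?E" using C \<zeta> by simp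
    have "D * exp (- Re \<zeta>) \<le> D * 1" using D \<zeta> a by (intro mult_left_mono) auto
    moreover have "cmod (q_fun \<zeta>) \<le> D * exp (- Re \<zeta>)" using D \<zeta> by simp
    ultimately have "cmod (q_fun \<zeta>) \<le> D" by linarith
    then have "Re (- q_fun \<zeta>) \<le> D" using abs_Re_le_cmod[of "q_fun \<zeta>"] by simp
    then have "cmod (exp (- q_fun \<zeta>)) \<le> exp D" unfolding norm_exp_eq_Re by simp
    then have "cmod (tasep_node h m \<zeta>) \<le> ?E * exp D"
      unfolding tasep_node_def norm_mult using 1 order_trans[OF norm_ge_zero 1] by (intro mult_mono) auto
    then show ?thesis by (simp add: mult_ac)
  qed
  moreover have "0 < C * exp D" using C by simp
  ultimately show ?thesis by blast
qed

lemma tasep_node_decay: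
  assumes "0 < h"
  shows "halfplane_decay (tasep_node h m)"
  unfolding halfplane_decay_def
proof (intro conjI allI impI)
  show "tasep_node h m holomorphic_on right_half"
    unfolding tasep_node_def[abs_def]
    by (intro holomorphic_on_mult holomorphic_on_exp' holomorphic_on_minus q_fun_holomorphic airy_node_holomorphic assms)
  fix a b :: real assume a: "0 < a"
  from tasep_node_strip_bound[OF assms a, of b m] obtain C where "0 < C \<and> (\<forall>\<zeta> m'. a \<le> Re \<zeta> \<and> Re \<zeta> \<le> b \<and> m \<le> m' \<longrightarrow>
     cmod (tasep_node h m' \<zeta>) \<le> C * exp (- (m' - m) * sqrt (2 * (h * a))) / (1 + (Im \<zeta>)\<^sup>2))" ..
  from conjunct2[OF this, rule_format, of _ m]
  show "\<exists>C. \<forall>\<zeta>. a \<le> Re \<zeta> \<and> Re \<zeta> \<le> b \<longrightarrow> cmod (tasep_node h m \<zeta>) \<le> C / (1 + (Im \<zeta>)\<^sup>2)"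
    by (intro exI[of _ C]) simp
qed

lemma disc_sum_measurable:
  assumes G: "\<And>y. halfplane_decay (G y)" and meas: "\<And>\<zeta>. (\<lambda>y. G y \<zeta>) \<in> borel_measurable M"
    and z: "z \<in> ball 0 1 - {0}"
  shows "(\<lambda>y. disc_sum (G y) z) \<in> borel_measurable M"
proof (rule borel_measurable_LIMSEQ_metric)
  show "(\<lambda>y. \<Sum>k\<in>{1 - int N..int N}. G y (- Ln z + 2 * of_real pi * \<i> * of_int k)) \<in> borel_measurable M" for N
    by (intro borel_measurable_sum meas)
  fix y
  have a: "0 < Re (- Ln z)" using z by (simp add: Re_Ln)
  then obtain C where C: "\<And>\<xi>. Re (- Ln z) \<le> Re \<xi> \<and> Re \<xi> \<le> Re (- Ln z) \<Longrightarrow> cmod (G y \<xi>) \<le> C / (1 + (Im \<xi>)\<^sup>2)"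
    using G[of y] unfolding halfplane_decay_def by meson
  show "(\<lambda>N. \<Sum>k\<in>{1 - int N..int N}. G y (- Ln z + 2 * of_real pi * \<i> * of_int k)) \<longlonglongrightarrow> disc_sum (G y) z"
    unfolding disc_sum_def lattice_sum_def
    by (intro lattice_partial_sums lattice_integrable[of _ _ C] C) simp
qed

lemma airy_node_measurable: "(\<lambda>m. airy_node h m \<zeta>) \<in> borel_measurable borel"
  unfolding airy_node_def airy_phase_def
  by (intro borel_measurable_continuous_onI continuous_intros)

lemma tasep_node_measurable: "(\<lambda>m. tasep_node h m \<zeta>) \<in> borel_measurable borel"
  unfolding tasep_node_def by (intro borel_measurable_times airy_node_measurable borel_measurable_const)

lemma half_line_sum_measurable:
  fixes f :: "real \<Rightarrow> complex"
  assumes "f \<in> borel_measurable borel"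
  shows "(\<lambda>(s, t). f (m + s + t)) \<in> borel_measurable (half_line \<Otimes>\<^sub>M half_line)"
proof -
  have id: "(\<lambda>s::real. s) \<in> borel_measurable half_line" by (rule measurable_restrict_space1) simp
  have "(\<lambda>p. m + fst p + snd p) \<in> borel_measurable (half_line \<Otimes>\<^sub>M half_line)"
    by (intro borel_measurable_add borel_measurable_const measurable_compose[OF measurable_fst id]
        measurable_compose[OF measurable_snd id])
  from measurable_compose[OF this assms] show ?thesis by (simp add: split_beta')
qed

lemma tasep_kernel_measurable:
  assumes "0 < h" "z \<in> ball 0 1 - {0}"
  shows "case_prod (tasep_kernel h m z) \<in> borel_measurable (half_line \<Otimes>\<^sub>M half_line)"
  unfolding tasep_kernel_def
  by (rule half_line_sum_measurable)
    (rule disc_sum_measurable[OF tasep_node_decay[OF assms(1)] tasep_node_measurable assms(2)])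

text \<open>With m itself as base point the decay in the shift m + s + t leaves only s + t, and the
  exponential splits into the product weight. Its rate sqrt (2 h a) tends to 0 as the annulus
  approaches the unit circle.\<close>

lemma tasep_kernel_bound:
  assumes h: "0 < h" and a: "0 < a"
  shows "\<exists>C\<ge>0. \<forall>z. exp (- b) \<le> cmod z \<and> cmod z \<le> exp (- a) \<longrightarrow>
    weighted_space.kernel_le half_line (\<lambda>s. exp (- sqrt (2 * (h * a)) * s)) C (tasep_kernel h m z)"
proof -
  let ?c = "sqrt (2 * (h * a))"
  have c: "0 < ?c" using h a by simp
  interpret weighted_space half_line "\<lambda>s. exp (- ?c * s)" by (rule weighted_half_line[OF c])
  from tasep_node_strip_bound[OF h a, of b m] obtain C where C: "0 < C \<and> (\<forall>\<zeta> m'. a \<le> Re \<zeta> \<and> Re \<zeta> \<le> b \<and> m \<le> m' \<longrightarrow>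
     cmod (tasep_node h m' \<zeta>) \<le> C * exp (- (m' - m) * ?c) / (1 + (Im \<zeta>)\<^sup>2))" ..
  have "kernel_le (C * disc_const) (tasep_kernel h m z)" if z: "exp (- b) \<le> cmod z \<and> cmod z \<le> exp (- a)" for z
    unfolding kernel_le_def space_half_line
  proof (intro ballI)
    fix s t :: real assume st: "s \<in> {0<..}" "t \<in> {0<..}"
    have z0: "z \<noteq> 0" using z exp_gt_zero[of "- b"] by auto
    then have ln: "a \<le> - ln (cmod z)" "- ln (cmod z) \<le> b"
    proof -
      have "ln (cmod z) \<le> ln (exp (- a))" using z z0 by (subst ln_le_cancel_iff) auto
      moreover have "ln (exp (- b)) \<le> ln (cmod z)" using z z0 by (subst ln_le_cancel_iff) auto
      ultimately show "a \<le> - ln (cmod z)" "- ln (cmod z) \<le> b" by simp_all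
    qed
    have "cmod (tasep_kernel h m z s t) \<le> (C * exp (- (m + s + t - m) * ?c)) * disc_const"
      unfolding tasep_kernel_def
    proof (rule disc_sum_bound[OF z0])
      fix \<xi> :: complex assume "Re \<xi> = - ln (cmod z)"
      then show "cmod (tasep_node h (m + s + t) \<xi>) \<le> C * exp (- (m + s + t - m) * ?c) / (1 + (Im \<xi>)\<^sup>2)"
        using conjunct2[OF C, rule_format, of \<xi> "m + s + t"] ln st by simp
    qed
    also have "exp (- (m + s + t - m) * ?c) = exp (- ?c * s) * exp (- ?c * t)"
      by (simp add: algebra_simps flip: exp_add)
    finally show "cmod (tasep_kernel h m z s t) \<le> C * disc_const * (exp (- ?c * s) * exp (- ?c * t))"
      by (simp add: mult_ac)
  qed
  then show ?thesis using C disc_const_pos by (intro exI[of _ "C * disc_const"]) simp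
qed

lemma tasep_det_holomorphic:
  assumes h: "0 < h"
  shows "(\<lambda>z. fredholm_det half_line (tasep_kernel h m z)) holomorphic_on ball 0 1 - {0}"
proof (rule holomorphic_on_fredholm_det)
  show "open (ball 0 1 - {0 :: complex})" by (intro open_Diff open_ball) auto
  show "case_prod (tasep_kernel h m z) \<in> borel_measurable (half_line \<Otimes>\<^sub>M half_line)" if "z \<in> ball 0 1 - {0}" for z
    by (rule tasep_kernel_measurable[OF h that])
  show "(\<lambda>z. tasep_kernel h m z s t) holomorphic_on ball 0 1 - {0}" for s t
    unfolding tasep_kernel_def by (rule holomorphic_disc_sum[OF tasep_node_decay[OF h]])
  fix z :: complex assume z: "z \<in> ball 0 1 - {0}"
  \<comment> \<open>The radii are chosen such that the ball around z lies in the annulus between |z|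
    / 2 = exp (- b) and (1 + |z|) / 2 = exp (- a).\<close>
  define r where "r = min (cmod z / 2) ((1 - cmod z) / 2)"
  define a where "a = - ln ((1 + cmod z) / 2)"
  define b where "b = - ln (cmod z / 2)"
  have r: "0 < r" using z by (simp add: r_def)
  have "0 < (1 + cmod z) / 2" "(1 + cmod z) / 2 < 1" using z by (auto simp: add_pos_nonneg)
  then have a: "0 < a" unfolding a_def using ln_less_zero by fastforce
  have w: "exp (- b) \<le> cmod w \<and> cmod w \<le> exp (- a)" if "w \<in> ball z r" for w
  proof -
    have "cmod (w - z) < r" using that by (simp add: dist_norm norm_minus_commute)
    then have "\<bar>cmod w - cmod z\<bar> < r" using norm_triangle_ineq3[of w z] by linarith
    then have "cmod z / 2 \<le> cmod w" "cmod w \<le> (1 + cmod z) / 2" unfolding r_def by (auto simp: min_def abs_less_iff field_simps split: if_splits)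
    moreover have "exp (- b) = cmod z / 2" "exp (- a) = (1 + cmod z) / 2" using z by (auto simp: a_def b_def add_pos_nonneg)
    ultimately show ?thesis by simp
  qed
  from tasep_kernel_bound[OF h a, of b m] obtain C where C: "C \<ge> 0 \<and> (\<forall>z. exp (- b) \<le> cmod z \<and> cmod z \<le> exp (- a) \<longrightarrow>
    weighted_space.kernel_le half_line (\<lambda>s. exp (- sqrt (2 * (h * a)) * s)) C (tasep_kernel h m z))" ..
  show "\<exists>r>0. \<exists>C\<ge>0. \<exists>g. weighted_space half_line g \<and> ball z r \<subseteq> ball 0 1 - {0} \<and>
      (\<forall>w\<in>ball z r. weighted_space.kernel_le half_line g C (tasep_kernel h m w))"
  proof (rule exI[of _ r], rule conjI[OF r], rule exI[of _ C], rule conjI[OF conjunct1[OF C]],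
      rule exI[of _ "\<lambda>s. exp (- sqrt (2 * (h * a)) * s)"], intro conjI ballI)
    show "weighted_space half_line (\<lambda>s. exp (- sqrt (2 * (h * a)) * s))"
      by (rule weighted_half_line) (use h a in simp)
    show "ball z r \<subseteq> ball 0 1 - {0}"
    proof
      fix w assume "w \<in> ball z r"
      then have "0 < cmod w" "cmod w < 1" using w[of w] a exp_gt_zero[of "- b"] exp_less_one_iff[of "- a"] by linarith+
      then show "w \<in> ball 0 1 - {0}" by simp
    qed
    show "weighted_space.kernel_le half_line (\<lambda>s. exp (- sqrt (2 * (h * a)) * s)) C (tasep_kernel h m w)"
      if "w \<in> ball z r" for w using C w[OF that] by simp
  qed
qed

text \<open>This is where the scales come from. The two copies of \<tau> w^3 / 3 add up to (\<eta>
  w)^3 / 3 exactly if \<eta>^3 = 2 \<tau>, and then 2 \<tau>^(1/3) x w = 2^(2/3) x (\<eta> w): hence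
  h = \<eta>^2 and the argument 2^(2/3) x of \<open>F_GOE\<close>.\<close>

lemma tasep_node_eq:
  fixes \<tau> x y :: real
  assumes \<tau>: "0 < \<tau>" and \<zeta>: "0 < Re \<zeta>"
  defines "\<eta> \<equiv> (2 * \<tau>) powr (1/3)" and "X \<equiv> \<tau> powr (1/3) * x"
  shows "tasep_node ((2 * \<tau>) powr (2/3)) (2 powr (2/3) * x + y) \<zeta>
    = of_real \<eta> / node 1 \<zeta> * exp (Psi X \<tau> (- node 1 \<zeta>) + Psi X \<tau> (- node 1 \<zeta>)) * exp (of_real (\<eta> * y) * (- node 1 \<zeta>))"
proof -
  define w where "w = node 1 \<zeta>"
  have \<eta>: "0 < \<eta>" using \<tau> by (simp add: \<eta>_def)
  have h: "(2 * \<tau>) powr (2/3) = \<eta> * \<eta>" by (simp add: \<eta>_def flip: powr_add)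
  have \<eta>3: "\<eta> ^ 3 = 2 * \<tau>" using \<tau> by (simp add: \<eta>_def powr_power)
  have X: "2 * X = 2 powr (2/3) * x * \<eta>"
  proof -
    have "2 powr (2/3) * \<eta> = 2 powr (2/3) * 2 powr (1/3) * \<tau> powr (1/3)"
      using \<tau> by (simp add: \<eta>_def powr_mult)
    also have "2 powr (2/3) * 2 powr (1/3) = (2::real)" by (simp flip: powr_add)
    finally show ?thesis by (simp add: X_def mult_ac)
  qed
  have nh: "node (\<eta> * \<eta>) \<zeta> = of_real \<eta> * w" using \<eta> by (simp add: node_def w_def)
  have w0: "w \<noteq> 0" unfolding w_def by (rule node_facts(4)) (use \<zeta> in auto)
  have e1: "2 * (of_real \<tau> * w ^ 3 / 3) = (of_real \<eta> * w) ^ 3 / 3"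
    unfolding power_mult_distrib of_real_power[symmetric] \<eta>3 by simp
  have e2: "2 * (of_real X * w) = of_real (2 powr (2/3) * x) * (of_real \<eta> * w)"
  proof -
    have "2 * (of_real X * w) = of_real (2 * X) * w" by simp
    then show ?thesis unfolding X by (simp add: mult_ac)
  qed
  have "Psi X \<tau> (- w) = of_real \<tau> * w ^ 3 / 3 - of_real X * w - q_fun \<zeta> / 2"
    by (simp add: Psi_def q_fun_def w_def)
  then have "Psi X \<tau> (- w) + Psi X \<tau> (- w) = 2 * (of_real \<tau> * w ^ 3 / 3) - 2 * (of_real X * w) - q_fun \<zeta>"
    by simp
  then have e: "Psi X \<tau> (- w) + Psi X \<tau> (- w) + of_real (\<eta> * y) * (- w)
      = ((of_real \<eta> * w) ^ 3 / 3 - of_real (2 powr (2/3) * x + y) * (of_real \<eta> * w)) + - q_fun \<zeta>"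
    unfolding e1 e2 by (simp add: algebra_simps)
  have "of_real (\<eta> * \<eta>) / (of_real \<eta> * w) = of_real \<eta> / w" using \<eta> by simp
  then show ?thesis
    unfolding h tasep_node_def airy_node_def airy_phase_def nh w_def[symmetric]
    by (simp only: mult.assoc exp_add[symmetric] e)
qed

text \<open>The Laplace variable is measured in units of 1 / \<eta>, so that exchanging the factors
  gives the Hankel kernel in m + s + t itself and not a rescaled copy.\<close>

lemma fredholm_det_K1:
  fixes \<tau> x :: real
  assumes \<tau>: "0 < \<tau>" and z: "z \<in> ball 0 1 - {0}"
  shows "fredholm_det (count_space (S_minus z)) (K1 (\<tau> powr (1/3) * x) \<tau>)
    = fredholm_det half_line (tasep_kernel ((2 * \<tau>) powr (2/3)) (2 powr (2/3) * x) z)"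
proof -
  define \<eta> where "\<eta> = (2 * \<tau>) powr (1/3)"
  define h where "h = (2 * \<tau>) powr (2/3)"
  define X where "X = \<tau> powr (1/3) * x"
  define m where "m = 2 powr (2/3) * x"
  define a where "a = Re (- Ln z)"
  have \<eta>: "0 < \<eta>" and h: "0 < h" using \<tau> by (auto simp: \<eta>_def h_def)
  have a: "0 < a" using z by (simp add: a_def Re_Ln)
  have ez: "exp (- (- Ln z)) = z" using z by simp
  define x' where "x' k = - Ln z + 2 * of_real pi * \<i> * of_int k" for k :: int
  have Rx: "Re (x' k) = a" for k by (simp add: x'_def a_def)
  have Rx0: "0 < Re (x' k)" for k using Rx a by simp
  have bij: "bij_betw (\<lambda>k. - node 1 (x' k)) UNIV (S_minus z)"
    unfolding x'_def using a ez unfolding a_def by (intro S_minus_bij)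
  have cS: "countable (S_minus z)"
    using bij_betw_imp_surj_on[OF bij] by (metis countable_image countableI_type)
  \<comment> \<open>For a node p + i q of unit scale, p^2 = |\<zeta>| + Re \<zeta> \<ge> 2 a. So
    \<open>S_minus z\<close> keeps the distance d from the imaginary axis, which makes both factors
    decay exponentially in s.\<close>
  define d where "d = sqrt (2 * a)"
  have d: "0 < d" using a by (simp add: d_def)
  have S: "Re \<xi> \<le> - d" "\<xi> \<noteq> 0" if "\<xi> \<in> S_minus z" for \<xi>
  proof -
    have "\<xi> \<in> range (\<lambda>k. - node 1 (x' k))" using that bij_betw_imp_surj_on[OF bij] by simp
    then obtain k where k: "\<xi> = - node 1 (x' k)" by blast
    have "d\<^sup>2 \<le> (Re (node 1 (x' k)))\<^sup>2"
      using node_facts(2)[of 1 "x' k"] Rx[of k] a complex_Re_le_cmod[of "x' k"] by (simp add: d_def)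
    then have "d \<le> Re (node 1 (x' k))"
      by (rule power2_le_imp_le) (rule less_imp_le[OF node_facts(1)], use Rx0 in simp_all)
    then show "Re \<xi> \<le> - d" "\<xi> \<noteq> 0" using d unfolding k by auto
  qed
  \<comment> \<open>The factor \<eta> cancels the 1 / \<eta> of the rescaled Laplace integral, and
    the sign of - \<xi> cancels the one in the integral of exp (s c), which is - 1 / c.\<close>
  define A where "A \<xi> s = of_real \<eta> * exp (Psi X \<tau> \<xi>) / (- \<xi>) * exp (of_real (\<eta> * s) * \<xi>)" for \<xi> s
  define B where "B s \<xi> = exp (Psi X \<tau> \<xi>) * exp (of_real (\<eta> * s) * \<xi>)" for s \<xi>
  define \<alpha> where "\<alpha> \<xi> = \<eta> * cmod (exp (Psi X \<tau> \<xi>)) / cmod \<xi>" for \<xi>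
  define \<beta> where "\<beta> \<xi> = cmod (exp (Psi X \<tau> \<xi>))" for \<xi>
  have BA: "B s \<xi> * A \<xi> t = of_real \<eta> / (- \<xi>) * exp (Psi X \<tau> \<xi> + Psi X \<tau> \<xi>) * exp (of_real (\<eta> * (s + t)) * \<xi>)" for s t \<xi>
    unfolding A_def B_def distrib_left of_real_add distrib_right exp_add by simp
  have node: "tasep_node h (m + s + t) (x' k) = B s (- node 1 (x' k)) * A (- node 1 (x' k)) t" for s t k
    unfolding BA h_def m_def X_def \<eta>_def minus_minus add.assoc by (rule tasep_node_eq[OF \<tau> Rx0])
  obtain C where C: "\<And>\<xi>. a \<le> Re \<xi> \<and> Re \<xi> \<le> a \<Longrightarrow> cmod (tasep_node h m \<xi>) \<le> C / (1 + (Im \<xi>)\<^sup>2)"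
    using tasep_node_decay[OF h, of m] a unfolding halfplane_decay_def by meson
  interpret sigma_finite_measure "count_space (S_minus z)"
    by (rule sigma_finite_measure_count_space_countable[OF cS])
  interpret H: sigma_finite_measure half_line by (rule sigma_finite_half_line)
  have meas_exp: "(\<lambda>s. exp (of_real (\<eta> * s) * \<xi>)) \<in> borel_measurable half_line" for \<xi> :: complex
  proof -
    have "(\<lambda>s. exp (of_real (\<eta> * s) * \<xi>)) \<in> borel_measurable borel"
      by (intro borel_measurable_continuous_onI continuous_intros)
    then show ?thesis by (auto intro!: measurable_restrict_space1)
  qed
  interpret kernel_factorization "count_space (S_minus z)" half_line A B \<alpha> \<beta> "\<lambda>s. exp (- (\<eta> * d) * s)"
  proof unfold_locales
    have "(\<lambda>s. A \<xi> s) \<in> borel_measurable half_line" "(\<lambda>s. B s \<xi>) \<in> borel_measurable half_line" for \<xi>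
      unfolding A_def B_def by (intro borel_measurable_times borel_measurable_const meas_exp)+
    then have "(\<lambda>(\<xi>, s). A \<xi> s) \<in> borel_measurable (count_space (S_minus z) \<Otimes>\<^sub>M half_line)"
      and B: "(\<lambda>(\<xi>, s). B s \<xi>) \<in> borel_measurable (count_space (S_minus z) \<Otimes>\<^sub>M half_line)"
      using cS by (auto intro!: measurable_pair_measure_countable1)
    then show "case_prod A \<in> borel_measurable (count_space (S_minus z) \<Otimes>\<^sub>M half_line)" by simp
    from measurable_compose[OF measurable_pair_swap' B]
    show "case_prod B \<in> borel_measurable (half_line \<Otimes>\<^sub>M count_space (S_minus z))"
      by (simp add: split_beta')
    show "0 \<le> \<alpha> \<xi>" "0 \<le> \<beta> \<xi>" for \<xi> using \<eta> by (auto simp: \<alpha>_def \<beta>_def)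
    have ex: "cmod (exp (of_real (\<eta> * s) * \<xi>)) \<le> exp (- (\<eta> * d) * s)"
      if "\<xi> \<in> space (count_space (S_minus z))" "s \<in> space half_line" for \<xi> s
    proof -
      have "\<eta> * s * Re \<xi> \<le> \<eta> * s * (- d)"
        using S(1)[of \<xi>] that \<eta> by (intro mult_left_mono) (auto simp: space_half_line)
      then show ?thesis by (simp add: norm_exp_eq_Re mult_ac)
    qed
    show "cmod (A \<xi> s) \<le> \<alpha> \<xi> * exp (- (\<eta> * d) * s)"
      if "\<xi> \<in> space (count_space (S_minus z))" "s \<in> space half_line" for \<xi> s
    proof -
      have "cmod (A \<xi> s) = \<alpha> \<xi> * cmod (exp (of_real (\<eta> * s) * \<xi>))"
        unfolding A_def \<alpha>_def norm_mult norm_divide using \<eta> by simp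
      also have "\<dots> \<le> \<alpha> \<xi> * exp (- (\<eta> * d) * s)"
        using \<eta> by (intro mult_left_mono ex that) (simp add: \<alpha>_def)
      finally show ?thesis .
    qed
    show "cmod (B s \<xi>) \<le> \<beta> \<xi> * exp (- (\<eta> * d) * s)"
      if "\<xi> \<in> space (count_space (S_minus z))" "s \<in> space half_line" for \<xi> s
      unfolding B_def \<beta>_def norm_mult by (intro mult_left_mono ex that) simp
    show "integrable (count_space (S_minus z)) (\<lambda>\<xi>. \<alpha> \<xi> * \<beta> \<xi>)"
    proof -
      \<comment> \<open>The product \<open>\<alpha> * \<beta>\<close> is the modulus of B A at s = t
        = 0, so its summability is the absolute convergence of the lattice sum of
        \<open>tasep_node h m\<close>.\<close>
      have "integrable (count_space UNIV) (\<lambda>k. cmod (tasep_node h m (x' k)))"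
        unfolding x'_def by (intro integrable_norm lattice_integrable[of _ _ C] C) (simp add: a_def)
      also have "(\<lambda>k. cmod (tasep_node h m (x' k))) = (\<lambda>k. \<alpha> (- node 1 (x' k)) * \<beta> (- node 1 (x' k)))"
        using node[of 0 0] \<eta> by (simp add: fun_eq_iff A_def B_def \<alpha>_def \<beta>_def norm_mult norm_divide)
      finally show ?thesis by (rule iffD1[OF integrable_bij_count_space[OF bij, of "\<lambda>\<xi>. \<alpha> \<xi> * \<beta> \<xi>"]])
    qed
    have "integrable half_line (\<lambda>s. exp (- (2 * (\<eta> * d)) * s))"
      using \<eta> d by (intro exp_integrable_half_line) simp
    moreover have "exp (- (2 * (\<eta> * d)) * s) = exp (- (\<eta> * d) * s) * exp (- (\<eta> * d) * s)" for s
      by (simp flip: exp_add)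
    ultimately show "integrable half_line (\<lambda>s. exp (- (\<eta> * d) * s) * exp (- (\<eta> * d) * s))"
      by (simp only:)
  qed simp
  have "fredholm_det (count_space (S_minus z)) (K1 X \<tau>)
      = fredholm_det (count_space (S_minus z)) (\<lambda>\<xi>1 \<xi>2. \<integral>s. A \<xi>1 s * B s \<xi>2 \<partial>half_line)"
    unfolding fredholm_det_alt
  proof (intro suminf_cong arg_cong2[where f = "(*)"] refl fredholm_term_cong)
    fix \<xi>1 \<xi>2 assume "\<xi>1 \<in> space (count_space (S_minus z))" "\<xi>2 \<in> space (count_space (S_minus z))"
    then have S12: "Re \<xi>1 \<le> - d" "Re \<xi>2 \<le> - d" "\<xi>1 \<noteq> 0" using S by auto
    have neg: "Re (of_real \<eta> * (\<xi>1 + \<xi>2)) < 0"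
      using \<eta> d S12 by (simp add: mult_pos_neg)
    then have nz: "\<xi>1 + \<xi>2 \<noteq> 0" by (metis less_irrefl mult_zero_right zero_complex.sel(1))
    have "(\<integral>s. A \<xi>1 s * B s \<xi>2 \<partial>half_line)
        = (\<integral>s. of_real \<eta> * exp (Psi X \<tau> \<xi>1 + Psi X \<tau> \<xi>2) / (- \<xi>1) * exp (of_real s * (of_real \<eta> * (\<xi>1 + \<xi>2))) \<partial>half_line)"
    proof (rule arg_cong[where f = "integral\<^sup>L half_line"], rule ext)
      fix s
      have "exp (of_real s * (of_real \<eta> * (\<xi>1 + \<xi>2))) = exp (of_real (\<eta> * s) * \<xi>1) * exp (of_real (\<eta> * s) * \<xi>2)"
        by (simp add: algebra_simps flip: exp_add)
      then show "A \<xi>1 s * B s \<xi>2 = of_real \<eta> * exp (Psi X \<tau> \<xi>1 + Psi X \<tau> \<xi>2) / (- \<xi>1) * exp (of_real s * (of_real \<eta> * (\<xi>1 + \<xi>2)))"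
        by (simp add: A_def B_def exp_add)
    qed
    also have "\<dots> = of_real \<eta> * exp (Psi X \<tau> \<xi>1 + Psi X \<tau> \<xi>2) / (- \<xi>1) * (- 1 / (of_real \<eta> * (\<xi>1 + \<xi>2)))"
      by (simp only: integral_mult_right_zero exp_integral_half_line[OF neg])
    also have "\<dots> = K1 X \<tau> \<xi>1 \<xi>2" using nz S12 \<eta> by (simp add: K1_def)
    finally show "K1 X \<tau> \<xi>1 \<xi>2 = (\<integral>s. A \<xi>1 s * B s \<xi>2 \<partial>half_line)" by (rule sym)
  qed
  also have "\<dots> = fredholm_det half_line (\<lambda>s t. \<integral>\<xi>. B s \<xi> * A \<xi> t \<partial>count_space (S_minus z))"
    by (rule fredholm_det_swap)
  also have "(\<lambda>s t. \<integral>\<xi>. B s \<xi> * A \<xi> t \<partial>count_space (S_minus z)) = tasep_kernel h m z"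
  proof (intro ext)
    fix s t
    have "(\<integral>\<xi>. B s \<xi> * A \<xi> t \<partial>count_space (S_minus z)) = (\<integral>k. tasep_node h (m + s + t) (x' k) \<partial>count_space UNIV)"
      unfolding node by (rule integral_bij_count_space[OF bij, symmetric])
    then show "(\<integral>\<xi>. B s \<xi> * A \<xi> t \<partial>count_space (S_minus z)) = tasep_kernel h m z s t"
      by (simp add: tasep_kernel_def disc_sum_def lattice_sum_def x'_def)
  qed
  finally show ?thesis unfolding X_def h_def m_def .
qed

section \<open>Exponential closeness\<close>

text \<open>The range of h Re \<zeta> from 1 to 4 covers the circles of radius exp (- 1 / h), exp (-
  2 / h) and exp (- 4 / h). Replacing 1 + (h Im \<zeta>)^2 by h^2 (1 + (Im \<zeta>)^2) costs 1 / h^2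
  and turns the Jacobian factor h into 1 / h.\<close>

lemma airy_node_uniform_bound:
  "\<exists>C>0. \<forall>h \<zeta> m. 0 < h \<and> h \<le> 1 \<and> 1 \<le> h * Re \<zeta> \<and> h * Re \<zeta> \<le> 4 \<and> m0 \<le> m \<longrightarrow>
     cmod (airy_node h m \<zeta>) \<le> C / h * exp (- (m - m0)) / (1 + (Im \<zeta>)\<^sup>2)"
proof -
  from airy_node_bound[of 4 m0] obtain C where C': "0 < C \<and> (\<forall>h \<zeta> m a. 0 < h \<and> 0 < a \<and> a \<le> h * Re \<zeta> \<and> h * Re \<zeta> \<le> 4 \<and> m0 \<le> m \<longrightarrow>
      cmod (airy_node h m \<zeta>) \<le> C * h / sqrt (2 * a) * exp (- (m - m0) * sqrt (2 * a)) / (a\<^sup>2 + (h * Im \<zeta>)\<^sup>2))" ..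
  note C = conjunct1[OF C'] and bd = conjunct2[OF C', rule_format]
  have "cmod (airy_node h m \<zeta>) \<le> C / h * exp (- (m - m0)) / (1 + (Im \<zeta>)\<^sup>2)"
    if h: "0 < h" "h \<le> 1" and \<zeta>: "1 \<le> h * Re \<zeta>" "h * Re \<zeta> \<le> 4" and m: "m0 \<le> m" for h \<zeta> m
  proof -
    let ?E = "exp (- (m - m0))"
    have "(m - m0) * 1 \<le> (m - m0) * sqrt 2" using m by (intro mult_left_mono) auto
    then have e: "exp (- (m - m0) * sqrt (2 * 1)) \<le> ?E" by (simp add: algebra_simps)
    have "cmod (airy_node h m \<zeta>) \<le> C * h / sqrt (2 * 1) * exp (- (m - m0) * sqrt (2 * 1)) / (1\<^sup>2 + (h * Im \<zeta>)\<^sup>2)"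
      using h \<zeta> m by (intro bd) auto
    also have "\<dots> \<le> C * h / 1 * ?E / (h\<^sup>2 * (1 + (Im \<zeta>)\<^sup>2))"
    proof (intro frac_le mult_mono e)
      have "h\<^sup>2 \<le> 1" using h by (simp add: power_le_one)
      then show "h\<^sup>2 * (1 + (Im \<zeta>)\<^sup>2) \<le> 1\<^sup>2 + (h * Im \<zeta>)\<^sup>2"
        by (simp add: distrib_left power_mult_distrib)
      show "0 < h\<^sup>2 * (1 + (Im \<zeta>)\<^sup>2)" using h by (intro mult_pos_pos add_pos_nonneg) auto
    qed (use C h in auto)
    also have "\<dots> = C / h * ?E / (1 + (Im \<zeta>)\<^sup>2)" using h by (simp add: power2_eq_square)
    finally show ?thesis .
  qed
  then show ?thesis using C by blast
qed

text \<open>The Airy value is the constant Laurent coefficient of the lattice sum, and on a circle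
  deep inside the annulus a function differs from that coefficient by little: the other coefficients
  are suppressed by the ratios of the radii.\<close>

lemma airy_sum_close:
  "\<exists>C>0. \<forall>h z m. 0 < h \<and> h \<le> 1 \<and> cmod z = exp (- 2 / h) \<and> m0 \<le> m \<longrightarrow>
     cmod (disc_sum (airy_node h m) z - of_real (airy_Ai m)) \<le> C / h * exp (- 1 / h) * exp (- (m - m0))"
proof -
  from airy_node_uniform_bound[of m0] obtain C where C': "0 < C \<and> (\<forall>h \<zeta> m. 0 < h \<and> h \<le> 1 \<and> 1 \<le> h * Re \<zeta> \<and> h * Re \<zeta> \<le> 4 \<and> m0 \<le> m \<longrightarrow>
     cmod (airy_node h m \<zeta>) \<le> C / h * exp (- (m - m0)) / (1 + (Im \<zeta>)\<^sup>2))" ..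
  note C = conjunct1[OF C'] and bd = conjunct2[OF C', rule_format]
  have "cmod (disc_sum (airy_node h m) z - of_real (airy_Ai m)) \<le> 4 * C * disc_const / h * exp (- 1 / h) * exp (- (m - m0))"
    if h: "0 < h" "h \<le> 1" and z: "cmod z = exp (- 2 / h)" and m: "m0 \<le> m" for h z m
  proof -
    define M where "M = C / h * exp (- (m - m0)) * disc_const"
    have M: "0 \<le> M" using C h disc_const_pos by (simp add: M_def)
    have circ: "cmod (disc_sum (airy_node h m) v) \<le> M" if v: "cmod v = exp (- (c / h))" and c: "1 \<le> c" "c \<le> 4" for v c
      unfolding M_def
    proof (rule disc_sum_bound)
      show "v \<noteq> 0" using v exp_gt_zero[of "- (c / h)"] by auto
      show "cmod (airy_node h m \<xi>) \<le> C / h * exp (- (m - m0)) / (1 + (Im \<xi>)\<^sup>2)" if "Re \<xi> = - ln (cmod v)" for \<xi>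
        using that v c h m by (intro bd) auto
    qed
    \<comment> \<open>The three radii are e^4 < e^2 < e. As e is at most 1/2, both e^2 / (e - e^2)
      and e^4 / (e^2 - e^4) are at most 2 e.\<close>
    define e where "e = exp (- 1 / h)"
    have "- 1 / h \<le> - 1" using h by (simp add: field_simps)
    then have "e \<le> exp (- 1)" by (simp add: e_def)
    also have "exp (- 1 :: real) \<le> 1 / 2"
      using exp_ge_add_one_self[of 1] by (simp add: exp_minus field_simps)
    finally have e: "0 < e" "e \<le> 1/2" by (auto simp: e_def)
    have r: "exp (- (4 / h)) = e ^ 4" "exp (- 2 / h) = e\<^sup>2" "exp (- (1 / h)) = e"
      by (auto simp: e_def exp_of_nat_mult[symmetric])
    have e12: "e\<^sup>2 < e" "e ^ 4 < e\<^sup>2" "e < 1"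
    proof -
      show "e < 1" using e by simp
      then show "e\<^sup>2 < e" using power_strict_decreasing[of 1 2 e] e by simp
      show "e ^ 4 < e\<^sup>2" using power_strict_decreasing[of 2 4 e] \<open>e < 1\<close> e by simp
    qed
    have "cmod (disc_sum (airy_node h m) z - contour_integral (circlepath 0 e) (\<lambda>v. disc_sum (airy_node h m) v / v) / (2 * of_real pi * \<i>))
        \<le> M * cmod z / (e - cmod z) + M * e ^ 4 / (cmod z - e ^ 4)"
    proof (rule laurent_mean_estimate)
      show "disc_sum (airy_node h m) holomorphic_on ball 0 1 - {0}"
        by (rule holomorphic_disc_sum[OF airy_node_decay[OF h(1)]])
      show "cmod (disc_sum (airy_node h m) v) \<le> M" if "cmod v = e ^ 4" for v
        using circ[of v 4] that r(1) by simp
      show "cmod (disc_sum (airy_node h m) v) \<le> M" if "cmod v = e" for v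
        using circ[of v 1] that r(3) by simp
    qed (use e e12 z r in auto)
    also have "contour_integral (circlepath 0 e) (\<lambda>v. disc_sum (airy_node h m) v / v) / (2 * of_real pi * \<i>) = of_real (airy_Ai m)"
      by (rule airy_node_mean) (use h e in auto)
    also have "M * cmod z / (e - cmod z) + M * e ^ 4 / (cmod z - e ^ 4) \<le> M * (2 * e) + M * (2 * e)"
    proof (rule add_mono)
      have "e\<^sup>2 \<le> 2 * e * (e - e\<^sup>2)" using e mult_left_mono[OF e(2), of "2 * e\<^sup>2"] by (simp add: power2_eq_square algebra_simps)
      then have "e\<^sup>2 / (e - e\<^sup>2) \<le> 2 * e" using e12 by (simp add: divide_le_eq)
      from mult_left_mono[OF this M] show "M * cmod z / (e - cmod z) \<le> M * (2 * e)" unfolding z r by simp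
      have "e ^ 4 \<le> 2 * e * (e\<^sup>2 - e ^ 4)"
      proof -
        have e3: "0 \<le> e ^ 3" using e by simp
        have "e * e ^ 3 \<le> 1/2 * e ^ 3" using e by (intro mult_right_mono) auto
        moreover have "e * e \<le> 1/2 * (1/2)" using e by (intro mult_mono) auto
        then have "e * e * e ^ 3 \<le> 1/4 * e ^ 3" using e3 by (intro mult_right_mono) auto
        ultimately show ?thesis using e3 by (simp add: algebra_simps eval_nat_numeral)
      qed
      then have "e ^ 4 / (e\<^sup>2 - e ^ 4) \<le> 2 * e" using e12 by (simp add: divide_le_eq)
      from mult_left_mono[OF this M] show "M * e ^ 4 / (cmod z - e ^ 4) \<le> M * (2 * e)" unfolding z r by simp
    qed
    also have "\<dots> = 4 * C * disc_const / h * exp (- 1 / h) * exp (- (m - m0))"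
      by (simp add: M_def e_def)
    finally show ?thesis .
  qed
  then show ?thesis using C disc_const_pos by (intro exI[of _ "4 * C * disc_const"]) auto
qed

lemma norm_exp_minus_1_le: "cmod (exp w - 1) \<le> cmod w * exp (cmod w)"
proof -
  have "cmod (exp w - exp 0) \<le> exp (cmod w) * cmod (w - 0)"
  proof (rule field_differentiable_bound[of "cball 0 (cmod w)"])
    fix v :: complex assume "v \<in> cball 0 (cmod w)"
    then show "cmod (exp v) \<le> exp (cmod w)"
      using complex_Re_le_cmod[of v] by (simp add: norm_exp_eq_Re)
    show "(exp has_field_derivative exp v) (at v within cball 0 (cmod w))"
      by (rule DERIV_subset[OF DERIV_exp]) simp
  qed auto
  then show ?thesis by (simp add: mult.commute)
qed

text \<open>On this circle Re \<zeta> = 2 / h, so Q is O(exp (- 2 / h)) and the factor exp (- Q)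
  differs from 1 by as little. The rate is relaxed to exp (- 1 / h) to match the error of the Airy
  sum.\<close>

lemma tasep_sum_close:
  "\<exists>C>0. \<forall>h z m. 0 < h \<and> h \<le> 1 \<and> cmod z = exp (- 2 / h) \<and> m0 \<le> m \<longrightarrow>
     cmod (disc_sum (tasep_node h m) z - disc_sum (airy_node h m) z) \<le> C / h * exp (- 1 / h) * exp (- (m - m0))"
proof -
  from airy_node_uniform_bound[of m0] obtain C where C': "0 < C \<and> (\<forall>h \<zeta> m. 0 < h \<and> h \<le> 1 \<and> 1 \<le> h * Re \<zeta> \<and> h * Re \<zeta> \<le> 4 \<and> m0 \<le> m \<longrightarrow>
     cmod (airy_node h m \<zeta>) \<le> C / h * exp (- (m - m0)) / (1 + (Im \<zeta>)\<^sup>2))" ..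
  note C = conjunct1[OF C'] and bd = conjunct2[OF C', rule_format]
  have "0 < (1::real)" by simp
  from q_fun_bound[OF this] obtain D where D': "0 < D \<and> (\<forall>\<zeta>. 1 \<le> Re \<zeta> \<longrightarrow> cmod (q_fun \<zeta>) \<le> D * exp (- Re \<zeta>))" ..
  note D = conjunct1[OF D'] and qb = conjunct2[OF D', rule_format]
  define K where "K = C * D * exp D * disc_const"
  have K: "0 < K" using C D disc_const_pos by (simp add: K_def)
  have "cmod (disc_sum (tasep_node h m) z - disc_sum (airy_node h m) z) \<le> K / h * exp (- 1 / h) * exp (- (m - m0))"
    if h: "0 < h" "h \<le> 1" and z: "cmod z = exp (- 2 / h)" and m: "m0 \<le> m" for h z m
  proof -
    have z0: "z \<noteq> 0" using z exp_gt_zero[of "- 2 / h"] by auto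
    have ReL: "Re (- Ln z) = 2 / h" using z0 z by (simp add: Re_Ln)
    have "1 / h \<ge> 1" using h by (simp add: field_simps)
    let ?d = "\<lambda>\<zeta>. tasep_node h m \<zeta> - airy_node h m \<zeta>"
    have bdd: "cmod (?d \<xi>) \<le> (C / h * exp (- (m - m0)) * (D * exp D * exp (- 1 / h))) / (1 + (Im \<xi>)\<^sup>2)"
      if \<xi>: "Re \<xi> = 2 / h" for \<xi>
    proof -
      have 1: "cmod (airy_node h m \<xi>) \<le> C / h * exp (- (m - m0)) / (1 + (Im \<xi>)\<^sup>2)"
        using h m \<xi> by (intro bd) auto
      have q: "cmod (q_fun \<xi>) \<le> D * exp (- 1 / h)"
      proof -
        have "cmod (q_fun \<xi>) \<le> D * exp (- (2 / h))" using qb[of \<xi>] \<xi> \<open>1 / h \<ge> 1\<close> by simp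
        also have "\<dots> \<le> D * exp (- 1 / h)" using D h by (intro mult_left_mono) (auto simp: field_simps)
        finally show ?thesis .
      qed
      have "D * exp (- 1 / h) \<le> D * 1" using D h by (intro mult_left_mono) auto
      with q have qD: "cmod (q_fun \<xi>) \<le> D" by simp
      have 2: "cmod (exp (- q_fun \<xi>) - 1) \<le> D * exp D * exp (- 1 / h)"
      proof -
        have "cmod (exp (- q_fun \<xi>) - 1) \<le> cmod (q_fun \<xi>) * exp (cmod (q_fun \<xi>))"
          using norm_exp_minus_1_le[of "- q_fun \<xi>"] by simp
        also have "\<dots> \<le> (D * exp (- 1 / h)) * exp D" using q qD D by (intro mult_mono) auto
        finally show ?thesis by (simp add: mult_ac)
      qed
      have "cmod (?d \<xi>) = cmod (airy_node h m \<xi>) * cmod (exp (- q_fun \<xi>) - 1)"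
        by (simp add: tasep_node_def right_diff_distrib flip: norm_mult)
      also have "\<dots> \<le> (C / h * exp (- (m - m0)) / (1 + (Im \<xi>)\<^sup>2)) * (D * exp D * exp (- 1 / h))"
        using order_trans[OF norm_ge_zero 1] by (intro mult_mono 1 2) auto
      finally show ?thesis by simp
    qed
    have intg: "integrable (count_space UNIV) (\<lambda>k::int. G (- Ln z + 2 * of_real pi * \<i> * of_int k))"
      if G: "halfplane_decay G" for G
    proof -
      obtain C where C: "\<And>\<xi>. 2 / h \<le> Re \<xi> \<and> Re \<xi> \<le> 2 / h \<Longrightarrow> cmod (G \<xi>) \<le> C / (1 + (Im \<xi>)\<^sup>2)"
        using G h unfolding halfplane_decay_def by (meson divide_pos_pos zero_less_numeral)
      show ?thesis
      proof (rule lattice_integrable)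
        show "cmod (G \<xi>) \<le> C / (1 + (Im \<xi>)\<^sup>2)" if "Re \<xi> = Re (- Ln z)" for \<xi>
          by (rule C) (simp only: that ReL order_refl)
      qed
    qed
    have "disc_sum (tasep_node h m) z - disc_sum (airy_node h m) z = disc_sum ?d z"
      unfolding disc_sum_def lattice_sum_def
      by (rule Bochner_Integration.integral_diff[symmetric]; rule intg)
        (rule tasep_node_decay[OF h(1)] airy_node_decay[OF h(1)])+
    also have "cmod \<dots> \<le> (C / h * exp (- (m - m0)) * (D * exp D * exp (- 1 / h))) * disc_const"
      by (rule disc_sum_bound[OF z0 bdd]) (simp add: z)
    also have "\<dots> = K / h * exp (- 1 / h) * exp (- (m - m0))" by (simp add: K_def)
    finally show ?thesis .
  qed
  then show ?thesis using K by blast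
qed

text \<open>Half of the exponent pays for the factor 1 / h; this is the origin of the rate exp (- 1
  / (2 h)).\<close>

lemma inverse_exp_absorb:
  assumes "0 < (h::real)" shows "1 / h * exp (- 1 / h) \<le> 2 * exp (- 1 / (2 * h))"
proof -
  have "1 / (2 * h) \<le> exp (1 / (2 * h))" using exp_ge_add_one_self[of "1 / (2 * h)"] by linarith
  then have "1 / h \<le> 2 * exp (1 / (2 * h))" by simp
  then have "1 / h * exp (- 1 / h) \<le> 2 * exp (1 / (2 * h)) * exp (- 1 / h)" by (intro mult_right_mono) auto
  also have "\<dots> = 2 * exp (- 1 / (2 * h))" by (simp add: field_simps flip: exp_add)
  finally show ?thesis .
qed

lemma kernel_entry_close:
  "\<exists>C>0. \<forall>h z m. 0 < h \<and> h \<le> 1 \<and> cmod z = exp (- 2 / h) \<and> m0 \<le> m \<longrightarrow>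
     cmod (disc_sum (tasep_node h m) z - of_real (airy_Ai m)) \<le> C * exp (- 1 / (2 * h)) * exp (- (m - m0))"
proof -
  from airy_sum_close[of m0] obtain C1 where C1': "0 < C1 \<and> (\<forall>h z m. 0 < h \<and> h \<le> 1 \<and> cmod z = exp (- 2 / h) \<and> m0 \<le> m \<longrightarrow>
     cmod (disc_sum (airy_node h m) z - of_real (airy_Ai m)) \<le> C1 / h * exp (- 1 / h) * exp (- (m - m0)))" ..
  from tasep_sum_close[of m0] obtain C2 where C2': "0 < C2 \<and> (\<forall>h z m. 0 < h \<and> h \<le> 1 \<and> cmod z = exp (- 2 / h) \<and> m0 \<le> m \<longrightarrow>
     cmod (disc_sum (tasep_node h m) z - disc_sum (airy_node h m) z) \<le> C2 / h * exp (- 1 / h) * exp (- (m - m0)))" ..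
  note C = conjunct1[OF C1'] conjunct1[OF C2'] and b1 = conjunct2[OF C1', rule_format] and b2 = conjunct2[OF C2', rule_format]
  have "cmod (disc_sum (tasep_node h m) z - of_real (airy_Ai m)) \<le> 2 * (C1 + C2) * exp (- 1 / (2 * h)) * exp (- (m - m0))"
    if *: "0 < h \<and> h \<le> 1 \<and> cmod z = exp (- 2 / h) \<and> m0 \<le> m" for h z m
  proof -
    have "cmod (disc_sum (tasep_node h m) z - of_real (airy_Ai m))
      \<le> C2 / h * exp (- 1 / h) * exp (- (m - m0)) + C1 / h * exp (- 1 / h) * exp (- (m - m0))"
      by (rule norm_diff_triangle_le[OF b2[OF *] b1[OF *]])
    also have "\<dots> = (C1 + C2) * exp (- (m - m0)) * (1 / h * exp (- 1 / h))"
      by (simp add: algebra_simps add_divide_distrib)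
    also have "\<dots> \<le> (C1 + C2) * exp (- (m - m0)) * (2 * exp (- 1 / (2 * h)))"
      using C * by (intro mult_left_mono inverse_exp_absorb) auto
    finally show ?thesis by (simp add: algebra_simps)
  qed
  then show ?thesis using C by (intro exI[of _ "2 * (C1 + C2)"]) auto
qed

text \<open>The closeness estimate along h = 1 / (n + 1) exhibits \<open>airy_Ai\<close> as a
  pointwise limit of lattice sums, which are measurable in m.\<close>

lemma airy_Ai_measurable: "(\<lambda>m. complex_of_real (airy_Ai m)) \<in> borel_measurable borel"
proof (rule borel_measurable_LIMSEQ_metric)
  define h where "h n = inverse (real (Suc n))" for n
  have h: "0 < h n" "h n \<le> 1" for n by (auto simp: h_def inverse_le_1_iff)
  define z where "z n = complex_of_real (exp (- 2 / h n))" for n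
  have z: "z n \<in> ball 0 1 - {0}" "cmod (z n) = exp (- 2 / h n)" for n using h[of n] by (auto simp: z_def)
  show "(\<lambda>m. disc_sum (tasep_node (h n) m) (z n)) \<in> borel_measurable borel" for n
    by (rule disc_sum_measurable[OF tasep_node_decay[OF h(1)] tasep_node_measurable z(1)])
  fix m
  from kernel_entry_close[of m] obtain C where C: "0 < C \<and> (\<forall>h z m'. 0 < h \<and> h \<le> 1 \<and> cmod z = exp (- 2 / h) \<and> m \<le> m' \<longrightarrow>
     cmod (disc_sum (tasep_node h m') z - of_real (airy_Ai m')) \<le> C * exp (- 1 / (2 * h)) * exp (- (m' - m)))" ..
  have "(\<lambda>n. disc_sum (tasep_node (h n) m) (z n) - of_real (airy_Ai m)) \<longlonglongrightarrow> 0"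
  proof (rule Lim_null_comparison)
    show "\<forall>\<^sub>F n in sequentially. cmod (disc_sum (tasep_node (h n) m) (z n) - of_real (airy_Ai m)) \<le> C * exp (- (real (Suc n) / 2))"
    proof (rule always_eventually, rule allI)
      fix n
      have "cmod (disc_sum (tasep_node (h n) m) (z n) - of_real (airy_Ai m)) \<le> C * exp (- 1 / (2 * h n)) * exp (- (m - m))"
        by (rule conjunct2[OF C, rule_format]) (use h z in auto)
      also have "\<dots> = C * exp (- (real (Suc n) / 2))" by (simp add: h_def field_simps)
      finally show "cmod (disc_sum (tasep_node (h n) m) (z n) - of_real (airy_Ai m)) \<le> C * exp (- (real (Suc n) / 2))" .
    qed
    have "(\<lambda>n. exp (- (real (Suc n) / 2))) \<longlonglongrightarrow> 0" by real_asymp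
    from tendsto_mult_right_zero[OF this] show "(\<lambda>n. C * exp (- (real (Suc n) / 2))) \<longlonglongrightarrow> 0" .
  qed
  then show "(\<lambda>n. disc_sum (tasep_node (h n) m) (z n)) \<longlonglongrightarrow> of_real (airy_Ai m)" by (simp add: LIM_zero_iff)
qed

definition airy_kernel :: "real \<Rightarrow> real \<Rightarrow> real \<Rightarrow> complex" where
  "airy_kernel m s t = of_real (airy_Ai (m + s + t))"

text \<open>With m = p x + s + t and p = 2^(2/3) \<ge> 1, the decay exp (- (m - p x0)) of the
  entries splits into exp (- (x - x0)) and the weight exp (- s) exp (- t). The first factor goes
  into the size of the difference, the second is the weight of the determinant bound.\<close>

lemma fredholm_det_close:
  "\<exists>C>0. \<forall>h z x. 0 < h \<and> h \<le> 1 \<and> cmod z = exp (- 2 / h) \<and> x0 \<le> x \<longrightarrow>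
     cmod (fredholm_det half_line (tasep_kernel h (2 powr (2/3) * x) z) - of_real (F_GOE (2 powr (2/3) * x)))
       \<le> C * exp (- 1 / (2 * h)) * exp (- (x - x0))"
proof -
  define p where "p = (2::real) powr (2/3)"
  have p: "1 \<le> p" unfolding p_def by (rule ge_one_powr_ge_zero) auto
  interpret weighted_space half_line "\<lambda>s. exp (- 1 * s)" by (rule weighted_half_line) simp
  from kernel_entry_close[of "p * x0"] obtain C1 where C1': "0 < C1 \<and> (\<forall>h z m. 0 < h \<and> h \<le> 1 \<and> cmod z = exp (- 2 / h) \<and> p * x0 \<le> m \<longrightarrow>
     cmod (disc_sum (tasep_node h m) z - of_real (airy_Ai m)) \<le> C1 * exp (- 1 / (2 * h)) * exp (- (m - p * x0)))" ..
  note C1 = conjunct1[OF C1'] and b1 = conjunct2[OF C1', rule_format]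
  \<comment> \<open>The decay of \<open>airy_Ai\<close> is read off at h = 1, where |z| = exp (- 2)
    and Re \<zeta> = 2: there the lattice sum is bounded directly, and it differs from
    \<open>airy_Ai\<close> by a decaying error.\<close>
  obtain C2 where C2: "0 \<le> C2" and b2: "\<And>m. p * x0 \<le> m \<Longrightarrow> cmod (of_real (airy_Ai m)) \<le> C2 * exp (- (m - p * x0))"
  proof -
    from tasep_node_strip_bound[of 1 2 2 "p * x0"] obtain K where K: "0 < K \<and> (\<forall>\<zeta> m. 2 \<le> Re \<zeta> \<and> Re \<zeta> \<le> 2 \<and> p * x0 \<le> m \<longrightarrow>
     cmod (tasep_node 1 m \<zeta>) \<le> K * exp (- (m - p * x0) * sqrt (2 * (1 * 2))) / (1 + (Im \<zeta>)\<^sup>2))" by auto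
    define z where "z = complex_of_real (exp (- 2 / 1))"
    have z: "cmod z = exp (- 2 / 1)" "z \<noteq> 0" by (auto simp: z_def)
    have "cmod (of_real (airy_Ai m)) \<le> (K * disc_const + C1) * exp (- (m - p * x0))" if m: "p * x0 \<le> m" for m
    proof -
      have "cmod (disc_sum (tasep_node 1 m) z) \<le> (K * exp (- (m - p * x0))) * disc_const"
      proof (rule disc_sum_bound[OF z(2)])
        fix \<xi> :: complex assume "Re \<xi> = - ln (cmod z)"
        then have \<xi>: "Re \<xi> = 2" by (simp add: z_def)
        have "(m - p * x0) * 1 \<le> (m - p * x0) * sqrt (2 * (1 * 2))" using m by (intro mult_left_mono) auto
        then have "K * exp (- (m - p * x0) * sqrt (2 * (1 * 2))) \<le> K * exp (- (m - p * x0))"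
          using K by (intro mult_left_mono) (auto simp: algebra_simps)
        then have "K * exp (- (m - p * x0) * sqrt (2 * (1 * 2))) / (1 + (Im \<xi>)\<^sup>2) \<le> K * exp (- (m - p * x0)) / (1 + (Im \<xi>)\<^sup>2)"
          by (rule divide_right_mono) simp
        moreover have "cmod (tasep_node 1 m \<xi>) \<le> K * exp (- (m - p * x0) * sqrt (2 * (1 * 2))) / (1 + (Im \<xi>)\<^sup>2)"
          by (rule conjunct2[OF K, rule_format]) (use \<xi> m in simp)
        ultimately show "cmod (tasep_node 1 m \<xi>) \<le> K * exp (- (m - p * x0)) / (1 + (Im \<xi>)\<^sup>2)" by (rule order_trans[rotated])
      qed
      moreover have "cmod (disc_sum (tasep_node 1 m) z - of_real (airy_Ai m)) \<le> C1 * exp (- 1 / (2 * 1)) * exp (- (m - p * x0))"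
        by (rule b1) (use z m in simp)
      moreover have "C1 * exp (- 1 / (2 * 1)) * exp (- (m - p * x0)) \<le> C1 * 1 * exp (- (m - p * x0))"
        using C1 by (intro mult_right_mono mult_left_mono) auto
      moreover have "cmod (of_real (airy_Ai m)) \<le> cmod (disc_sum (tasep_node 1 m) z) + cmod (disc_sum (tasep_node 1 m) z - of_real (airy_Ai m))"
        by (metis norm_minus_commute norm_triangle_sub)
      ultimately show ?thesis by (simp add: algebra_simps)
    qed
    moreover have "0 \<le> K * disc_const + C1" using K C1 disc_const_pos by simp
    ultimately show ?thesis using that by blast
  qed
  \<comment> \<open>A common bound for both kernels: C2 for the Airy kernel, and C1 on top for the
    distance of the other kernel from it.\<close>
  define C where "C = (C1 + C2) * 1"
  have C: "0 < C" using C1 C2 by (simp add: C_def)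
  from fredholm_det_diff_bound[OF C] obtain D where D: "0 < D \<and> (\<forall>K L e. case_prod K \<in> borel_measurable (half_line \<Otimes>\<^sub>M half_line)
    \<and> case_prod L \<in> borel_measurable (half_line \<Otimes>\<^sub>M half_line)
    \<and> kernel_le C K \<and> kernel_le C L \<and> kernel_le e (\<lambda>x y. K x y - L x y) \<and> 0 \<le> e
    \<longrightarrow> cmod (fredholm_det half_line K - fredholm_det half_line L) \<le> D * e)" ..
  have "cmod (fredholm_det half_line (tasep_kernel h (p * x) z) - of_real (F_GOE (p * x)))
       \<le> D * C1 * exp (- 1 / (2 * h)) * exp (- (x - x0))"
    if h: "0 < h" "h \<le> 1" and z: "cmod z = exp (- 2 / h)" and x: "x0 \<le> x" for h z x
  proof -
    have ex: "exp (- (p * x + s + t - p * x0)) \<le> exp (- (x - x0)) * (exp (- 1 * s) * exp (- 1 * t))" for s t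
    proof -
      have "1 * (x - x0) \<le> p * (x - x0)" using p x by (intro mult_right_mono) auto
      then show ?thesis by (simp add: algebra_simps flip: exp_add)
    qed
    have ex1: "exp (- (p * x + s + t - p * x0)) \<le> 1 * (exp (- 1 * s) * exp (- 1 * t))" for s t
      by (rule order_trans[OF ex mult_right_mono]) (use x in auto)
    have pm: "p * x0 \<le> p * x + s + t" if "s \<in> {0<..}" "t \<in> {0<..}" for s t
    proof -
      have "p * x0 \<le> p * x" by (rule mult_left_mono[OF x]) (use p in simp)
      then show ?thesis using that by (auto intro: add_increasing2)
    qed
    have eh: "exp (- 1 / (2 * h)) \<le> 1" using h by simp
    have close: "cmod (tasep_kernel h (p * x) z s t - airy_kernel (p * x) s t)
        \<le> C1 * exp (- 1 / (2 * h)) * exp (- (p * x + s + t - p * x0))" if "s \<in> {0<..}" "t \<in> {0<..}" for s t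
      unfolding tasep_kernel_def airy_kernel_def by (rule b1) (use h z pm[OF that] in simp)
    have ai: "cmod (airy_kernel (p * x) s t) \<le> C2 * exp (- (p * x + s + t - p * x0))" if "s \<in> {0<..}" "t \<in> {0<..}" for s t
      unfolding airy_kernel_def by (rule b2[OF pm[OF that]])
    have kd: "kernel_le (C1 * exp (- 1 / (2 * h)) * exp (- (x - x0))) (\<lambda>s t. tasep_kernel h (p * x) z s t - airy_kernel (p * x) s t)"
      unfolding kernel_le_def space_half_line
    proof (intro ballI)
      fix s t :: real assume st: "s \<in> {0<..}" "t \<in> {0<..}"
      have "C1 * exp (- 1 / (2 * h)) * exp (- (p * x + s + t - p * x0))
        \<le> C1 * exp (- 1 / (2 * h)) * (exp (- (x - x0)) * (exp (- 1 * s) * exp (- 1 * t)))"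
        using C1 by (intro mult_left_mono ex) auto
      with close[OF st] show "cmod (tasep_kernel h (p * x) z s t - airy_kernel (p * x) s t)
        \<le> C1 * exp (- 1 / (2 * h)) * exp (- (x - x0)) * (exp (- 1 * s) * exp (- 1 * t))"
        by (simp only: mult.assoc)
    qed
    have ka: "kernel_le C (airy_kernel (p * x))"
      unfolding kernel_le_def space_half_line
    proof (intro ballI)
      fix s t :: real assume st: "s \<in> {0<..}" "t \<in> {0<..}"
      have "C2 * exp (- (p * x + s + t - p * x0)) \<le> C * (1 * (exp (- 1 * s) * exp (- 1 * t)))"
        using C1 C2 ex1 by (intro mult_mono) (auto simp: C_def)
      with ai[OF st] show "cmod (airy_kernel (p * x) s t) \<le> C * (exp (- 1 * s) * exp (- 1 * t))" by simp
    qed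
    have kt: "kernel_le C (tasep_kernel h (p * x) z)"
      unfolding kernel_le_def space_half_line
    proof (intro ballI)
      fix s t :: real assume st: "s \<in> {0<..}" "t \<in> {0<..}"
      let ?E = "exp (- (p * x + s + t - p * x0))"
      have "cmod (tasep_kernel h (p * x) z s t) \<le> cmod (tasep_kernel h (p * x) z s t - airy_kernel (p * x) s t) + cmod (airy_kernel (p * x) s t)"
        by (metis diff_add_cancel norm_triangle_ineq)
      also have "\<dots> \<le> C1 * exp (- 1 / (2 * h)) * ?E + C2 * ?E" by (intro add_mono close ai st)
      also have "\<dots> \<le> C1 * 1 * ?E + C2 * ?E"
        using C1 eh by (intro add_mono mult_right_mono mult_left_mono order_refl) auto
      also have "\<dots> = C * ?E" by (simp add: C_def algebra_simps)
      also have "\<dots> \<le> C * (1 * (exp (- 1 * s) * exp (- 1 * t)))" using C by (intro mult_left_mono ex1) auto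
      finally show "cmod (tasep_kernel h (p * x) z s t) \<le> C * (exp (- 1 * s) * exp (- 1 * t))" by simp
    qed
    have "z \<in> ball 0 1 - {0}" using z h by (auto simp: dest: sym)
    have mt: "case_prod (tasep_kernel h (p * x) z) \<in> borel_measurable (half_line \<Otimes>\<^sub>M half_line)"
      by (rule tasep_kernel_measurable) fact+
    have ma: "case_prod (airy_kernel (p * x)) \<in> borel_measurable (half_line \<Otimes>\<^sub>M half_line)"
      unfolding airy_kernel_def[abs_def] by (rule half_line_sum_measurable[OF airy_Ai_measurable])
    have "cmod (fredholm_det half_line (tasep_kernel h (p * x) z) - fredholm_det half_line (airy_kernel (p * x)))
      \<le> D * (C1 * exp (- 1 / (2 * h)) * exp (- (x - x0)))"
      by (rule conjunct2[OF D, rule_format]) (use mt ma kt ka kd C1 in simp)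
    moreover have "fredholm_det half_line (airy_kernel (p * x)) = of_real (F_GOE (p * x))"
    proof -
      have e: "airy_kernel (p * x) = (\<lambda>s t. of_real (airy_Ai (s + p * x + t)))"
        by (simp add: airy_kernel_def fun_eq_iff add.commute[of "p * x"])
      show ?thesis
        using summable_fredholm[OF ka less_imp_le[OF C]] unfolding e F_GOE_def by (rule fredholm_det_of_real)
    qed
    ultimately show ?thesis by (simp add: mult_ac)
  qed
  then show ?thesis using D C1 unfolding p_def by (intro exI[of _ "D * C1"]) auto
qed

section \<open>Comparison of the contour integrals\<close>

lemma F1_eq_contour:
  assumes \<tau>: "0 < \<tau>" and R: "0 < R" "R < 1" and r: "0 < r" "r < 1"
  shows "F1 R (\<tau> powr (1/3) * x) \<tau> = contour_integral (circlepath 0 r)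
    (\<lambda>z. prefactor (\<tau> powr (1/3) * x) \<tau> z * fredholm_det half_line (tasep_kernel ((2 * \<tau>) powr (2/3)) (2 powr (2/3) * x) z)
      / (2 * of_real pi * \<i> * z))" (is "_ = contour_integral _ ?f")
proof -
  have "F1 R (\<tau> powr (1/3) * x) \<tau> = contour_integral (circlepath 0 R) ?f"
    unfolding F1_def
  proof (rule contour_integral_cong[OF refl])
    fix z assume "z \<in> path_image (circlepath 0 R)"
    then have "z \<in> ball 0 1 - {0}" using R by auto
    from fredholm_det_K1[OF \<tau> this, of x]
    show "exp (of_real (\<tau> powr (1/3) * x) * A1 z + of_real \<tau> * A2 z + A3 z + B_fun z)
        * fredholm_det (count_space (S_minus z)) (K1 (\<tau> powr (1/3) * x) \<tau>) / (2 * of_real pi * \<i> * z) = ?f z"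
      by (simp only: prefactor_def)
  qed
  also have "\<dots> = contour_integral (circlepath 0 r) ?f"
  proof (rule punctured_circle_independent[OF _ R r])
    have "prefactor (\<tau> powr (1/3) * x) \<tau> holomorphic_on ball 0 1 - {0}"
      by (rule holomorphic_on_subset[OF prefactor_holomorphic]) auto
    moreover have "(\<lambda>z. fredholm_det half_line (tasep_kernel ((2 * \<tau>) powr (2/3)) (2 powr (2/3) * x) z)) holomorphic_on ball 0 1 - {0}"
      by (rule tasep_det_holomorphic) (use \<tau> in simp)
    ultimately show "?f holomorphic_on ball 0 1 - {0}"
      by (intro holomorphic_on_divide holomorphic_on_mult holomorphic_on_const holomorphic_on_ident) auto
  qed
  finally show ?thesis .
qed

text \<open>Keeping the constant c under the integral gives it the same prefactor as the
  determinant, so the two integrands can be subtracted pointwise. The value comes from Cauchy's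
  formula at 0.\<close>

lemma prefactor_mean:
  assumes "0 < r" "r < 1"
  shows "((\<lambda>z. prefactor x \<tau> z * c / (2 * of_real pi * \<i> * z)) has_contour_integral c) (circlepath 0 r)"
proof -
  have h: "prefactor x \<tau> holomorphic_on cball 0 r"
    by (rule holomorphic_on_subset[OF prefactor_holomorphic]) (use assms in auto)
  have "((\<lambda>u. prefactor x \<tau> u / (u - 0)) has_contour_integral (2 * of_real pi * \<i> * prefactor x \<tau> 0)) (circlepath 0 r)"
    by (rule Cauchy_integral_circlepath)
      (use assms in \<open>auto intro: holomorphic_on_imp_continuous_on[OF h] holomorphic_on_subset[OF h ball_subset_cball]\<close>)
  from has_contour_integral_lmul[OF this, of "c / (2 * of_real pi * \<i>)"]
  show ?thesis by (simp add: prefactor_0 mult.commute)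
qed

text \<open>The prefactor may grow in x at rate 1/2, while the difference of the determinants decays
  at rate 1; the remaining rate is 1/2. The growth is measured through |x| \<le> (x - x0) + |x0|,
  which puts exp (|x0| / 2) into the constant.\<close>

lemma F1_close:
  "\<exists>C>0. \<forall>R \<tau> x. 0 < R \<and> R < 1 \<and> 0 < \<tau> \<and> \<tau> < 1/2 \<and> x0 \<le> x \<longrightarrow>
     cmod (F1 R (\<tau> powr (1/3) * x) \<tau> - of_real (F_GOE (2 powr (2/3) * x)))
       \<le> C * exp (- (1/2 * 2 powr (- (2/3))) * \<tau> powr (- (2/3))) * exp (- (1/2) * (x - x0))"
proof -
  from fredholm_det_close[of x0] obtain C1 where C1': "0 < C1 \<and> (\<forall>h z x. 0 < h \<and> h \<le> 1 \<and> cmod z = exp (- 2 / h) \<and> x0 \<le> x \<longrightarrow>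
     cmod (fredholm_det half_line (tasep_kernel h (2 powr (2/3) * x) z) - of_real (F_GOE (2 powr (2/3) * x)))
       \<le> C1 * exp (- 1 / (2 * h)) * exp (- (x - x0)))" ..
  note C1 = conjunct1[OF C1'] and b1 = conjunct2[OF C1', rule_format]
  from prefactor_bound obtain C2 where C2': "0 < C2 \<and> (\<forall>x \<tau> z. 0 \<le> \<tau> \<and> \<tau> \<le> 1 \<and> cmod z \<le> 1/2 \<longrightarrow> cmod (prefactor x \<tau> z) \<le> C2 * exp (2 * \<bar>x\<bar> * cmod z))" ..
  note C2 = conjunct1[OF C2'] and b2 = conjunct2[OF C2', rule_format]
  define C where "C = C2 * exp (1/2 * \<bar>x0\<bar>) * C1"
  have C: "0 < C" using C1 C2 by (simp add: C_def)
  have "cmod (F1 R (\<tau> powr (1/3) * x) \<tau> - of_real (F_GOE (2 powr (2/3) * x)))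
       \<le> C * exp (- (1/2 * 2 powr (- (2/3))) * \<tau> powr (- (2/3))) * exp (- (1/2) * (x - x0))"
    if R: "0 < R" "R < 1" and \<tau>: "0 < \<tau>" "\<tau> < 1/2" and x: "x0 \<le> x" for R \<tau> x
  proof -
    define h where "h = (2 * \<tau>) powr (2/3)"
    define X where "X = \<tau> powr (1/3) * x"
    define r where "r = exp (- 2 / h)"
    define F where "F = complex_of_real (F_GOE (2 powr (2/3) * x))"
    define D where "D = (\<lambda>z. fredholm_det half_line (tasep_kernel h (2 powr (2/3) * x) z))"
    define e where "e = C1 * exp (- 1 / (2 * h)) * exp (- (x - x0))"
    \<comment> \<open>The condition \<open>\<tau>\<close> < 1/2 is exactly what makes h at most
      1.\<close>
    have h: "0 < h" "h \<le> 1" using \<tau> by (auto simp: h_def intro!: powr_le1)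
    have hinv: "1 / (2 * h) = 1/2 * 2 powr (- (2/3)) * \<tau> powr (- (2/3))"
      unfolding h_def using \<tau> by (simp add: powr_mult powr_minus_divide)
    have "2 \<le> 2 / h" using h by (simp add: field_simps)
    then have "r \<le> exp (- 2)" by (simp add: r_def)
    \<comment> \<open>The bound 1/4 on the radius turns the growth exp (2 |X| r) of the prefactor
      into at most exp (|X| / 2).\<close>
    also have "exp (- 2 :: real) \<le> 1 / 4"
    proof -
      have "(2::real) * 2 \<le> exp 1 * exp 1" using exp_ge_add_one_self[of 1] by (intro mult_mono) auto
      then show ?thesis by (simp add: exp_minus field_simps flip: exp_add)
    qed
    finally have "r \<le> 1/4" .
    moreover have "0 < r" by (simp add: r_def)
    ultimately have r: "0 < r" "r \<le> 1/4" "r < 1" by simp_all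
    have e: "0 \<le> e" using C1 by (simp add: e_def)
    have "\<tau> powr (1/3) \<le> 1" using \<tau> by (intro powr_le1) auto
    then have "\<bar>X\<bar> \<le> 1 * \<bar>x\<bar>" unfolding X_def abs_mult by (intro mult_right_mono) auto
    also have "\<dots> \<le> (x - x0) + \<bar>x0\<bar>" using x by linarith
    finally have X: "\<bar>X\<bar> \<le> (x - x0) + \<bar>x0\<bar>" .
    have pre: "cmod (prefactor X \<tau> z) \<le> C2 * exp (1/2 * \<bar>x0\<bar>) * exp (1/2 * (x - x0))" if z: "cmod z = r" for z
    proof -
      have "cmod (prefactor X \<tau> z) \<le> C2 * exp (2 * \<bar>X\<bar> * cmod z)"
        by (rule b2) (use \<tau> r z in auto)
      also have "\<dots> \<le> C2 * exp (1/2 * \<bar>x0\<bar> + 1/2 * (x - x0))"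
      proof -
        have "2 * \<bar>X\<bar> * r \<le> 2 * \<bar>X\<bar> * (1/4)" using r by (intro mult_left_mono) auto
        also have "\<dots> = 1/2 * \<bar>X\<bar>" by simp
        also have "\<dots> \<le> 1/2 * ((x - x0) + \<bar>x0\<bar>)" using X by (rule mult_left_mono) simp
        also have "\<dots> = 1/2 * \<bar>x0\<bar> + 1/2 * (x - x0)" by (simp only: distrib_left add.commute)
        finally show ?thesis using C2 z by simp
      qed
      finally show ?thesis by (simp add: exp_add)
    qed
    let ?f = "\<lambda>z. prefactor X \<tau> z * D z / (2 * of_real pi * \<i> * z)"
    let ?g = "\<lambda>z. prefactor X \<tau> z * F / (2 * of_real pi * \<i> * z)"
    have F1: "F1 R X \<tau> = contour_integral (circlepath 0 r) ?f"
      unfolding X_def D_def h_def by (rule F1_eq_contour) (use \<tau> R r in auto)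
    have "?f contour_integrable_on circlepath 0 r"
    proof (rule punctured_circle_integrable[OF _ r(1,3)])
      have "prefactor X \<tau> holomorphic_on ball 0 1 - {0}"
        by (rule holomorphic_on_subset[OF prefactor_holomorphic]) auto
      moreover have "D holomorphic_on ball 0 1 - {0}"
        unfolding D_def by (rule tasep_det_holomorphic[OF h(1)])
      ultimately show "?f holomorphic_on ball 0 1 - {0}"
        by (intro holomorphic_on_divide holomorphic_on_mult holomorphic_on_const holomorphic_on_ident) auto
    qed
    then have "(?f has_contour_integral F1 R X \<tau>) (circlepath 0 r)"
      unfolding F1 by (rule has_contour_integral_integral)
    from has_contour_integral_diff[OF this prefactor_mean[OF r(1,3), of X \<tau> F]]
    have int: "((\<lambda>z. ?f z - ?g z) has_contour_integral (F1 R X \<tau> - F)) (circlepath 0 r)" .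
    let ?B = "C2 * exp (1/2 * \<bar>x0\<bar>) * exp (1/2 * (x - x0)) * e"
    have "cmod (F1 R X \<tau> - F) \<le> ?B / (2 * pi * r) * (2 * pi * r)"
    proof (rule has_contour_integral_bound_circlepath[OF int])
      show "0 \<le> ?B / (2 * pi * r)" using C2 e r by simp
      fix z assume "cmod (z - 0) = r"
      then have z: "cmod z = r" by simp
      have "?f z - ?g z = prefactor X \<tau> z * (D z - F) / (2 * of_real pi * \<i> * z)"
        by (simp add: diff_divide_distrib right_diff_distrib)
      also have "cmod \<dots> = cmod (prefactor X \<tau> z) * cmod (D z - F) / (2 * pi * r)"
        by (simp add: norm_mult norm_divide z)
      also have "\<dots> \<le> ?B / (2 * pi * r)"
      proof (intro divide_right_mono mult_mono pre z)
        show "cmod (D z - F) \<le> e"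
          unfolding D_def F_def e_def by (rule b1) (use h z x in \<open>simp add: r_def\<close>)
      qed (use C2 r in auto)
      finally show "cmod (?f z - ?g z) \<le> ?B / (2 * pi * r)" .
    qed (rule r(1))
    also have "\<dots> = ?B" using r by simp
    also have "?B = C * exp (- (1 / (2 * h))) * (exp (1/2 * (x - x0)) * exp (- (x - x0)))"
      by (simp add: C_def e_def)
    also have "exp (1/2 * (x - x0)) * exp (- (x - x0)) = exp (- (1/2) * (x - x0))"
      unfolding exp_add[symmetric] by (rule arg_cong[where f = exp]) (simp add: field_simps)
    finally show ?thesis unfolding hinv X_def F_def by simp
  qed
  then show ?thesis using C by blast
qed

theorem theorem8p2:
  shows "(\<forall>x0::real. \<exists>C>0. \<exists>c>0. \<exists>\<epsilon>>0. \<exists>\<tau>0>0.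
            \<forall>R \<tau> x. 0 < R \<and> R < 1 \<and> 0 < \<tau> \<and> \<tau> < \<tau>0 \<and> x0 \<le> x \<longrightarrow>
              cmod (F1 R (\<tau> powr (1/3) * x) \<tau> - of_real (F_GOE (2 powr (2/3) * x)))
                \<le> C * exp (- \<epsilon> * \<tau> powr (- (2/3))) * exp (- c * (x - x0)))
       \<and> (\<forall>R x. 0 < R \<and> R < 1 \<longrightarrow>
            ((\<lambda>\<tau>. F1 R (\<tau> powr (1/3) * x) \<tau>)
               \<longlongrightarrow> of_real (F_GOE (2 powr (2/3) * x))) (at_right 0))"
proof (intro conjI allI impI)
  define \<epsilon> :: real where "\<epsilon> = 1/2 * 2 powr (- (2/3))"
  have \<epsilon>: "0 < \<epsilon>" by (simp add: \<epsilon>_def)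
  note close = F1_close[folded \<epsilon>_def]
  show "\<exists>C>0. \<exists>c>0. \<exists>\<epsilon>>0. \<exists>\<tau>0>0.
            \<forall>R \<tau> x. 0 < R \<and> R < 1 \<and> 0 < \<tau> \<and> \<tau> < \<tau>0 \<and> x0 \<le> x \<longrightarrow>
              cmod (F1 R (\<tau> powr (1/3) * x) \<tau> - of_real (F_GOE (2 powr (2/3) * x)))
                \<le> C * exp (- \<epsilon> * \<tau> powr (- (2/3))) * exp (- c * (x - x0))" for x0 :: real
  proof -
    from close[of x0] obtain C where C: "0 < C \<and> (\<forall>R \<tau> x. 0 < R \<and> R < 1 \<and> 0 < \<tau> \<and> \<tau> < 1/2 \<and> x0 \<le> x \<longrightarrow>
      cmod (F1 R (\<tau> powr (1/3) * x) \<tau> - of_real (F_GOE (2 powr (2/3) * x)))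
       \<le> C * exp (- \<epsilon> * \<tau> powr (- (2/3))) * exp (- (1/2) * (x - x0)))" ..
    have half: "(0::real) < 1/2" by simp
    show ?thesis
      by (rule exI[of _ C], rule conjI[OF conjunct1[OF C]], rule exI[of _ "1/2"], rule conjI[OF half],
          rule exI[of _ \<epsilon>], rule conjI[OF \<epsilon>], rule exI[of _ "1/2"], rule conjI[OF half conjunct2[OF C]])
  qed
  fix R x :: real assume R: "0 < R \<and> R < 1"
  \<comment> \<open>For the limit at a fixed point x, that point is taken as \<open>x0\<close>, so
    the factor in x - x0 becomes 1.\<close>
  from close[of x] obtain C where C: "0 < C \<and> (\<forall>R \<tau> x'. 0 < R \<and> R < 1 \<and> 0 < \<tau> \<and> \<tau> < 1/2 \<and> x \<le> x' \<longrightarrow>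
      cmod (F1 R (\<tau> powr (1/3) * x') \<tau> - of_real (F_GOE (2 powr (2/3) * x')))
       \<le> C * exp (- \<epsilon> * \<tau> powr (- (2/3))) * exp (- (1/2) * (x' - x)))" ..
  have "((\<lambda>\<tau>. F1 R (\<tau> powr (1/3) * x) \<tau> - of_real (F_GOE (2 powr (2/3) * x))) \<longlongrightarrow> 0) (at_right 0)"
  proof (rule Lim_null_comparison)
    have "filterlim (\<lambda>\<tau>::real. \<tau> powr (- (2/3))) at_top (at_right 0)" by real_asymp
    then have "filterlim (\<lambda>\<tau>::real. \<epsilon> * \<tau> powr (- (2/3))) at_top (at_right 0)"
      by (rule filterlim_tendsto_pos_mult_at_top[OF tendsto_const \<epsilon>])
    then have "filterlim (\<lambda>\<tau>::real. - \<epsilon> * \<tau> powr (- (2/3))) at_bot (at_right 0)"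
      by (simp add: filterlim_uminus_at_bot)
    from filterlim_compose[OF exp_at_bot this]
    show "((\<lambda>\<tau>. C * exp (- \<epsilon> * \<tau> powr (- (2/3)))) \<longlongrightarrow> 0) (at_right 0)"
      by (rule tendsto_mult_right_zero)
    show "\<forall>\<^sub>F \<tau> in at_right 0. cmod (F1 R (\<tau> powr (1/3) * x) \<tau> - of_real (F_GOE (2 powr (2/3) * x)))
        \<le> C * exp (- \<epsilon> * \<tau> powr (- (2/3)))"
      unfolding eventually_at_right_field
    proof (intro exI[of _ "1/2 :: real"] conjI allI impI)
      fix \<tau> :: real assume "0 < \<tau>" "\<tau> < 1/2"
      then have "cmod (F1 R (\<tau> powr (1/3) * x) \<tau> - of_real (F_GOE (2 powr (2/3) * x)))
        \<le> C * exp (- \<epsilon> * \<tau> powr (- (2/3))) * exp (- (1/2) * (x - x))"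
        by (intro conjunct2[OF C, rule_format]) (use R in simp)
      then show "cmod (F1 R (\<tau> powr (1/3) * x) \<tau> - of_real (F_GOE (2 powr (2/3) * x)))
        \<le> C * exp (- \<epsilon> * \<tau> powr (- (2/3)))" by simp
    qed simp
  qed
  then show "((\<lambda>\<tau>. F1 R (\<tau> powr (1/3) * x) \<tau>) \<longlongrightarrow> of_real (F_GOE (2 powr (2/3) * x))) (at_right 0)"
    by (simp add: LIM_zero_iff)
qed

end
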